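(* Let $D\subset\check D=G_{\mathbb C}/P_0$ be a Mumford–Tate domain, let $\mathcal O_{\mathrm{cl}}\subset\check D$ be the unique closed $G_{\mathbb R}$-orbit, and assume that $\mathcal O_{\mathrm{cl}}$ is polarizable relative to $D$. Let $(V,W_\bullet(N),F^\bullet)$ be a limiting mixed Hodge structure for $D$ whose reduced limit period $F^\bullet_\infty$ lies in $\mathcal O_{\mathrm{cl}}$, and let $(\mathfrak g,W_\bullet(N)_{\mathfrak g},F^\bullet_{\mathfrak g})$ be the associated adjoint limiting mixed Hodge structure. The following are equivalent: (a) The orbit $\mathcal O_{\mathrm{cl}}$ is totally real; i.e. its Cauchy–Riemann tangent space vanishes, $T^{\mathrm{CR}}\mathcal O_{\mathrm{cl}}=0$. (b) $\dim_{\mathbb R}\mathcal O_{\mathrm{cl}}=\dim_{\mathbb C}\check D$. (c) The stabilizer $P=\mathrm{Stab}_{G_{\mathbb C}}(F^\bullet_\infty)$ is $\mathbb R$-split (i.e. defined over $\mathbb R$) and $\mathcal O_{\mathrm{cl}}=G_{\mathbb R}/P_{\mathbb R}$. Any of these implies that the limiting mixed Hodge structures $(V,W_\bullet(N),F^\bullet)$ and $(\mathfrak g,W_\bullet(N)_{\mathfrak g},F^\bullet_{\mathfrak g})$ are of Hodge–Tate type.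
   Context: A polarized Hodge structure of weight $n$ is $(V,Q,F^\bullet)$ with $V$ a real vector space (with rational structure), $Q$ a nondegenerate $(-1)^n$-symmetric bilinear form, and $F^n\subset\dots\subset F^0=V_{\mathbb C}$ with $F^p\oplus\overline{F^{n-p+1}}=V_{\mathbb C}$, $Q(F^p,F^{n-p+1})=0$, and $Q(Cv,\bar v)>0$ for $v\neq0$, where $C=i^{p-q}$ on $V^{p,q}=F^p\cap\overline{F^q}$. A Mumford–Tate domain $D=G_{\mathbb R}/R$ is the $G_{\mathbb R}$-orbit of a polarized Hodge structure $(V,Q,F^\bullet)$ of weight $n$ whose Mumford–Tate group is $G$ and whose stabilizer in $G_{\mathbb R}$ is the compact group $R$. Here $G_{\mathbb R}$ is a connected real form of the complex semisimple group $G_{\mathbb C}$, and $\mathfrak g\subset\mathrm{End}(V,Q)$. $D$ is open in its compact dual $\check D=G_{\mathbb C}/P_0$, the $G_{\mathbb C}$-orbit of $F^\bullet$ in the variety of $Q$-isotropic filtrations. $\check D$ contains a unique closed $G_{\mathbb R}$-orbit. A nilpotent orbit is a pair $(F^\bullet,N)$ with $F^\bullet\in\check D$, $N\in\mathfrak g_{\mathbb R}$ nilpotent, $e^{zN}F^\bullet\in D$ for $\mathrm{Im}(z)\gg0$, and $N(F^p)\subset F^{p-1}$. The associated limiting mixed Hodge structure is $(V,W_\bullet(N),F^\bullet)$, where $W_\bullet(N)$ is the monodromy weight filtration of $N$ on $V$ centered at $n$. All limiting mixed Hodge structures are of this form. Its reduced limit period is $F^\bullet_\infty=\lim_{\mathrm{Im}(z)\to\infty}e^{zN}F^\bullet\in\check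 D$. An orbit $\mathcal O$ is polarizable relative to $D$ if there is a Mumford–Tate domain structure on $D$ and a nilpotent orbit $(F^\bullet,N)$ with $F^\bullet_\infty\in\mathcal O$. The Deligne splitting $V_{\mathbb C}=\bigoplus I^{p,q}$ of a mixed Hodge structure is the unique bigrading with $W_k=\bigoplus_{p+q\le k}I^{p,q}$, $F^p=\bigoplus_{r\ge p}I^{r,\bullet}$ and $\overline{I^{p,q}}\equiv I^{q,p}$ modulo $\bigoplus_{r<q,\,s<p}I^{r,s}$. The adjoint limiting mixed Hodge structure on $\mathfrak g$ is given by $F^p_{\mathfrak g}=\{\xi\in\mathfrak g_{\mathbb C}:\xi(F^q)\subset F^{p+q}\ \forall q\}$, $W_\ell(N)_{\mathfrak g}=\{\xi\in\mathfrak g_{\mathbb R}:\xi(W_m(N))\subset W_{m+\ell}(N)\ \forall m\}$. A mixed Hodge structure is of Hodge–Tate type if $I^{p,q}=0$ for all $p\ne q$. For $x\in\mathcal O$, $T^{\mathrm{CR}}_x\mathcal O=T_x\mathcal O\cap J\,T_x\mathcal O$ where $J$ is the complex structure of $\check D$. $P_{\mathbb R}=P\cap G_{\mathbb R}$. *)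

theory Defs
  imports "HOL-Analysis.Analysis"
begin

text \<open>
  Conventions.  A rational vector space of dimension \<open>CARD('n)\<close> is taken to be \<open>\<rat>^'n\<close>, so that
  \<open>V\<^sub>\<complex> = complex^'n\<close>, complex conjugation is componentwise and \<open>V\<^sub>\<real>\<close> is its fixed-point set.
  The group \<open>GL(V)\<close> is the set of invertible elements of \<open>complex^'n^'n\<close>; its real points are
  the matrices with real entries.  Filtrations of \<open>V\<^sub>\<complex>\<close> are maps from \<open>int\<close> to sets.
  Real filtrations such as \<open>W\<close> consist of real subspaces of the set of real points and
  are complexified when necessary.
\<close>

section \<open>Complex vector spaces with a real structure\<close>

text \<open>One class covers both \<open>V\<^sub>\<complex>\<close> and \<open>End(V\<^sub>\<complex>)\<close>, where the notions of mixed Hodge structure and of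
  Deligne splitting are both needed.\<close>

class conj_space = real_vector +
  fixes scaleC :: "complex \<Rightarrow> 'a \<Rightarrow> 'a" (infixr "*\<^sub>C" 75)
    and vconj :: "'a \<Rightarrow> 'a"
  assumes scaleC_add_right: "c *\<^sub>C (x + y) = c *\<^sub>C x + c *\<^sub>C y"
    and scaleC_add_left: "(c + d) *\<^sub>C x = c *\<^sub>C x + d *\<^sub>C x"
    and scaleC_scaleC: "c *\<^sub>C (d *\<^sub>C x) = (c * d) *\<^sub>C x"
    and scaleC_of_real: "complex_of_real r *\<^sub>C x = r *\<^sub>R x"
    and vconj_add: "vconj (x + y) = vconj x + vconj y"
    and vconj_scaleC: "vconj (c *\<^sub>C x) = cnj c *\<^sub>C vconj x"
    and vconj_vconj: "vconj (vconj x) = x"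

instantiation complex :: conj_space
begin

definition scaleC_complex :: "complex \<Rightarrow> complex \<Rightarrow> complex" where
  "scaleC_complex c x = c * x"

definition vconj_complex :: "complex \<Rightarrow> complex" where
  "vconj_complex = cnj"

instance
  by standard
    (auto simp: scaleC_complex_def vconj_complex_def algebra_simps scaleR_conv_of_real)

end

instantiation vec :: (conj_space, finite) conj_space
begin

definition scaleC_vec :: "complex \<Rightarrow> 'a ^ 'b \<Rightarrow> 'a ^ 'b" where
  "scaleC_vec c x = (\<chi> i. c *\<^sub>C (x $ i))"

definition vconj_vec :: "'a ^ 'b \<Rightarrow> 'a ^ 'b" where
  "vconj_vec x = (\<chi> i. vconj (x $ i))"

instance
  by standard
    (auto simp: scaleC_vec_def vconj_vec_def vec_eq_iff scaleC_add_right scaleC_add_left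
      scaleC_scaleC scaleC_of_real vconj_add vconj_scaleC vconj_vconj)

end

lemma scaleC_one: "1 *\<^sub>C (x::'a::conj_space) = x"
  using scaleC_of_real[of 1 x] by simp

global_interpretation cvs: vector_space "scaleC :: complex \<Rightarrow> 'a \<Rightarrow> 'a::conj_space"
  by standard (auto simp: scaleC_add_right scaleC_add_left scaleC_scaleC scaleC_one)

definition real_points :: "'a::conj_space set \<Rightarrow> 'a set" where
  "real_points U = {u \<in> U. vconj u = u}"

definition complexify :: "'a::conj_space set \<Rightarrow> 'a set" where
  "complexify A = {u + \<i> *\<^sub>C v | u v. u \<in> A \<and> v \<in> A}"


section \<open>Mixed Hodge structures and the Deligne splitting\<close>

text \<open>\<open>(U, W, F)\<close> with \<open>U\<close> a conjugation-stable complex subspace, \<open>W\<close> an increasing filtration of the real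
  points of \<open>U\<close> and \<open>F\<close> a decreasing filtration of \<open>U\<close>.  The last clause says that \<open>F\<close> induces on
  \<open>Gr\<^sub>k = W\<^sub>k / W\<^sub>k\<^sub>-\<^sub>1\<close> a Hodge structure of weight \<open>k\<close>, that is
  \<open>F\<^sup>p Gr\<^sub>k\<close> and the conjugate of \<open>F\<^bsup>k-p+1\<^esup> Gr\<^sub>k\<close> are complementary in \<open>Gr\<^sub>k\<close>; subspaces of \<open>Gr\<^sub>k\<close> are
  written as subspaces of \<open>W\<^sub>k\<close> containing \<open>W\<^sub>k\<^sub>-\<^sub>1\<close>.  Sums of sets are elementwise sums.\<close>

definition mixed_hodge_structure ::
  "'a::conj_space set \<Rightarrow> (int \<Rightarrow> 'a set) \<Rightarrow> (int \<Rightarrow> 'a set) \<Rightarrow> bool" where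
  "mixed_hodge_structure U W F \<longleftrightarrow>
     cvs.subspace U \<and> vconj ` U = U \<and>
     (\<forall>k. subspace (W k) \<and> W k \<subseteq> real_points U) \<and>
     (\<forall>k l. k \<le> l \<longrightarrow> W k \<subseteq> W l) \<and> (\<exists>k. W k = {0}) \<and> (\<exists>k. W k = real_points U) \<and>
     (\<forall>p. cvs.subspace (F p) \<and> F p \<subseteq> U) \<and>
     (\<forall>p q. p \<le> q \<longrightarrow> F q \<subseteq> F p) \<and> (\<exists>p. F p = {0}) \<and> (\<exists>p. F p = U) \<and>
     (\<forall>k p. let Wk = complexify (W k);
                Wk1 = complexify (W (k - 1));
                A = (F p \<inter> Wk) + Wk1;
                B = (vconj ` F (k - p + 1) \<inter> Wk) + Wk1
            in A + B = Wk \<and> A \<inter> B = Wk1)"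

definition bigraded_support :: "(int \<Rightarrow> int \<Rightarrow> 'a::conj_space set) \<Rightarrow> (int \<times> int) set" where
  "bigraded_support I = {(p, q). I p q \<noteq> {0}}"

definition bigraded_sum ::
  "(int \<Rightarrow> int \<Rightarrow> 'a::conj_space set) \<Rightarrow> (int \<times> int) set \<Rightarrow> 'a set" where
  "bigraded_sum I S =
     {\<Sum>x \<in> S \<inter> bigraded_support I. f x | f. \<forall>p q. f (p, q) \<in> I p q}"

definition is_bigrading :: "'a::conj_space set \<Rightarrow> (int \<Rightarrow> int \<Rightarrow> 'a set) \<Rightarrow> bool" where
  "is_bigrading U I \<longleftrightarrow>
     (\<forall>p q. cvs.subspace (I p q)) \<and>
     finite (bigraded_support I) \<and>
     bigraded_sum I UNIV = U \<and>
     (\<forall>f. (\<forall>p q. f (p, q) \<in> I p q) \<and> (\<Sum>x \<in> bigraded_support I. f x) = 0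
        \<longrightarrow> (\<forall>p q. f (p, q) = 0))"

definition deligne_splitting ::
  "'a::conj_space set \<Rightarrow> (int \<Rightarrow> 'a set) \<Rightarrow> (int \<Rightarrow> 'a set) \<Rightarrow> (int \<Rightarrow> int \<Rightarrow> 'a set) \<Rightarrow> bool" where
  "deligne_splitting U W F I \<longleftrightarrow>
     is_bigrading U I \<and>
     (\<forall>k. complexify (W k) = bigraded_sum I {(p, q). p + q \<le> k}) \<and>
     (\<forall>p. F p = bigraded_sum I {(r, s). r \<ge> p}) \<and>
     (\<forall>p q. let L = bigraded_sum I {(r, s). r < q \<and> s < p}
            in vconj ` I p q + L = I q p + L)"

text \<open>The Deligne splitting of a mixed Hodge structure exists and is unique; the Hodge--Tate
  condition asserts that it exists and is concentrated on the diagonal.\<close>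

definition hodge_tate ::
  "'a::conj_space set \<Rightarrow> (int \<Rightarrow> 'a set) \<Rightarrow> (int \<Rightarrow> 'a set) \<Rightarrow> bool" where
  "hodge_tate U W F \<longleftrightarrow>
     (\<exists>I. deligne_splitting U W F I \<and> (\<forall>p q. p \<noteq> q \<longrightarrow> I p q = {0}))"


section \<open>Matrix exponential, Lie algebras, algebraic groups\<close>

definition mpow :: "complex^'n^'n \<Rightarrow> nat \<Rightarrow> complex^'n^'n" where
  "mpow A k = (((**) A) ^^ k) (mat 1)"

definition mexp :: "complex^'n^'n \<Rightarrow> complex^'n^'n" where
  "mexp A = (\<Sum>k. (1 / fact k) *\<^sub>R mpow A k)"

definition lie_algebra :: "(complex^'n^'n) set \<Rightarrow> (complex^'n^'n) set" where
  "lie_algebra H = {X. \<forall>t::real. mexp (t *\<^sub>R X) \<in> H}"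

definition lie_bracket :: "complex^'n^'n \<Rightarrow> complex^'n^'n \<Rightarrow> complex^'n^'n" where
  "lie_bracket X Y = X ** Y - Y ** X"

definition lie_ideal :: "(complex^'n^'n) set \<Rightarrow> (complex^'n^'n) set \<Rightarrow> bool" where
  "lie_ideal I g \<longleftrightarrow>
     cvs.subspace I \<and> I \<subseteq> g \<and> (\<forall>X\<in>g. \<forall>Y\<in>I. lie_bracket X Y \<in> I)"

definition derived_algebra :: "(complex^'n^'n) set \<Rightarrow> (complex^'n^'n) set" where
  "derived_algebra I = cvs.span {lie_bracket X Y | X Y. X \<in> I \<and> Y \<in> I}"

definition semisimple_lie :: "(complex^'n^'n) set \<Rightarrow> bool" where
  "semisimple_lie g \<longleftrightarrow>
     (\<forall>I. lie_ideal I g \<and> (\<exists>k. (derived_algebra ^^ k) I = {0}) \<longrightarrow> I = {0})"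

text \<open>Polynomial functions of the matrix entries with coefficients in a subfield \<open>K\<close>.\<close>

inductive_set poly_funs :: "complex set \<Rightarrow> (complex^'n^'n \<Rightarrow> complex) set"
  for K :: "complex set" where
  const: "c \<in> K \<Longrightarrow> (\<lambda>A. c) \<in> poly_funs K"
| entry: "(\<lambda>A. A $ i $ j) \<in> poly_funs K"
| add: "f \<in> poly_funs K \<Longrightarrow> g \<in> poly_funs K \<Longrightarrow> (\<lambda>A. f A + g A) \<in> poly_funs K"
| mult: "f \<in> poly_funs K \<Longrightarrow> g \<in> poly_funs K \<Longrightarrow> (\<lambda>A. f A * g A) \<in> poly_funs K"

text \<open>Zariski-closed subsets of \<open>GL(V\<^sub>\<complex>)\<close> cut out by equations over \<open>K\<close>.  Powers of the inverse of the determinant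
  can be cleared, so polynomials in the entries suffice.\<close>

definition defined_over :: "complex set \<Rightarrow> (complex^'n^'n) set \<Rightarrow> bool" where
  "defined_over K H \<longleftrightarrow> (\<exists>S \<subseteq> poly_funs K. H = {A. invertible A \<and> (\<forall>f\<in>S. f A = 0)})"

definition algebraic_subgroup :: "complex set \<Rightarrow> (complex^'n^'n) set \<Rightarrow> bool" where
  "algebraic_subgroup K H \<longleftrightarrow>
     defined_over K H \<and> mat 1 \<in> H \<and> (\<forall>A\<in>H. \<forall>B\<in>H. A ** B \<in> H) \<and> (\<forall>A\<in>H. matrix_inv A \<in> H)"


section \<open>Polarized Hodge structures and Mumford--Tate groups\<close>

definition hodge_piece :: "(int \<Rightarrow> (complex^'n) set) \<Rightarrow> int \<Rightarrow> int \<Rightarrow> (complex^'n) set" where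
  "hodge_piece F p q = F p \<inter> vconj ` F q"

text \<open>The endomorphism acting on \<open>V\<^bsup>p,q\<^esup>\<close>, \<open>p + q = n\<close>, as multiplication by \<open>z\<^bsup>p-q\<^esup>\<close>.  It is well defined
  as soon as \<open>V\<^sub>\<complex>\<close> is the direct sum of the \<open>V\<^bsup>p,q\<^esup>\<close>.  On \<open>|z| = 1\<close> it is the circle
  representation of the Hodge structure, and for \<open>z = \<i>\<close> it is the Weil operator \<open>C\<close>.\<close>

definition circle_rep :: "nat \<Rightarrow> (int \<Rightarrow> (complex^'n) set) \<Rightarrow> complex \<Rightarrow> complex^'n^'n" where
  "circle_rep n F z =
     (THE A. \<forall>p q. p + q = int n \<longrightarrow>
        (\<forall>v \<in> hodge_piece F p q. A *v v = (z powi (p - q)) *\<^sub>C v))"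

definition bilin :: "complex^'n^'n \<Rightarrow> complex^'n \<Rightarrow> complex^'n \<Rightarrow> complex" where
  "bilin Q u v = (\<Sum>i\<in>UNIV. \<Sum>j\<in>UNIV. u $ i * Q $ i $ j * v $ j)"

definition polarized_hodge_structure ::
  "nat \<Rightarrow> complex^'n^'n \<Rightarrow> (int \<Rightarrow> (complex^'n) set) \<Rightarrow> bool" where
  "polarized_hodge_structure n Q F \<longleftrightarrow>
     (\<forall>i j. Q $ i $ j \<in> \<rat>) \<and> invertible Q \<and>
     (\<forall>u v. bilin Q u v = (-1) ^ n * bilin Q v u) \<and>
     (\<forall>p. cvs.subspace (F p)) \<and> (\<forall>p q. p \<le> q \<longrightarrow> F q \<subseteq> F p) \<and>
     (\<forall>p\<le>0. F p = UNIV) \<and> (\<forall>p>int n. F p = {0}) \<and>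
     (\<forall>p. F p + vconj ` F (int n - p + 1) = UNIV \<and> F p \<inter> vconj ` F (int n - p + 1) = {0}) \<and>
     (\<forall>p. \<forall>u \<in> F p. \<forall>v \<in> F (int n - p + 1). bilin Q u v = 0) \<and>
     (\<forall>v. v \<noteq> 0 \<longrightarrow>
        (\<exists>r>0. bilin Q (circle_rep n F \<i> *v v) (vconj v) = complex_of_real r))"

text \<open>The complex points of the Mumford--Tate group: the smallest algebraic subgroup over \<open>\<rat>\<close> through
  which the circle representation factors.  It is a connected algebraic group; its
  group of real points may be disconnected, and \<open>GR\<close> is the identity component of the latter.
  In this and all following definitions \<open>n\<close> and \<open>F0\<close> are the weight and the base point.\<close>

definition GC :: "nat \<Rightarrow> (int \<Rightarrow> (complex^'n) set) \<Rightarrow> (complex^'n^'n) set" where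
  "GC n F0 = \<Inter>{H. algebraic_subgroup \<rat> H \<and> (\<forall>z. cmod z = 1 \<longrightarrow> circle_rep n F0 z \<in> H)}"

definition GR :: "nat \<Rightarrow> (int \<Rightarrow> (complex^'n) set) \<Rightarrow> (complex^'n^'n) set" where
  "GR n F0 = connected_component_set (real_points (GC n F0)) (mat 1)"

abbreviation gC :: "nat \<Rightarrow> (int \<Rightarrow> (complex^'n) set) \<Rightarrow> (complex^'n^'n) set" where
  "gC n F0 \<equiv> lie_algebra (GC n F0)"

abbreviation gR :: "nat \<Rightarrow> (int \<Rightarrow> (complex^'n) set) \<Rightarrow> (complex^'n^'n) set" where
  "gR n F0 \<equiv> lie_algebra (GR n F0)"


section \<open>Mumford--Tate domains, compact duals and orbits\<close>

definition act :: "complex^'n^'n \<Rightarrow> (int \<Rightarrow> (complex^'n) set) \<Rightarrow> (int \<Rightarrow> (complex^'n) set)" where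
  "act g F = (\<lambda>p. (\<lambda>v. g *v v) ` F p)"

definition stabC ::
  "nat \<Rightarrow> (int \<Rightarrow> (complex^'n) set) \<Rightarrow> (int \<Rightarrow> (complex^'n) set) \<Rightarrow> (complex^'n^'n) set" where
  "stabC n F0 x = {g \<in> GC n F0. act g x = x}"

definition stabR ::
  "nat \<Rightarrow> (int \<Rightarrow> (complex^'n) set) \<Rightarrow> (int \<Rightarrow> (complex^'n) set) \<Rightarrow> (complex^'n^'n) set" where
  "stabR n F0 x = {g \<in> GR n F0. act g x = x}"

definition orbitR ::
  "nat \<Rightarrow> (int \<Rightarrow> (complex^'n) set) \<Rightarrow> (int \<Rightarrow> (complex^'n) set) \<Rightarrow> (int \<Rightarrow> (complex^'n) set) set" where
  "orbitR n F0 x = (\<lambda>g. act g x) ` GR n F0"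

definition mt_dom :: "nat \<Rightarrow> (int \<Rightarrow> (complex^'n) set) \<Rightarrow> (int \<Rightarrow> (complex^'n) set) set" where
  "mt_dom n F0 = orbitR n F0 F0"

definition compact_dual :: "nat \<Rightarrow> (int \<Rightarrow> (complex^'n) set) \<Rightarrow> (int \<Rightarrow> (complex^'n) set) set" where
  "compact_dual n F0 = (\<lambda>g. act g F0) ` GC n F0"

definition mumford_tate_domain ::
  "nat \<Rightarrow> complex^'n^'n \<Rightarrow> (int \<Rightarrow> (complex^'n) set) \<Rightarrow> bool" where
  "mumford_tate_domain n Q F0 \<longleftrightarrow>
     polarized_hodge_structure n Q F0 \<and> semisimple_lie (gC n F0) \<and> compact (stabR n F0 F0)"

text \<open>The topology of the flag variety, via the embedding of Grassmannians which sends
  a subspace to the orthogonal projection onto it.  For complex subspaces the orthogonal projections of the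
  Hermitian and of the underlying Euclidean inner product agree.\<close>

definition flag_coord :: "(int \<Rightarrow> (complex^'n) set) \<Rightarrow> int \<times> (complex^'n) \<Rightarrow> complex^'n" where
  "flag_coord F = (\<lambda>(p, v). closest_point (F p) v)"

definition flag_topology :: "(int \<Rightarrow> (complex^'n) set) topology" where
  "flag_topology = pullback_topology UNIV flag_coord euclidean"

definition closed_orbit ::
  "nat \<Rightarrow> (int \<Rightarrow> (complex^'n) set) \<Rightarrow> (int \<Rightarrow> (complex^'n) set) set \<Rightarrow> bool" where
  "closed_orbit n F0 Orb \<longleftrightarrow>
     (\<exists>x \<in> compact_dual n F0. Orb = orbitR n F0 x) \<and>
     closedin (subtopology flag_topology (compact_dual n F0)) Orb"


section \<open>Nilpotent orbits and limiting mixed Hodge structures\<close>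

text \<open>The filter \<open>filtercomap Im at_top\<close> is \<open>Im z \<longlongrightarrow> \<infinity>\<close>, with no condition on \<open>Re z\<close>.\<close>

definition nilpotent_orbit ::
  "nat \<Rightarrow> (int \<Rightarrow> (complex^'n) set) \<Rightarrow> (int \<Rightarrow> (complex^'n) set) \<Rightarrow> complex^'n^'n \<Rightarrow> bool" where
  "nilpotent_orbit n F0 F N \<longleftrightarrow>
     F \<in> compact_dual n F0 \<and> N \<in> gR n F0 \<and> (\<exists>k. mpow N k = 0) \<and>
     (\<forall>\<^sub>F z in filtercomap Im at_top. act (mexp (z *\<^sub>C N)) F \<in> mt_dom n F0) \<and>
     (\<forall>p. (\<lambda>v. N *v v) ` F p \<subseteq> F (p - 1))"

definition reduced_limit_period ::
  "nat \<Rightarrow> (int \<Rightarrow> (complex^'n) set) \<Rightarrow> (int \<Rightarrow> (complex^'n) set) \<Rightarrow> complex^'n^'n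
    \<Rightarrow> (int \<Rightarrow> (complex^'n) set) \<Rightarrow> bool" where
  "reduced_limit_period n F0 F N Finf \<longleftrightarrow>
     limitin (subtopology flag_topology (compact_dual n F0))
       (\<lambda>z. act (mexp (z *\<^sub>C N)) F) Finf (filtercomap Im at_top)"

definition monodromy_weight_filtration ::
  "complex^'n^'n \<Rightarrow> int \<Rightarrow> (int \<Rightarrow> (complex^'n) set) \<Rightarrow> bool" where
  "monodromy_weight_filtration N n W \<longleftrightarrow>
     (\<forall>k. subspace (W k) \<and> W k \<subseteq> real_points UNIV) \<and>
     (\<forall>k l. k \<le> l \<longrightarrow> W k \<subseteq> W l) \<and> (\<exists>k. W k = {0}) \<and> (\<exists>k. W k = real_points UNIV) \<and>
     (\<forall>k. (\<lambda>v. N *v v) ` W k \<subseteq> W (k - 2)) \<and>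
     (\<forall>l::nat.
        (\<lambda>v. mpow N l *v v) ` W (n + int l) + W (n - int l - 1) = W (n - int l) \<and>
        {v \<in> W (n + int l). mpow N l *v v \<in> W (n - int l - 1)} = W (n + int l - 1))"

text \<open>By Schmid's theorem the last conjunct follows from the others.\<close>

definition limiting_mhs ::
  "nat \<Rightarrow> (int \<Rightarrow> (complex^'n) set) \<Rightarrow> (int \<Rightarrow> (complex^'n) set) \<Rightarrow> (int \<Rightarrow> (complex^'n) set)
    \<Rightarrow> complex^'n^'n \<Rightarrow> bool" where
  "limiting_mhs n F0 W F N \<longleftrightarrow>
     nilpotent_orbit n F0 F N \<and> monodromy_weight_filtration N (int n) W \<and>
     mixed_hodge_structure UNIV W F"

definition adjoint_F ::
  "nat \<Rightarrow> (int \<Rightarrow> (complex^'n) set) \<Rightarrow> (int \<Rightarrow> (complex^'n) set) \<Rightarrow> int \<Rightarrow> (complex^'n^'n) set" where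
  "adjoint_F n F0 F p = {X \<in> gC n F0. \<forall>q. (\<lambda>v. X *v v) ` F q \<subseteq> F (p + q)}"

definition adjoint_W ::
  "nat \<Rightarrow> (int \<Rightarrow> (complex^'n) set) \<Rightarrow> (int \<Rightarrow> (complex^'n) set) \<Rightarrow> int \<Rightarrow> (complex^'n^'n) set" where
  "adjoint_W n F0 W l = {X \<in> gR n F0. \<forall>m. (\<lambda>v. X *v v) ` W m \<subseteq> W (m + l)}"


section \<open>Polarizability relative to a domain\<close>

text \<open>Two Mumford--Tate domains, possibly realized on different Hodge structures, are the same
  homogeneous complex manifold: an isomorphism \<open>\<psi>\<close> of Lie algebras respecting the real forms and a bijection
  \<open>f\<close> of compact duals, equivariant along \<open>\<psi>\<close>, identifying the domains.  As the complex groups are connected,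
  equivariance makes \<open>f\<close> biholomorphic and lets it match real orbits.\<close>

definition domain_iso ::
  "nat \<Rightarrow> (int \<Rightarrow> (complex^'m) set) \<Rightarrow> nat \<Rightarrow> (int \<Rightarrow> (complex^'n) set)
    \<Rightarrow> (complex^'m^'m \<Rightarrow> complex^'n^'n)
    \<Rightarrow> ((int \<Rightarrow> (complex^'m) set) \<Rightarrow> (int \<Rightarrow> (complex^'n) set)) \<Rightarrow> bool" where
  "domain_iso m F1 n F0 \<psi> f \<longleftrightarrow>
     bij_betw \<psi> (gC m F1) (gC n F0) \<and> \<psi> ` gR m F1 = gR n F0 \<and>
     (\<forall>X \<in> gC m F1. \<forall>Y \<in> gC m F1.
        \<psi> (X + Y) = \<psi> X + \<psi> Y \<and> \<psi> (lie_bracket X Y) = lie_bracket (\<psi> X) (\<psi> Y)) \<and>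
     (\<forall>X \<in> gC m F1. \<forall>c. \<psi> (c *\<^sub>C X) = c *\<^sub>C \<psi> X) \<and>
     bij_betw f (compact_dual m F1) (compact_dual n F0) \<and> f ` mt_dom m F1 = mt_dom n F0 \<and>
     (\<forall>X \<in> gC m F1. \<forall>x \<in> compact_dual m F1. f (act (mexp X) x) = act (mexp (\<psi> X)) (f x))"

text \<open>There is a Mumford--Tate domain structure on \<open>D\<close>, on a vector space of dimension \<open>CARD('m)\<close>, and a
  nilpotent orbit for it with reduced limit period in \<open>Orb\<close>.  HOL cannot quantify
  existentially over the dimension, which is the reason for the type argument; in a hypothesis with \<open>'m\<close> a free
  type variable, this is equivalent to existential quantification over all dimensions.\<close>

definition polarizable_relative ::
  "'m::finite itself \<Rightarrow> nat \<Rightarrow> (int \<Rightarrow> (complex^'n) set) \<Rightarrow> (int \<Rightarrow> (complex^'n) set) set \<Rightarrow> bool" where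
  "polarizable_relative (_ :: 'm::finite itself) n F0 Orb \<longleftrightarrow>
     (\<exists>m (Q1 :: complex^'m^'m) F1 \<psi> f F N Finf.
        mumford_tate_domain m Q1 F1 \<and> domain_iso m F1 n F0 \<psi> f \<and>
        nilpotent_orbit m F1 F N \<and> reduced_limit_period m F1 F N Finf \<and> f Finf \<in> Orb)"


section \<open>Tangent spaces and dimensions\<close>

text \<open>\<open>T\<^sub>x\<close> of the compact dual \<open>G\<^sub>\<complex> / Stab(x)\<close> is the quotient of \<open>gC\<close> by the Lie algebra of the stabilizer;
  tangent vectors are cosets, and \<open>X + Lie Stab(x)\<close> is the velocity at \<open>t = 0\<close> of the curve
  \<open>exp(tX) x\<close>.  The tangent space of the real orbit of \<open>x\<close> consists of the velocities with \<open>X\<close> in \<open>gR\<close>,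
  and \<open>J\<close> is multiplication by \<open>\<i>\<close>.\<close>

definition tangent_vector ::
  "nat \<Rightarrow> (int \<Rightarrow> (complex^'n) set) \<Rightarrow> (int \<Rightarrow> (complex^'n) set) \<Rightarrow> complex^'n^'n
    \<Rightarrow> (complex^'n^'n) set" where
  "tangent_vector n F0 x X = (\<lambda>Y. X + Y) ` lie_algebra (stabC n F0 x)"

definition orbit_tangent ::
  "nat \<Rightarrow> (int \<Rightarrow> (complex^'n) set) \<Rightarrow> (int \<Rightarrow> (complex^'n) set) \<Rightarrow> (complex^'n^'n) set set" where
  "orbit_tangent n F0 x = tangent_vector n F0 x ` gR n F0"

definition cr_tangent ::
  "nat \<Rightarrow> (int \<Rightarrow> (complex^'n) set) \<Rightarrow> (int \<Rightarrow> (complex^'n) set) \<Rightarrow> (complex^'n^'n) set set" where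
  "cr_tangent n F0 x =
     orbit_tangent n F0 x \<inter> (\<lambda>c. (\<lambda>X. \<i> *\<^sub>C X) ` c) ` orbit_tangent n F0 x"

definition totally_real ::
  "nat \<Rightarrow> (int \<Rightarrow> (complex^'n) set) \<Rightarrow> (int \<Rightarrow> (complex^'n) set) set \<Rightarrow> bool" where
  "totally_real n F0 Orb \<longleftrightarrow> (\<forall>x \<in> Orb. cr_tangent n F0 x = {tangent_vector n F0 x 0})"

text \<open>Dimensions of the homogeneous manifolds \<open>G\<^sub>\<real> / Stab(x)\<close> and \<open>G\<^sub>\<complex> / P\<^sub>0\<close>; note that \<open>dim\<close> is the
  real dimension, also for sets of complex matrices, while \<open>cvs.dim\<close> is the complex dimension.\<close>

definition real_orbit_dim :: "nat \<Rightarrow> (int \<Rightarrow> (complex^'n) set) \<Rightarrow> (int \<Rightarrow> (complex^'n) set) \<Rightarrow> nat" where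
  "real_orbit_dim n F0 x = dim (gR n F0) - dim (lie_algebra (stabR n F0 x))"

definition compact_dual_dim :: "nat \<Rightarrow> (int \<Rightarrow> (complex^'n) set) \<Rightarrow> nat" where
  "compact_dual_dim n F0 = cvs.dim (gC n F0) - cvs.dim (lie_algebra (stabC n F0 F0))"

text \<open>\<open>Orb = G\<^sub>\<real> / H\<close> with base point \<open>x\<close>: the orbit map of \<open>x\<close> induces a bijection from cosets to \<open>Orb\<close>.\<close>

definition is_quotient_by ::
  "nat \<Rightarrow> (int \<Rightarrow> (complex^'n) set) \<Rightarrow> (int \<Rightarrow> (complex^'n) set) \<Rightarrow> (complex^'n^'n) set
    \<Rightarrow> (int \<Rightarrow> (complex^'n) set) set \<Rightarrow> bool" where
  "is_quotient_by n F0 x H Orb \<longleftrightarrow>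
     (\<lambda>g. act g x) ` GR n F0 = Orb \<and>
     (\<forall>g \<in> GR n F0. \<forall>h \<in> GR n F0. act g x = act h x \<longleftrightarrow> matrix_inv g ** h \<in> H)"

end

theory Submission
  imports Defs "HOL-Complex_Analysis.Cauchy_Integral_Formula"
begin

text \<open>
  Let \<open>\<pp>\<close> be the isotropy algebra of \<open>F\<^sub>\<infinity>\<close> in \<open>\<gg>\<close>.  Conditions (a), (b) and (c) all say that \<open>\<pp>\<close> is
  stable under complex conjugation.  For (a), the tangent space of the real orbit consists of the
  cosets \<open>X + \<pp>\<close> with \<open>X\<close> real (\<open>cr_tangent_trivial_iff\<close>).  For (b), the complexification of
  \<open>\<pp> \<inter> \<gg>\<^sub>\<real>\<close> is the intersection of \<open>\<pp>\<close> with its conjugate, and it fills \<open>\<pp>\<close> precisely when the two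
  dimensions agree (\<open>orbit_dim_eq_iff\<close>).  If the stabilizer \<open>P\<close> is defined over \<open>\<real>\<close>, then \<open>\<pp>\<close> is conjugation
  stable.  What remains is the implication from the stability of \<open>\<pp>\<close> to the reality of the filtration
  \<open>F\<^sub>\<infinity>\<close>, hence of \<open>P\<close>, and to the Hodge--Tate property.  This is where the limiting mixed Hodge
  structure enters.

  \<^item> The filtration \<open>F\<close> has a canonical opposite, the increasing filtration \<open>\<Psi>\<^sub>p\<close> spanned by the
    intersections of \<open>W\<^sub>k\<close> with the conjugate of \<open>F\<^bsup>k-p\<^esup>\<close>.  The two filtrations split \<open>V\<close> into pieces of a
    grading \<open>e\<^sub>F\<close>.  The conjugate grading is block triangular with respect to \<open>e\<^sub>F\<close>, and its diagonal
    blocks form a second grading \<open>e\<^sub>S\<close>, commuting with \<open>e\<^sub>F\<close>.  In the resulting bigrading \<open>V\<^bsup>p,q\<^esup>\<close>, the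
    filtration \<open>F\<close> is given by \<open>p\<close>, the conjugate \<open>\<Phi>\<close> of \<open>\<Psi>\<close> by \<open>q\<close> and \<open>W\<close> by \<open>p + q\<close>, while \<open>N\<close> has
    bidegree \<open>(-1,-1)\<close>.

  \<^item> Writing out \<open>exp(N)\<close> on primitive strings shows that every element of \<open>V\<^bsup>p,q\<^esup>\<close> is a limit of elements of
    \<open>exp(zN) F\<^bsup>n-q\<^esup>\<close> (\<open>limit_vectors\<close>).  Hence \<open>\<Phi>\<^sub>q\<close> is contained in \<open>F\<^sub>\<infinity>\<^bsup>n-q\<^esup>\<close>, and the two are
    equal for reasons of dimension (\<open>Phi_eq_Finf\<close>).

  \<^item> On \<open>\<gg>\<close>, the Hodge structure of the base point has weight zero, and its dimensions carry over to all
    points of the compact dual. Therefore \<open>\<gg>\<close> is, for every \<open>a\<close>, the direct sum of the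
    subspace \<open>F\<^bsup>a+1\<^esup>\<gg>\<close> and the conjugate of
    \<open>F\<^sub>\<infinity>\<^bsup>-a\<^esup>\<gg>\<close>, and it contains the components of its elements for
    \<open>e\<^sub>F\<close> (\<open>component_eF_mem\<close>). It follows that the degree operators of
    \<open>e\<^sub>F\<close> and \<open>e\<^sub>S\<close>, shifted by \<open>n/2\<close>, belong to
    \<open>\<gg>\<close>, and that \<open>\<gg>\<close> is bigraded. Let \<open>Z \<in> \<gg>\<close> be the
    difference of the two degree operators, which is multiplication by \<open>p - q\<close> on
    \<open>V\<^bsup>p,q\<^esup>\<close>.

  \<^item> The subalgebra \<open>\<pp>\<close> is the part of nonpositive \<open>e\<^sub>S\<close>-degree and its conjugate the part of nonpositive
    \<open>e\<^sub>F\<close>-degree.  If they coincide, then \<open>\<gg>\<^bsup>a,b\<^esup> \<noteq> 0\<close> implies \<open>a \<le> 0 \<longleftrightarrow> b \<le> 0\<close>.  Since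
    \<open>ad(N)\<^bsup>a+b\<^esup>\<close> is injective on \<open>\<gg>\<^bsup>a,b\<^esup>\<close> for \<open>a + b > 0\<close> (\<open>bracket_N_power_inj\<close>), applying \<open>ad N\<close> until
    one of the degrees reaches zero shows \<open>\<gg>\<^bsup>a,b\<^esup> = 0\<close> for \<open>a, b > 0\<close> and \<open>a \<noteq> b\<close>.  So \<open>Z\<close> commutes with
    everything of positive degree; and \<open>ad(N)\<^bsup>2a\<^esup>\<close>, which commutes with \<open>ad Z\<close>, carries degree \<open>a\<close>
    onto degree \<open>-a\<close>.  Hence \<open>Z\<close> is central (\<open>Z_central\<close>), and \<open>Z = 0\<close> because \<open>\<gg>\<close> is semisimple.

  \<^item> Now \<open>V\<^bsup>p,q\<^esup> = 0\<close> for \<open>p \<noteq> q\<close>: the limiting mixed Hodge structure is Hodge--Tate, and with it the adjoint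
    one.  Moreover \<open>\<Phi> = \<Psi>\<close>, so \<open>F\<^sub>\<infinity>\<close> equals its own conjugate (\<open>Finf_real\<close>).
\<close>


section \<open>Complex matrices as a conjugation space\<close>

lemma scaleC_complex_eq [simp]: "c *\<^sub>C (x::complex) = c * x"
  by (simp add: scaleC_complex_def)

lemma vconj_complex_eq [simp]: "vconj (x::complex) = cnj x"
  by (simp add: vconj_complex_def)

lemma scaleC_vec_nth [simp]: "(c *\<^sub>C x) $ i = c *\<^sub>C (x $ i)"
  by (simp add: scaleC_vec_def)

lemma vconj_vec_nth [simp]: "(vconj x) $ i = vconj (x $ i)"
  by (simp add: vconj_vec_def)

lemma scaleC_zero_right [simp]: "c *\<^sub>C (0::'a::conj_space) = 0"
  by (rule cvs.scale_zero_right)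

lemma vconj_zero [simp]: "vconj (0::'a::conj_space) = 0"
  using vconj_add[of "0::'a" 0] by simp

lemma vconj_minus: "vconj (- x) = - vconj (x::'a::conj_space)"
  using vconj_add[of x "- x"] by (simp add: eq_neg_iff_add_eq_0 add.commute)

lemma vconj_diff: "vconj (x - y) = vconj x - vconj (y::'a::conj_space)"
  using vconj_add[of x "- y"] by (simp add: vconj_minus)

lemma vconj_sum: "vconj (sum f A) = (\<Sum>i\<in>A. vconj (f i :: 'a::conj_space))"
  by (induction A rule: infinite_finite_induct) (auto simp: vconj_add)

lemma inj_vconj: "inj (vconj :: 'a \<Rightarrow> 'a::conj_space)"
  by (metis injI vconj_vconj)

lemma scaleR_eq_scaleC: "r *\<^sub>R x = complex_of_real r *\<^sub>C (x::'a::conj_space)"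
  by (simp add: scaleC_of_real)

lemma vconj_scaleR: "vconj (r *\<^sub>R x) = r *\<^sub>R vconj (x::'a::conj_space)"
  by (simp add: scaleR_eq_scaleC vconj_scaleC)

lemma linear_vconj: "linear (vconj :: 'a \<Rightarrow> 'a::conj_space)"
  by (rule linearI) (auto simp: vconj_add vconj_scaleR)

lemma linear_scaleC: "linear (\<lambda>x. c *\<^sub>C (x::'a::conj_space))"
  by (rule linearI) (auto simp: scaleC_add_right scaleR_eq_scaleC scaleC_scaleC mult.commute)

lemma subspace_of_csubspace: "cvs.subspace S \<Longrightarrow> subspace (S::'a::conj_space set)"
  by (auto simp: cvs.subspace_def subspace_def scaleR_eq_scaleC)

lemma csubspace_vconj: "cvs.subspace S \<Longrightarrow> cvs.subspace (vconj ` (S::'a::conj_space set))"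
  unfolding cvs.subspace_def
proof (safe)
  fix c x y assume S: "0 \<in> S" "\<forall>x\<in>S. \<forall>y\<in>S. x + y \<in> S" "\<forall>c. \<forall>x\<in>S. c *\<^sub>C x \<in> S" 
  show "0 \<in> vconj ` S" using S(1) by (metis imageI vconj_zero)
  assume x: "x \<in> S"
  show "c *\<^sub>C vconj x \<in> vconj ` S"
    using S(3) x by (metis (no_types, lifting) complex_cnj_cnj imageI vconj_scaleC)
  assume y: "y \<in> S"
  show "vconj x + vconj y \<in> vconj ` S"
    using S(2) x y by (metis imageI vconj_add)
qed

lemma vconj_image_iff: "x \<in> vconj ` S \<longleftrightarrow> vconj x \<in> (S::'a::conj_space set)"
  by (metis image_iff vconj_vconj)

lemma dim_vconj_image: "dim (vconj ` S) = dim (S::'a::{conj_space,euclidean_space} set)"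
  by (rule dim_image_eq[OF linear_vconj]) (metis inj_on_subset inj_vconj subset_UNIV)

lemma mat_vec_scaleC: "A *v (c *\<^sub>C v) = c *\<^sub>C (A *v (v::complex^'n))"
  by (simp add: vec_eq_iff matrix_vector_mult_def sum_distrib_left mult.left_commute)

lemma scaleC_mat_vec: "(c *\<^sub>C A) *v v = c *\<^sub>C (A *v (v::complex^'n))"
  by (simp add: vec_eq_iff matrix_vector_mult_def sum_distrib_left mult.assoc)

lemma scaleC_mat_mul_left: "(c *\<^sub>C A) ** B = c *\<^sub>C (A ** (B::complex^'n^'n))"
  by (simp add: vec_eq_iff matrix_matrix_mult_def sum_distrib_left mult.assoc)

lemma scaleC_mat_mul_right: "A ** (c *\<^sub>C B) = c *\<^sub>C (A ** (B::complex^'n^'n))"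
  by (simp add: vec_eq_iff matrix_matrix_mult_def sum_distrib_left mult.left_commute)

lemma vconj_mat_vec: "vconj (A *v v) = vconj A *v vconj (v::complex^'n)"
  by (simp add: vec_eq_iff matrix_vector_mult_def)

lemma vconj_mat_mul: "vconj (A ** B) = vconj A ** vconj (B::complex^'n^'n)"
  by (simp add: vec_eq_iff matrix_matrix_mult_def)

lemma vconj_mat_1: "vconj (mat 1) = (mat 1 :: complex^'n^'n)"
  by (simp add: vec_eq_iff mat_def)

lemma mat_vec_sum_right: "A *v (sum f K) = (\<Sum>i\<in>K. A *v (f i :: complex^'n))"
  by (induction K rule: infinite_finite_induct) (auto simp: matrix_vector_right_distrib)

lemma mat_vec_sum_left: "(sum f K) *v v = (\<Sum>i\<in>K. f i *v (v :: complex^'n))"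
  by (induction K rule: infinite_finite_induct) (auto simp: matrix_vector_mult_add_rdistrib)

lemma matrix_add_rdistrib: "(B + C) ** A = B ** A + C ** (A::complex^'n^'n)"
  by (simp add: vec_eq_iff matrix_matrix_mult_def sum.distrib algebra_simps)

lemma mat_mul_sum_right: "A ** (sum f K) = (\<Sum>i\<in>K. A ** (f i :: complex^'n^'n))"
  by (induction K rule: infinite_finite_induct) (auto simp: matrix_add_ldistrib)

lemma mat_mul_sum_left: "(sum f K) ** A = (\<Sum>i\<in>K. f i ** (A :: complex^'n^'n))"
  by (induction K rule: infinite_finite_induct) (auto simp: matrix_add_rdistrib)

lemma mat_mul_minus: "A ** (- B) = - (A ** B)" "(- A) ** B = - (A ** (B::complex^'n^'n))"
  by (auto simp: vec_eq_iff matrix_matrix_mult_def sum_negf)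

lemma mat_mul_diff: "A ** (B - C) = A ** B - A ** C" "(B - C) ** A = B ** A - C ** (A::complex^'n^'n)"
  by (auto simp: vec_eq_iff matrix_matrix_mult_def sum_subtractf algebra_simps)

lemma mat_vec_diff: "A *v (x - y) = A *v x - A *v y" "(A - B) *v x = A *v x - B *v (x::complex^'n)"
  by (auto simp: vec_eq_iff matrix_vector_mult_def sum_subtractf algebra_simps)

lemma mat_eqI: "(\<And>v. A *v v = B *v v) \<Longrightarrow> A = (B::complex^'n^'n)"
  by (simp add: matrix_eq)

lemma sum_scaleC: "c *\<^sub>C sum f K = (\<Sum>i\<in>K. c *\<^sub>C (f i::'a::conj_space))"
  by (rule cvs.scale_sum_right)

section \<open>The matrix exponential\<close>

lemma mpow_0 [simp]: "mpow A 0 = mat 1"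
  by (simp add: mpow_def)

lemma mpow_Suc: "mpow A (Suc k) = A ** mpow A k"
  by (simp add: mpow_def)

lemma mpow_comm: "A ** B = B ** A \<Longrightarrow> mpow A k ** B = B ** mpow A k"
proof (induction k)
  case (Suc k)
  then show ?case
    by (simp add: mpow_Suc matrix_mul_assoc [symmetric]) (simp add: matrix_mul_assoc)
qed simp

lemma mpow_Suc': "mpow A (Suc k) = mpow A k ** A"
  by (simp add: mpow_Suc mpow_comm)

lemma mpow_add: "mpow A (j + k) = mpow A j ** mpow A k"
  by (induction j) (auto simp: mpow_Suc matrix_mul_assoc)

lemma mpow_scaleC: "mpow (c *\<^sub>C A) k = c ^ k *\<^sub>C mpow A k"
  by (induction k) (auto simp: mpow_Suc scaleC_mat_mul_left scaleC_mat_mul_right scaleC_scaleC)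

lemma mpow_vconj: "mpow (vconj A) k = vconj (mpow A k)"
  by (induction k) (auto simp: mpow_Suc vconj_mat_mul vconj_mat_1)

definition entry_bound :: "complex^'n^'n \<Rightarrow> real" where
  "entry_bound A = (\<Sum>i\<in>UNIV. \<Sum>j\<in>UNIV. cmod (A $ i $ j))"

lemma mpow_entry_le: "cmod (mpow A k $ i $ j) \<le> entry_bound A ^ k"
proof (induction k arbitrary: i)
  case 0
  then show ?case by (simp add: mat_def)
next
  case (Suc k)
  have nn: "entry_bound A \<ge> 0"
    by (simp add: entry_bound_def sum_nonneg)
  have "cmod (mpow A (Suc k) $ i $ j) \<le> (\<Sum>l\<in>UNIV. cmod (A $ i $ l * mpow A k $ l $ j))"
    by (simp add: mpow_Suc matrix_matrix_mult_def norm_sum)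
  also have "\<dots> \<le> (\<Sum>l\<in>UNIV. cmod (A $ i $ l) * entry_bound A ^ k)"
    by (intro sum_mono) (auto simp: norm_mult intro!: mult_left_mono Suc.IH)
  also have "\<dots> = (\<Sum>l\<in>UNIV. cmod (A $ i $ l)) * entry_bound A ^ k"
    by (simp add: sum_distrib_right)
  also have "\<dots> \<le> entry_bound A * entry_bound A ^ k"
    unfolding entry_bound_def
    by (intro mult_right_mono member_le_sum[where f="\<lambda>i. \<Sum>j\<in>UNIV. cmod (A $ i $ j)"])
       (auto intro!: sum_nonneg zero_le_power)
  finally show ?case by simp
qed

lemma summable_mexp_entry: "summable (\<lambda>k. (mpow A k $ i $ j / fact k) * z ^ k)"
proof (rule summable_comparison_test')
  show "summable (\<lambda>k. (entry_bound A * cmod z) ^ k / fact k)"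
    using summable_exp[of "entry_bound A * cmod z"] by (simp add: field_simps)
  show "norm (mpow A k $ i $ j / fact k * z ^ k) \<le> (entry_bound A * cmod z) ^ k / fact k" for k
    using mpow_entry_le[of A k i j]
    by (auto simp: norm_mult norm_divide norm_power power_mult_distrib field_simps
        intro!: mult_left_mono)
qed

lemma sums_vecI:
  fixes f :: "nat \<Rightarrow> 'a::real_normed_vector ^ 'n"
  assumes "\<And>i. (\<lambda>k. f k $ i) sums (l $ i)"
  shows "f sums l"
  using assms unfolding sums_def by (auto intro!: vec_tendstoI)

lemma sums_vec_nth:
  fixes f :: "nat \<Rightarrow> 'a::real_normed_vector ^ 'n"
  shows "f sums l \<Longrightarrow> (\<lambda>k. f k $ i) sums (l $ i)"
  by (rule bounded_linear.sums[OF bounded_linear_vec_nth])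

lemma mexp_sums: "(\<lambda>k. (1 / fact k) *\<^sub>R mpow A k) sums mexp A"
proof -
  have "(\<lambda>k. (1 / fact k) *\<^sub>R mpow A k) sums (\<chi> i j. \<Sum>k. mpow A k $ i $ j / fact k * 1 ^ k)"
    using summable_mexp_entry[of A _ _ 1]
    by (intro sums_vecI) (auto simp: scaleR_eq_scaleC summable_sums)
  then show ?thesis
    unfolding mexp_def by (rule summable_sums[OF sums_summable])
qed

lemma mexp_entry_sums: "(\<lambda>k. mpow A k $ i $ j / fact k * z ^ k) sums (mexp (z *\<^sub>C A) $ i $ j)"
proof -
  have "(\<lambda>k. ((1 / fact k) *\<^sub>R mpow (z *\<^sub>C A) k) $ i $ j) sums (mexp (z *\<^sub>C A) $ i $ j)"
    by (intro sums_vec_nth mexp_sums)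
  then show ?thesis
    by (simp add: mpow_scaleC scaleR_eq_scaleC field_simps)
qed

lemma mexp_vec_sums: "(\<lambda>k. (1 / fact k) *\<^sub>R (mpow A k *v v)) sums (mexp A *v v)"
proof (rule sums_vecI)
  fix i
  have "(\<lambda>k. \<Sum>j\<in>UNIV. ((1 / fact k) *\<^sub>R mpow A k) $ i $ j * v $ j) sums (\<Sum>j\<in>UNIV. mexp A $ i $ j * v $ j)"
    by (intro sums_sum sums_mult2 sums_vec_nth mexp_sums)
  then show "(\<lambda>k. ((1 / fact k) *\<^sub>R (mpow A k *v v)) $ i) sums ((mexp A *v v) $ i)"
    by (simp add: matrix_vector_mult_def scaleR_eq_scaleC sum_divide_distrib)
qed

lemma mexp_0 [simp]: "mexp 0 = (mat 1 :: complex^'n^'n)"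
proof -
  have "mpow (0::complex^'n^'n) k = (if k = 0 then mat 1 else 0)" for k
    by (induction k) (auto simp: mpow_Suc)
  then have "(\<lambda>k. (1 / fact k) *\<^sub>R mpow (0::complex^'n^'n) k) = (\<lambda>k. if k = 0 then mat 1 else 0)"
    by auto
  then show ?thesis
    using sums_unique2[OF mexp_sums[of "0::complex^'n^'n"]] sums_single[of 0 "\<lambda>k. mat 1"] by fastforce
qed

lemma mexp_vconj: "mexp (vconj A) = vconj (mexp (A::complex^'n^'n))"
proof -
  have "bounded_linear (vconj :: complex^'n^'n \<Rightarrow> _)"
    using linear_vconj linear_conv_bounded_linear by blast
  note bl = bounded_linear.sums[OF this mexp_sums[of A]]
  have "(\<lambda>k. (1 / fact k) *\<^sub>R mpow (vconj A) k) sums vconj (mexp A)"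
    using bl
    by (simp add: mpow_vconj vconj_scaleR)
  then show ?thesis using mexp_sums sums_unique2 by blast
qed

lemma linear_mat_mul_left: "linear (\<lambda>X::complex^'n^'n. (A::complex^'n^'n) ** X)"
  by (rule linearI) (auto simp: matrix_add_ldistrib scaleR_eq_scaleC scaleC_mat_mul_right)

lemma linear_mat_mul_right: "linear (\<lambda>X::complex^'n^'n. X ** (A::complex^'n^'n))"
  by (rule linearI) (auto simp: matrix_add_rdistrib scaleR_eq_scaleC scaleC_mat_mul_left)

lemma mexp_commute:
  fixes A B :: "complex^'n^'n"
  assumes "A ** B = B ** A"
  shows "mexp A ** B = B ** mexp A"
proof -
  have "(\<lambda>k. ((1 / fact k) *\<^sub>R mpow A k) ** B) sums (mexp A ** B)"
    by (rule bounded_linear.sums[OF linear_mat_mul_right[unfolded linear_conv_bounded_linear] mexp_sums])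
  moreover have "(\<lambda>k. B ** ((1 / fact k) *\<^sub>R mpow A k)) sums (B ** mexp A)"
    by (rule bounded_linear.sums[OF linear_mat_mul_left[unfolded linear_conv_bounded_linear] mexp_sums])
  ultimately show ?thesis
    using mpow_comm[OF assms]
    by (simp add: scaleR_eq_scaleC scaleC_mat_mul_left scaleC_mat_mul_right sums_unique2)
qed

lemma mexp_conj:
  fixes g h A :: "complex^'n^'n"
  assumes "h ** g = mat 1"
  shows "mexp (g ** A ** h) = g ** mexp A ** h"
proof -
  have hg: "g ** h = mat 1" using assms matrix_left_right_inverse by blast
  have p: "mpow (g ** A ** h) k = g ** mpow A k ** h" for k
  proof (induction k)
    case (Suc k)
    have "mpow (g ** A ** h) (Suc k) = g ** A ** (h ** g) ** mpow A k ** h"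
      by (simp only: mpow_Suc Suc matrix_mul_assoc)
    then show ?case by (simp add: assms mpow_Suc matrix_mul_assoc)
  qed (simp add: hg)
  have "linear (\<lambda>X. g ** X ** h)"
    by (rule linearI) (auto simp: matrix_add_ldistrib matrix_add_rdistrib scaleR_eq_scaleC
        scaleC_mat_mul_right scaleC_mat_mul_left)
  then have "(\<lambda>k. g ** ((1 / fact k) *\<^sub>R mpow A k) ** h) sums (g ** mexp A ** h)"
    unfolding linear_conv_bounded_linear by (rule bounded_linear.sums[OF _ mexp_sums])
  then have "(\<lambda>k. (1 / fact k) *\<^sub>R mpow (g ** A ** h) k) sums (g ** mexp A ** h)"
    by (simp add: p scaleR_eq_scaleC scaleC_mat_mul_left scaleC_mat_mul_right)
  then show ?thesis using mexp_sums sums_unique2 by blast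
qed

lemma mexp_entry_has_derivative:
  "((\<lambda>z. mexp (z *\<^sub>C A) $ i $ j) has_field_derivative (A ** mexp (z *\<^sub>C A)) $ i $ j) (at z)"
proof -
  define c where "c = (\<lambda>k. mpow A k $ i $ j / fact k)"
  have e: "(\<lambda>z. mexp (z *\<^sub>C A) $ i $ j) = (\<lambda>z. \<Sum>k. c k * z ^ k)"
    using mexp_entry_sums[of A i j] by (auto simp: c_def sums_iff)
  have s: "summable (\<lambda>k. c k * z ^ k)" for z
    unfolding c_def by (rule summable_mexp_entry)
  have "DERIV (\<lambda>z. \<Sum>k. c k * z ^ k) z :> (\<Sum>k. diffs c k * z ^ k)"
    using s by (rule termdiffs_strong_converges_everywhere)
  moreover have "(\<lambda>k. diffs c k * z ^ k) = (\<lambda>k. \<Sum>l\<in>UNIV. A $ i $ l * (mpow A k $ l $ j / fact k * z ^ k))"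
  proof
    fix k
    have "diffs c k = mpow A (Suc k) $ i $ j / fact k"
      by (simp add: diffs_def c_def field_simps del: of_nat_Suc)
    then show "diffs c k * z ^ k = (\<Sum>l\<in>UNIV. A $ i $ l * (mpow A k $ l $ j / fact k * z ^ k))"
      by (simp add: mpow_Suc matrix_matrix_mult_def sum_divide_distrib sum_distrib_right mult.assoc)
  qed
  moreover have "(\<lambda>k. \<Sum>l\<in>UNIV. A $ i $ l * (mpow A k $ l $ j / fact k * z ^ k)) sums 
     (A ** mexp (z *\<^sub>C A)) $ i $ j"
    unfolding matrix_matrix_mult_def
    by (simp only: vec_lambda_beta, intro sums_sum sums_mult mexp_entry_sums)
  ultimately show ?thesis
    unfolding e by (simp add: sums_iff)
qed

lemma mexp_commute_self: "A ** mexp (z *\<^sub>C A) = mexp (z *\<^sub>C A) ** A"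
  by (rule mexp_commute[symmetric]) (simp add: scaleC_mat_mul_left scaleC_mat_mul_right)

text \<open>As a function of \<open>z\<close> the left-hand side has derivative zero, so it keeps its value at \<open>z = 0\<close>.\<close>

lemma mexp_mult_inverse_aux: "mexp ((w + z) *\<^sub>C A) ** mexp (- z *\<^sub>C A) = mexp (w *\<^sub>C A)"
proof -
  have "(mexp ((w + z) *\<^sub>C A) ** mexp (- z *\<^sub>C A)) $ i $ j = mexp (w *\<^sub>C A) $ i $ j" for i j
  proof -
    define G where "G = (\<lambda>z. (mexp ((w + z) *\<^sub>C A) ** mexp (- z *\<^sub>C A)) $ i $ j)"
    have d: "(G has_field_derivative 0) (at z)" for z
    proof -
      have "((\<lambda>z. w + z) has_field_derivative 1) (at z)" "((\<lambda>z. - z) has_field_derivative - 1) (at z)"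
        by (auto intro!: derivative_eq_intros)
      note d0 = DERIV_chain2[OF mexp_entry_has_derivative this(1)] DERIV_chain2[OF mexp_entry_has_derivative this(2)]
      have d1: "((\<lambda>z. mexp ((w + z) *\<^sub>C A) $ i $ l) has_field_derivative
               (mexp ((w + z) *\<^sub>C A) ** A) $ i $ l) (at z)" for l
        using d0(1)[of A i l] by (simp add: mexp_commute_self)
      have d2: "((\<lambda>z. mexp (- z *\<^sub>C A) $ l $ j) has_field_derivative
               - (A ** mexp (- z *\<^sub>C A)) $ l $ j) (at z)" for l
        using d0(2)[of A l j] by simp
      have "(G has_field_derivative (\<Sum>l\<in>UNIV. (mexp ((w + z) *\<^sub>C A) ** A) $ i $ l * mexp (- z *\<^sub>C A) $ l $ j
              + (- (A ** mexp (- z *\<^sub>C A)) $ l $ j) * mexp ((w + z) *\<^sub>C A) $ i $ l)) (at z)"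
        unfolding G_def matrix_matrix_mult_def[of "mexp _" "mexp _"]
        by (simp, intro DERIV_sum DERIV_mult[OF d1 d2, simplified])
      also have "(\<Sum>l\<in>UNIV. (mexp ((w + z) *\<^sub>C A) ** A) $ i $ l * mexp (- z *\<^sub>C A) $ l $ j
              + (- (A ** mexp (- z *\<^sub>C A)) $ l $ j) * mexp ((w + z) *\<^sub>C A) $ i $ l)
         = ((mexp ((w + z) *\<^sub>C A) ** A) ** mexp (- z *\<^sub>C A)) $ i $ j
           - (mexp ((w + z) *\<^sub>C A) ** (A ** mexp (- z *\<^sub>C A))) $ i $ j"
        by (simp only: matrix_matrix_mult_def[of "_ ** A"] matrix_matrix_mult_def[of "mexp _" "A ** _"]
            vec_lambda_beta flip: sum_subtractf) (simp add: mult.commute)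
      also have "\<dots> = 0" by (simp add: matrix_mul_assoc)
      finally show ?thesis .
    qed
    have "\<exists>c. \<forall>z\<in>UNIV. G z = c"
      by (rule has_field_derivative_zero_constant) (auto intro: d has_field_derivative_at_within)
    then have "G z = G 0" by auto
    then show ?thesis by (simp add: G_def)
  qed
  then show ?thesis by (simp add: vec_eq_iff)
qed

lemma mexp_inverse: "mexp (z *\<^sub>C A) ** mexp (- z *\<^sub>C A) = mat 1" 
    "mexp (- z *\<^sub>C A) ** mexp (z *\<^sub>C A) = mat 1"
  using mexp_mult_inverse_aux[of 0 z A] mexp_mult_inverse_aux[of 0 "-z" A] by simp_all

lemma invertible_mexp: "invertible (mexp A)"
  using mexp_inverse[of 1 A] by (auto simp: invertible_def)

lemma matrix_inv_eqI:
  fixes A B :: "complex^'n^'n"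
  assumes "A ** B = mat 1"
  shows "matrix_inv A = B"
proof -
  have "invertible A" using assms matrix_left_right_inverse unfolding invertible_def by blast
  then have "matrix_inv A ** A = mat 1"
    unfolding invertible_def matrix_inv_def by (rule someI2_ex) simp
  then have "matrix_inv A ** (A ** B) = B"
    by (simp add: matrix_mul_assoc)
  then show ?thesis by (simp add: assms)
qed

lemma mexp_difference_quotient:
  "(\<lambda>k. real (Suc k) *\<^sub>R (mexp ((1 / real (Suc k)) *\<^sub>R X) - mat 1)) \<longlonglongrightarrow> X"
proof (intro vec_tendstoI)
  fix i j
  let ?f = "\<lambda>z. mexp (z *\<^sub>C X) $ i $ j"
  have "(?f has_field_derivative X $ i $ j) (at 0)"
    using mexp_entry_has_derivative[of X i j 0] by simp
  then have l: "((\<lambda>h. (?f h - mat 1 $ i $ j) / h) \<longlongrightarrow> X $ i $ j) (at 0)"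
    by (simp add: DERIV_def)
  have "(\<lambda>k. 1 / real (Suc k)) \<longlonglongrightarrow> 0"
    using LIMSEQ_inverse_real_of_nat by (simp add: inverse_eq_divide)
  then have "(\<lambda>k. complex_of_real (1 / real (Suc k))) \<longlonglongrightarrow> complex_of_real 0"
    by (rule tendsto_of_real)
  then have "filterlim (\<lambda>k. complex_of_real (1 / real (Suc k))) (at 0) sequentially"
    by (auto simp: filterlim_at simp del: of_nat_Suc)
  from filterlim_compose[OF l this]
  have "(\<lambda>k. (?f (complex_of_real (1 / real (Suc k))) - mat 1 $ i $ j) / complex_of_real (1 / real (Suc k))) 
     \<longlonglongrightarrow> X $ i $ j" .
  then show "(\<lambda>k. (real (Suc k) *\<^sub>R (mexp ((1 / real (Suc k)) *\<^sub>R X) - mat 1)) $ i $ j) \<longlonglongrightarrow> X $ i $ j"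
    by (simp add: scaleR_eq_scaleC mult.commute del: of_nat_Suc)
qed

text \<open>Passing from a one-parameter group to its generator: \<open>X\<close> is the limit of the difference
  quotients of \<open>exp(tX)\<close>, and a linear condition is closed.\<close>

lemma mexp_difference_quotient_mem:
  fixes f :: "complex^'n^'n \<Rightarrow> 'b::euclidean_space"
  assumes f: "linear f" and S: "subspace S"
    and mem: "\<And>t::real. f (mexp (t *\<^sub>R X)) - f (mat 1) \<in> S"
  shows "f X \<in> S"
proof -
  have "(\<lambda>k. f (real (Suc k) *\<^sub>R (mexp ((1 / real (Suc k)) *\<^sub>R X) - mat 1))) \<longlonglongrightarrow> f X"
    using linear_continuous_at[of f X] f mexp_difference_quotient[of X]
    by (intro isCont_tendsto_compose[of X f]) (auto simp: linear_conv_bounded_linear)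
  moreover have "f (real (Suc k) *\<^sub>R (mexp ((1 / real (Suc k)) *\<^sub>R X) - mat 1)) \<in> S" for k
    using mem S by (simp add: linear_scale[OF f] linear_diff[OF f] subspace_scale)
  ultimately show ?thesis
    using closed_sequentially[OF closed_subspace[OF S]] by fast
qed

lemma mexp_vec_mem:
  assumes S: "cvs.subspace S" and X: "\<And>v. v \<in> S \<Longrightarrow> X *v v \<in> S" and v: "v \<in> (S::(complex^'n) set)"
  shows "mexp X *v v \<in> S"
proof -
  have p: "mpow X k *v v \<in> S" for k
    by (induction k) (auto simp: v mpow_Suc X simp flip: matrix_vector_mul_assoc)
  have "subspace S" by (rule subspace_of_csubspace[OF S])
  then have "(\<Sum>k<m. (1 / fact k) *\<^sub>R (mpow X k *v v)) \<in> S" for m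
    by (intro subspace_sum subspace_scale p)
  then show ?thesis
    using closed_sequentially[OF closed_subspace[OF \<open>subspace S\<close>]] mexp_vec_sums[of X v]
    unfolding sums_def by fast
qed

lemma mexp_eigenvector:
  assumes "A *v v = c *\<^sub>C v"
  shows "mexp (z *\<^sub>C A) *v v = exp (z * c) *\<^sub>C (v::complex^'n)"
proof -
  have p: "mpow A k *v v = c ^ k *\<^sub>C v" for k
    by (induction k) (auto simp: mpow_Suc assms mat_vec_scaleC scaleC_scaleC mult.commute
        simp flip: matrix_vector_mul_assoc)
  have "(\<lambda>k. (1 / fact k) *\<^sub>R (mpow (z *\<^sub>C A) k *v v)) = (\<lambda>k. ((z * c) ^ k /\<^sub>R fact k) *\<^sub>C v)"
    by (auto simp: mpow_scaleC scaleC_mat_vec p scaleC_scaleC scaleR_eq_scaleC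
       scaleR_conv_of_real power_mult_distrib field_simps)
  moreover have "(\<lambda>k. ((z * c) ^ k /\<^sub>R fact k) *\<^sub>C v) sums (exp (z * c) *\<^sub>C v)"
    by (rule sums_vecI) (simp only: scaleC_vec_nth scaleC_complex_eq, rule sums_mult2, rule exp_converges)
  ultimately show ?thesis
    using mexp_vec_sums[of "z *\<^sub>C A" v] sums_unique2 by metis
qed

lemma mexp_nilpotent_vec:
  assumes "mpow N m *v v = 0"
  shows "mexp (z *\<^sub>C N) *v v = (\<Sum>k<m. (z ^ k / fact k) *\<^sub>C (mpow N k *v (v::complex^'n)))"
proof -
  have "mpow N k *v v = 0" if "k \<ge> m" for k
  proof -
    have "mpow N k = mpow N (k - m) ** mpow N m" 
      using that by (simp flip: mpow_add)
    then show ?thesis using assms by (simp flip: matrix_vector_mul_assoc)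
  qed
  then have "(\<lambda>k. (1 / fact k) *\<^sub>R (mpow (z *\<^sub>C N) k *v v)) sums
     (\<Sum>k<m. (1 / fact k) *\<^sub>R (mpow (z *\<^sub>C N) k *v v))"
    by (intro sums_finite) (auto simp: mpow_scaleC scaleC_mat_vec)
  then have "mexp (z *\<^sub>C N) *v v = (\<Sum>k<m. (1 / fact k) *\<^sub>R (mpow (z *\<^sub>C N) k *v v))"
    using mexp_vec_sums sums_unique2 by blast
  then show ?thesis
    by (simp add: mpow_scaleC scaleC_mat_vec scaleR_eq_scaleC scaleC_scaleC)
qed

section \<open>Lie algebras of algebraic groups\<close>

lemma poly_funs_mono: "K \<subseteq> L \<Longrightarrow> poly_funs K \<subseteq> (poly_funs L :: (complex^'n^'n \<Rightarrow> complex) set)"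
proof
  fix f :: "complex^'n^'n \<Rightarrow> complex" assume "K \<subseteq> L" "f \<in> poly_funs K"
  from this(2,1) show "f \<in> poly_funs L"
    by induction (auto intro: poly_funs.intros)
qed

lemma poly_funs_sum:
  assumes "0 \<in> K" "\<And>i. i \<in> I \<Longrightarrow> f i \<in> poly_funs K"
  shows "(\<lambda>A. \<Sum>i\<in>I. f i A) \<in> poly_funs K"
  using assms(2)
  by (induction I rule: infinite_finite_induct) (auto intro: poly_funs.intros assms(1))

lemma poly_funs_vconj: "f \<in> poly_funs \<real> \<Longrightarrow> f (vconj A) = cnj (f A)"
proof (induction rule: poly_funs.induct)
  case (const c)
  then show ?case by (metis Reals_cnj_iff)
qed auto

text \<open>The differential \<open>d g X\<close> of a polynomial function \<open>f\<close> at \<open>g\<close> in the direction \<open>X\<close>, through the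
  properties by which it is used: linearity in \<open>X\<close>; along the left-invariant vector field \<open>g X\<close> it is again a
  polynomial function of \<open>g\<close>; and it is the derivative of \<open>f\<close> along the curves \<open>g exp(zX)\<close>.\<close>

definition poly_derivation ::
  "(complex^'n^'n \<Rightarrow> complex) \<Rightarrow> (complex^'n^'n \<Rightarrow> complex^'n^'n \<Rightarrow> complex) \<Rightarrow> bool" where
  "poly_derivation f d \<longleftrightarrow>
     (\<forall>g X Y. d g (X + Y) = d g X + d g Y) \<and> (\<forall>g c X. d g (c *\<^sub>C X) = c * d g X) \<and>
     (\<forall>X. (\<lambda>g. d g (g ** X)) \<in> poly_funs UNIV) \<and>
     (\<forall>g X z. ((\<lambda>z. f (g ** mexp (z *\<^sub>C X))) has_field_derivative
        d (g ** mexp (z *\<^sub>C X)) (g ** mexp (z *\<^sub>C X) ** X)) (at z))"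

lemma poly_derivationD:
  assumes "poly_derivation f d"
  shows "d g (X + Y) = d g X + d g Y" "d g (c *\<^sub>C X) = c * d g X"
    "(\<lambda>g. d g (g ** X)) \<in> poly_funs UNIV"
    "((\<lambda>z. f (g ** mexp (z *\<^sub>C X))) has_field_derivative
        d (g ** mexp (z *\<^sub>C X)) (g ** mexp (z *\<^sub>C X) ** X)) (at z)"
  using assms unfolding poly_derivation_def by blast+

lemma mult_mexp_entry_has_derivative:
  "((\<lambda>z. (g ** mexp (z *\<^sub>C X)) $ i $ j) has_field_derivative (g ** mexp (z *\<^sub>C X) ** X) $ i $ j) (at z)"
proof -
  have "((\<lambda>z. \<Sum>k\<in>UNIV. g $ i $ k * mexp (z *\<^sub>C X) $ k $ j) has_field_derivative
     (\<Sum>k\<in>UNIV. g $ i $ k * (X ** mexp (z *\<^sub>C X)) $ k $ j)) (at z)"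
    by (intro DERIV_sum DERIV_cmult mexp_entry_has_derivative)
  moreover have "(\<Sum>k\<in>UNIV. g $ i $ k * (X ** mexp (z *\<^sub>C X)) $ k $ j) = (g ** (mexp (z *\<^sub>C X) ** X)) $ i $ j"
    by (simp add: matrix_matrix_mult_def[of g] mexp_commute_self)
  ultimately show ?thesis
    by (simp add: matrix_matrix_mult_def[of g "mexp _"] matrix_mul_assoc)
qed

lemma poly_derivation_exists:
  fixes f :: "complex^'n^'n \<Rightarrow> complex"
  assumes "f \<in> poly_funs K"
  shows "\<exists>d. poly_derivation f d"
  using assms
proof (induction rule: poly_funs.induct)
  case (const c)
  have "poly_derivation (\<lambda>A. c) (\<lambda>g X. 0)"
    by (auto simp: poly_derivation_def intro: poly_funs.intros)
  then show ?case by blast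
next
  case (entry i j)
  have "(\<lambda>g. (g ** X) $ i $ j) \<in> poly_funs UNIV" for X :: "complex^'n^'n"
    by (auto simp: matrix_matrix_mult_def intro!: poly_funs_sum poly_funs.intros)
  then have "poly_derivation (\<lambda>A. A $ i $ j) (\<lambda>g X. X $ i $ j)"
    unfolding poly_derivation_def by (auto intro: mult_mexp_entry_has_derivative)
  then show ?case by blast
next
  case (add f g)
  then obtain d e where d: "poly_derivation f d" and e: "poly_derivation g e" by blast
  have "poly_derivation (\<lambda>A. f A + g A) (\<lambda>h X. d h X + e h X)"
    unfolding poly_derivation_def
    by (intro conjI allI poly_funs.add poly_derivationD[OF d] poly_derivationD[OF e] DERIV_add)
       (simp_all add: poly_derivationD[OF d] poly_derivationD[OF e] distrib_left ac_simps)
  then show ?case by blast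
next
  case (mult f g)
  then obtain d e where d: "poly_derivation f d" and e: "poly_derivation g e" by blast
  have mono: "f \<in> poly_funs UNIV" "g \<in> poly_funs UNIV"
    using mult.hyps poly_funs_mono[of K UNIV] by auto
  have "poly_derivation (\<lambda>A. f A * g A) (\<lambda>h X. d h X * g h + e h X * f h)"
    unfolding poly_derivation_def
    by (intro conjI allI poly_funs.add poly_funs.mult poly_derivationD[OF d] poly_derivationD[OF e] mono
          DERIV_mult)
       (simp_all add: poly_derivationD[OF d] poly_derivationD[OF e] distrib_left distrib_right ac_simps)
  then show ?case by blast
qed

definition vanishing :: "(complex^'n^'n) set \<Rightarrow> (complex^'n^'n \<Rightarrow> complex) set" where
  "vanishing H = {f \<in> poly_funs UNIV. \<forall>A\<in>H. f A = 0}"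

text \<open>Tangency of the left-invariant vector field of \<open>X\<close> to \<open>H\<close>.  This condition is visibly complex linear in
  \<open>X\<close>, in contrast to the definition of \<open>lie_algebra\<close> by one-parameter groups.\<close>

definition tangent_to :: "(complex^'n^'n) set \<Rightarrow> complex^'n^'n \<Rightarrow> bool" where
  "tangent_to H X \<longleftrightarrow> (\<forall>f\<in>vanishing H. \<forall>d. poly_derivation f d \<longrightarrow> (\<forall>g\<in>H. d g (g ** X) = 0))"

lemma algebraic_subgroup_iff_vanishing:
  assumes "algebraic_subgroup K H" 
  shows "A \<in> H \<longleftrightarrow> invertible A \<and> (\<forall>f\<in>vanishing H. f A = 0)"
proof -
  obtain S where S: "S \<subseteq> poly_funs K" "H = {A. invertible A \<and> (\<forall>f\<in>S. f A = 0)}"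
    using assms by (auto simp: algebraic_subgroup_def defined_over_def)
  then have "S \<subseteq> vanishing H"
    using poly_funs_mono[of K UNIV] by (auto simp: vanishing_def)
  then show ?thesis using S(2) by (auto simp: vanishing_def)
qed

text \<open>Differentiation along \<open>X\<close> maps the polynomials vanishing on \<open>H\<close> to polynomials vanishing on \<open>H\<close>.  So all
  derivatives of \<open>f(exp(zX))\<close> at \<open>z = 0\<close> vanish if \<open>f\<close> vanishes on \<open>H\<close>, and this entire function of \<open>z\<close> is zero.\<close>

lemma tangent_to_mexp_mem:
  assumes H: "algebraic_subgroup K H" and X: "tangent_to H X"
  shows "mexp (z *\<^sub>C X) \<in> H"
proof -
  have one: "mat 1 \<in> H" using H by (auto simp: algebraic_subgroup_def)
  have "(deriv ^^ k) (\<lambda>z. f (mexp (z *\<^sub>C X))) 0 = 0 \<and> (\<lambda>z. f (mexp (z *\<^sub>C X))) holomorphic_on UNIV" 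
    if "f \<in> vanishing H" for f k
    using that
  proof (induction k arbitrary: f)
    case (0 f)
    then obtain d where d: "poly_derivation f d" using poly_derivation_exists[of f UNIV]
      by (auto simp: vanishing_def)
    have "((\<lambda>z. f (mexp (z *\<^sub>C X))) has_field_derivative d (mexp (z *\<^sub>C X)) (mexp (z *\<^sub>C X) ** X)) (at z)" for z
      using poly_derivationD(4)[OF d, of "mat 1"] by simp
    then have "(\<lambda>z. f (mexp (z *\<^sub>C X))) holomorphic_on UNIV"
      by (auto simp: holomorphic_on_open)
    then show ?case using 0 one by (auto simp: vanishing_def)
  next
    case (Suc k f)
    then obtain d where d: "poly_derivation f d" using poly_derivation_exists[of f UNIV]
      by (auto simp: vanishing_def)
    have "deriv (\<lambda>z. f (mexp (z *\<^sub>C X))) = (\<lambda>z. d (mexp (z *\<^sub>C X)) (mexp (z *\<^sub>C X) ** X))"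
      using DERIV_imp_deriv[OF poly_derivationD(4)[OF d, of "mat 1"]] by (intro ext) simp
    moreover have "(\<lambda>g. d g (g ** X)) \<in> vanishing H"
      using d X Suc.prems poly_derivationD(3)[OF d] by (auto simp: vanishing_def tangent_to_def)
    ultimately show ?case
      using Suc.IH[of "\<lambda>g. d g (g ** X)"] Suc.IH[OF Suc.prems] by (simp add: funpow_swap1)
  qed
  then have "f (mexp (z *\<^sub>C X)) = 0" if "f \<in> vanishing H" for f
    using that by (intro holomorphic_fun_eq_0_on_connected[of "\<lambda>z. f (mexp (z *\<^sub>C X))" UNIV 0 z]) auto
  then show ?thesis
    using algebraic_subgroup_iff_vanishing[OF H] invertible_mexp by blast
qed

text \<open>For the forward direction, differentiate \<open>f(g exp(tX)) = 0\<close> at \<open>t = 0\<close> along real \<open>t\<close>.\<close>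

lemma lie_algebra_iff_tangent_to:
  assumes H: "algebraic_subgroup K H"
  shows "X \<in> lie_algebra H \<longleftrightarrow> tangent_to H X"
proof
  assume "tangent_to H X"
  then show "X \<in> lie_algebra H"
    using tangent_to_mexp_mem[OF H] by (auto simp: lie_algebra_def scaleR_eq_scaleC)
next
  assume X: "X \<in> lie_algebra H"
  show "tangent_to H X"
    unfolding tangent_to_def
  proof (intro ballI allI impI)
    fix f d g assume f: "f \<in> vanishing H" and d: "poly_derivation f d" and g: "g \<in> H"
    let ?F = "\<lambda>z. f (g ** mexp (z *\<^sub>C X))"
    have "(?F has_field_derivative d (g ** mexp (0 *\<^sub>C X)) (g ** mexp (0 *\<^sub>C X) ** X)) (at 0)"
      by (rule poly_derivationD(4)[OF d])
    then have l: "((\<lambda>h. (?F h - ?F 0) / h) \<longlongrightarrow> d g (g ** X)) (at 0)"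
      by (simp add: DERIV_def)
    have "(\<lambda>k. 1 / real (Suc k)) \<longlonglongrightarrow> 0"
      using LIMSEQ_inverse_real_of_nat by (simp add: inverse_eq_divide)
    then have "(\<lambda>k. complex_of_real (1 / real (Suc k))) \<longlonglongrightarrow> complex_of_real 0"
      by (rule tendsto_of_real)
    then have "filterlim (\<lambda>k. complex_of_real (1 / real (Suc k))) (at 0) sequentially"
      by (auto simp: filterlim_at simp del: of_nat_Suc)
    note l' = filterlim_compose[OF l this]
    have "?F (complex_of_real t) = 0" for t
      using X g f H by (auto simp: lie_algebra_def vanishing_def algebraic_subgroup_def scaleR_eq_scaleC)
    note F0 = this
    have "(\<lambda>k. (?F (complex_of_real (1 / real (Suc k))) - ?F 0) / complex_of_real (1 / real (Suc k))) = (\<lambda>k. 0)"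
      using F0[of 0] by (simp only: F0 of_real_0) simp
    then have "(\<lambda>k. 0) \<longlonglongrightarrow> d g (g ** X)"
      using l' by simp
    then show "d g (g ** X) = 0" by (simp add: LIMSEQ_const_iff)
  qed
qed

lemma csubspace_lie_algebra:
  assumes H: "algebraic_subgroup K H"
  shows "cvs.subspace (lie_algebra H)"
  unfolding cvs.subspace_def lie_algebra_iff_tangent_to[OF H]
proof (intro conjI ballI allI)
  show "tangent_to H 0"
    unfolding tangent_to_def
  proof (intro ballI allI impI)
    fix f d g assume "poly_derivation f d"
    from poly_derivationD(2)[OF this, of g 0 0] show "d g (g ** 0) = 0" by simp
  qed
next
  fix X Y assume "X \<in> lie_algebra H" "Y \<in> lie_algebra H"
  then have t: "tangent_to H X" "tangent_to H Y" by (auto simp: lie_algebra_iff_tangent_to[OF H])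
  show "tangent_to H (X + Y)"
    unfolding tangent_to_def
  proof (intro ballI allI impI)
    fix f d g assume "f \<in> vanishing H" and d: "poly_derivation f d" and "g \<in> H"
    then have "d g (g ** X) = 0" "d g (g ** Y) = 0" using t by (auto simp: tangent_to_def)
    then show "d g (g ** (X + Y)) = 0"
      by (simp add: matrix_add_ldistrib poly_derivationD(1)[OF d])
  qed
next
  fix c X assume "X \<in> lie_algebra H"
  then have t: "tangent_to H X" by (auto simp: lie_algebra_iff_tangent_to[OF H])
  show "tangent_to H (c *\<^sub>C X)"
    unfolding tangent_to_def
  proof (intro ballI allI impI)
    fix f d g assume "f \<in> vanishing H" and d: "poly_derivation f d" and "g \<in> H"
    then have "d g (g ** X) = 0" using t by (auto simp: tangent_to_def)
    then show "d g (g ** (c *\<^sub>C X)) = 0"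
      by (simp add: scaleC_mat_mul_right poly_derivationD(2)[OF d])
  qed
qed

lemma lie_algebra_Ad:
  assumes H: "algebraic_subgroup K H" and "h \<in> H" "X \<in> lie_algebra H" "h ** h' = mat 1"
  shows "h ** X ** h' \<in> lie_algebra H"
proof -
  have h': "h' \<in> H" using assms matrix_inv_eqI[of h h'] by (auto simp: algebraic_subgroup_def)
  have c: "h' ** h = mat 1" using assms(4) matrix_left_right_inverse by blast
  have "mexp (t *\<^sub>R (h ** X ** h')) = h ** mexp (t *\<^sub>R X) ** h'" for t
    using mexp_conj[OF c, of "t *\<^sub>R X"] by (simp add: scaleR_eq_scaleC scaleC_mat_mul_left scaleC_mat_mul_right)
  then show ?thesis
    using assms h' by (auto simp: lie_algebra_def algebraic_subgroup_def)
qed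

text \<open>The bracket is the limit of \<open>k (Ad(exp(X/k)) Y - Y)\<close>, and the Lie algebra is a closed subspace
  stable under \<open>Ad\<close>.\<close>

lemma lie_bracket_mem_lie_algebra:
  assumes H: "algebraic_subgroup K H" and X: "X \<in> lie_algebra H" and Y: "Y \<in> lie_algebra H"
  shows "lie_bracket X Y \<in> lie_algebra H"
proof -
  let ?f = "\<lambda>Z. Z ** Y - Y ** Z" 
  let ?S = "lie_algebra H"
  note cs = csubspace_lie_algebra[OF H]
  note S = subspace_of_csubspace[OF cs]
  define E where "E = (\<lambda>k. mexp ((1 / real (Suc k)) *\<^sub>R X))"
  define E' where "E' = (\<lambda>k. mexp ((1 / real (Suc k)) *\<^sub>R (- X)))"
  have lim: "(\<lambda>k. real (Suc k) *\<^sub>R (E k - mat 1)) \<longlonglongrightarrow> X"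
     "(\<lambda>k. real (Suc k) *\<^sub>R (E' k - mat 1)) \<longlonglongrightarrow> - X"
    unfolding E_def E'_def by (rule mexp_difference_quotient)+
  have "(\<lambda>k. (1 / real (Suc k)) *\<^sub>R (real (Suc k) *\<^sub>R (E k - mat 1))) \<longlonglongrightarrow> 0 *\<^sub>R X"
    using LIMSEQ_inverse_real_of_nat lim(1)
    by (intro tendsto_scaleR) (simp_all add: inverse_eq_divide del: of_nat_Suc)
  then have E1: "E \<longlonglongrightarrow> mat 1"
    by (simp add: LIM_zero_iff del: of_nat_Suc)
  have bl: "bounded_bilinear (\<lambda>(A::complex^'a^'a) (B::complex^'a^'a). A ** B)"
    by (rule bilinear_conv_bounded_bilinear[THEN iffD1])
       (auto simp: bilinear_def linear_mat_mul_left linear_mat_mul_right)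
  note tm = bounded_bilinear.tendsto[OF bl]
  have "(\<lambda>k. (real (Suc k) *\<^sub>R (E k - mat 1)) ** Y + E k ** (Y ** (real (Suc k) *\<^sub>R (E' k - mat 1))))
     \<longlonglongrightarrow> X ** Y + mat 1 ** (Y ** (- X))"
    by (intro tendsto_add tm lim E1 tendsto_const)
  also have "X ** Y + mat 1 ** (Y ** (- X)) = lie_bracket X Y"
    by (simp add: lie_bracket_def mat_mul_minus)
  finally have L: "(\<lambda>k. (real (Suc k) *\<^sub>R (E k - mat 1)) ** Y + E k ** (Y ** (real (Suc k) *\<^sub>R (E' k - mat 1))))
     \<longlonglongrightarrow> lie_bracket X Y" .
  have "(real (Suc k) *\<^sub>R (E k - mat 1)) ** Y + E k ** (Y ** (real (Suc k) *\<^sub>R (E' k - mat 1))) \<in> ?S" for k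
  proof -
    have "E k \<in> H" using X by (simp add: E_def lie_algebra_def)
    moreover have "E k ** E' k = mat 1"
      using mexp_inverse[of "complex_of_real (1 / real (Suc k))" X]
      by (simp add: E_def E'_def scaleR_eq_scaleC del: of_nat_Suc)
    ultimately have "E k ** Y ** E' k \<in> ?S" by (intro lie_algebra_Ad[OF H] Y)
    then have "real (Suc k) *\<^sub>R (E k ** Y ** E' k - Y) \<in> ?S"
      using Y S by (intro subspace_scale subspace_diff)
    also have "real (Suc k) *\<^sub>R (E k ** Y ** E' k - Y) =
      (real (Suc k) *\<^sub>R (E k - mat 1)) ** Y + E k ** (Y ** (real (Suc k) *\<^sub>R (E' k - mat 1)))"
      by (simp add: scaleR_eq_scaleC scaleC_mat_mul_left scaleC_mat_mul_right mat_mul_diff matrix_mul_assoc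
         cvs.scale_right_diff_distrib del: of_nat_Suc)
    finally show ?thesis .
  qed
  then show ?thesis
    using closed_sequentially[OF closed_subspace[OF S]] L by fast
qed

lemma algebraic_subgroup_vconj:
  assumes "algebraic_subgroup \<real> H" "A \<in> H" shows "vconj A \<in> H"
proof -
  have "invertible A" using assms algebraic_subgroup_iff_vanishing by blast
  then obtain B where B: "A ** B = mat 1" "B ** A = mat 1" by (auto simp: invertible_def)
  have "invertible (vconj A)"
    unfolding invertible_def using B by (metis vconj_mat_1 vconj_mat_mul)
  then show ?thesis
    using assms by (auto simp: algebraic_subgroup_def defined_over_def poly_funs_vconj subset_iff)
qed

section \<open>The Mumford--Tate group, its real points and isotropy algebras\<close>

lemma algebraic_subgroup_mono:
  assumes "K \<subseteq> L" "algebraic_subgroup K H" shows "algebraic_subgroup L H"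
  using assms poly_funs_mono[OF assms(1)] unfolding algebraic_subgroup_def defined_over_def by blast

text \<open>The equations of all groups in the intersection together cut out \<open>GC\<close>.  Invertibility of the circle
  representation makes \<open>GL(V)\<close> one of these groups; otherwise the intersection might be empty, that is, the set of
  all matrices.\<close>

lemma GC_algebraic:
  assumes inv: "\<And>z. cmod z = 1 \<Longrightarrow> invertible (circle_rep n F0 z)"
  shows "algebraic_subgroup \<rat> (GC n F0)"
proof -
  let ?C = "{H. algebraic_subgroup \<rat> H \<and> (\<forall>z. cmod z = 1 \<longrightarrow> circle_rep n F0 z \<in> H)}"
  define GL where "GL = {A :: complex^'a^'a. invertible A}"
  have mi: "invertible (matrix_inv A)" if A: "invertible A" for A :: "complex^'a^'a"
  proof -
    obtain B where B: "A ** B = mat 1" "B ** A = mat 1" using A unfolding invertible_def by blast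
    then show ?thesis unfolding matrix_inv_eqI[OF B(1)] invertible_def by blast
  qed
  have "defined_over \<rat> GL"
    unfolding defined_over_def GL_def by (rule exI[of _ "{}"]) simp
  moreover have "mat 1 \<in> GL" unfolding GL_def invertible_def by (auto intro: exI[of _ "mat 1"])
  ultimately have "algebraic_subgroup \<rat> GL"
    unfolding algebraic_subgroup_def using mi invertible_mult by (auto simp: GL_def)
  then have GL: "GL \<in> ?C" using inv by (auto simp: GL_def)
  have "\<forall>H\<in>?C. \<exists>S \<subseteq> poly_funs \<rat>. H = {A. invertible A \<and> (\<forall>f\<in>S. f A = 0)}"
    by (auto simp: algebraic_subgroup_def defined_over_def)
  then obtain S where S: "\<forall>H\<in>?C. S H \<subseteq> poly_funs \<rat> \<and> H = {A. invertible A \<and> (\<forall>f\<in>S H. f A = 0)}"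
    by (rule bchoice[THEN exE])
  have m: "A \<in> H \<longleftrightarrow> invertible A \<and> (\<forall>f\<in>S H. f A = 0)" if "H \<in> ?C" for A H
    by (rule conjunct2[OF S[rule_format, OF that], unfolded set_eq_iff mem_Collect_eq, rule_format])
  have "GC n F0 = {A. invertible A \<and> (\<forall>f\<in>(\<Union>H\<in>?C. S H). f A = 0)}"
  proof (intro set_eqI iffI)
    fix A assume "A \<in> GC n F0"
    then have "A \<in> H" if "H \<in> ?C" for H using that unfolding GC_def by blast
    then show "A \<in> {A. invertible A \<and> (\<forall>f\<in>(\<Union>H\<in>?C. S H). f A = 0)}"
      using m GL by blast
  next
    fix A assume "A \<in> {A. invertible A \<and> (\<forall>f\<in>(\<Union>H\<in>?C. S H). f A = 0)}"
    then have "A \<in> H" if "H \<in> ?C" for H using m[OF that] that by blast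
    then show "A \<in> GC n F0" unfolding GC_def by blast
  qed
  moreover have "(\<Union>H\<in>?C. S H) \<subseteq> poly_funs \<rat>" using S by blast
  ultimately have "defined_over \<rat> (GC n F0)" unfolding defined_over_def by blast
  then show ?thesis
    by (auto simp: algebraic_subgroup_def GC_def)
qed

text \<open>The Lie algebra of \<open>stabC n F0 x\<close>, see \<open>lie_stabC\<close>, in terms of linear conditions.\<close>

definition isotropy ::
  "nat \<Rightarrow> (int \<Rightarrow> (complex^'n) set) \<Rightarrow> (int \<Rightarrow> (complex^'n) set) \<Rightarrow> (complex^'n^'n) set" where
  "isotropy n F0 x = {X \<in> gC n F0. \<forall>p. \<forall>v\<in>x p. X *v v \<in> x p}"

locale mt_group =
  fixes n :: nat and F0 :: "int \<Rightarrow> (complex^'n) set"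
  assumes alg: "algebraic_subgroup \<real> (GC n F0)"
begin

lemma GC_mult: "A \<in> GC n F0 \<Longrightarrow> B \<in> GC n F0 \<Longrightarrow> A ** B \<in> GC n F0"
  and GC_inv: "A \<in> GC n F0 \<Longrightarrow> matrix_inv A \<in> GC n F0"
  using alg by (auto simp: algebraic_subgroup_def)

lemma GC_inverse:
  assumes "A \<in> GC n F0" 
  shows "A ** matrix_inv A = mat 1" "matrix_inv A ** A = mat 1"
proof -
  have "invertible A" using assms alg by (auto simp: algebraic_subgroup_def defined_over_def)
  then have "A ** matrix_inv A = mat 1 \<and> matrix_inv A ** A = mat 1"
    unfolding invertible_def matrix_inv_def by (rule someI_ex)
  then show "A ** matrix_inv A = mat 1" "matrix_inv A ** A = mat 1" by auto
qed

lemma gC_csubspace: "cvs.subspace (gC n F0)"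
  by (rule csubspace_lie_algebra[OF alg])

lemma gC_subspace: "subspace (gC n F0)"
  by (rule subspace_of_csubspace[OF gC_csubspace])

lemma gC_bracket: "X \<in> gC n F0 \<Longrightarrow> Y \<in> gC n F0 \<Longrightarrow> lie_bracket X Y \<in> gC n F0"
  by (rule lie_bracket_mem_lie_algebra[OF alg])

lemma gC_vconj: "X \<in> gC n F0 \<Longrightarrow> vconj X \<in> gC n F0"
  by (auto simp: lie_algebra_def mexp_vconj algebraic_subgroup_vconj[OF alg] simp flip: vconj_scaleR)

lemma GR_GC: "A \<in> GR n F0 \<Longrightarrow> A \<in> GC n F0"
  and GR_real: "A \<in> GR n F0 \<Longrightarrow> vconj A = A"
  using connected_component_subset[of "real_points (GC n F0)" "mat 1"]
  by (auto simp: GR_def real_points_def)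

lemma GR_iff: "A \<in> GR n F0 \<longleftrightarrow>
   (\<exists>C. connected C \<and> C \<subseteq> real_points (GC n F0) \<and> mat 1 \<in> C \<and> A \<in> C)"
  by (auto simp: GR_def connected_component_def)

lemma GR_translate:
  assumes g: "g \<in> real_points (GC n F0)" and C: "connected C" "C \<subseteq> real_points (GC n F0)"
  shows "connected ((\<lambda>X. g ** X) ` C)" "(\<lambda>X. g ** X) ` C \<subseteq> real_points (GC n F0)"
proof -
  have "continuous_on C (\<lambda>X. g ** X)"
    using linear_mat_mul_left by (intro linear_continuous_on) (simp add: linear_conv_bounded_linear)
  then show "connected ((\<lambda>X. g ** X) ` C)" using C(1) by (rule connected_continuous_image)
  show "(\<lambda>X. g ** X) ` C \<subseteq> real_points (GC n F0)"
    using g C(2) GC_mult by (auto simp: real_points_def vconj_mat_mul)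
qed

text \<open>A connected set joining \<open>1\<close> to \<open>g\<close> and the translate by \<open>g\<close> of one joining \<open>1\<close> to \<open>h\<close> have \<open>g\<close> in common.\<close>

lemma GR_mult:
  assumes "g \<in> GR n F0" "h \<in> GR n F0" shows "g ** h \<in> GR n F0"
proof -
  obtain C where C: "connected C" "C \<subseteq> real_points (GC n F0)" "mat 1 \<in> C" "g \<in> C"
    using assms(1) GR_iff by blast
  obtain D where D: "connected D" "D \<subseteq> real_points (GC n F0)" "mat 1 \<in> D" "h \<in> D"
    using assms(2) GR_iff by blast
  have g: "g \<in> real_points (GC n F0)" using C by blast
  have "g \<in> (\<lambda>X. g ** X) ` D" using D(3) by force
  then have "connected (C \<union> (\<lambda>X. g ** X) ` D)"
    using C GR_translate(1)[OF g D(1,2)] by (intro connected_Un) auto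
  then show ?thesis
    using C D GR_translate(2)[OF g D(1,2)] unfolding GR_iff
    by (intro exI[of _ "C \<union> (\<lambda>X. g ** X) ` D"]) auto
qed

lemma GR_inv:
  assumes "g \<in> GR n F0" shows "matrix_inv g \<in> GR n F0"
proof -
  obtain C where C: "connected C" "C \<subseteq> real_points (GC n F0)" "mat 1 \<in> C" "g \<in> C"
    using assms(1) GR_iff by blast
  have gi: "g ** matrix_inv g = mat 1" "matrix_inv g ** g = mat 1" 
    using assms GC_inverse GR_GC by blast+
  have "g ** vconj (matrix_inv g) = mat 1"
    using arg_cong[OF gi(1), of vconj] GR_real[OF assms] by (simp add: vconj_mat_mul vconj_mat_1)
  then have "vconj (matrix_inv g) = matrix_inv g"
    using matrix_inv_eqI by metis
  then have g: "matrix_inv g \<in> real_points (GC n F0)" 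
    using GC_inv assms GR_GC by (auto simp: real_points_def)
  show ?thesis
    unfolding GR_iff
    by (rule exI[of _ "(\<lambda>X. matrix_inv g ** X) ` C"]) (use GR_translate[OF g C(1,2)] C(3,4) gi in force)
qed

lemma continuous_mexp: "continuous_on UNIV (\<lambda>t::real. mexp (t *\<^sub>R X))"
proof -
  have "continuous_on UNIV (\<lambda>z. mexp (z *\<^sub>C X) $ i $ j)" for i j
    by (rule DERIV_continuous_on[OF has_field_derivative_at_within[OF mexp_entry_has_derivative]])
  then have "continuous_on UNIV (\<lambda>t. mexp (complex_of_real t *\<^sub>C X) $ i $ j)" for i j
    by (rule continuous_on_compose2[of UNIV]) (auto intro: continuous_intros)
  then have "continuous_on UNIV (\<lambda>t. \<chi> i j. mexp (complex_of_real t *\<^sub>C X) $ i $ j)"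
    by (intro continuous_on_vec_lambda)
  then show ?thesis by (simp add: scaleR_eq_scaleC)
qed

text \<open>The one-parameter group of a real element of \<open>\<gg>\<close> is a connected set of real points containing \<open>1\<close>, so it lies in the
  identity component \<open>GR\<close>.\<close>

lemma gR_iff: "X \<in> gR n F0 \<longleftrightarrow> X \<in> gC n F0 \<and> vconj X = X"
proof
  assume X: "X \<in> gR n F0"
  have "X \<in> gC n F0" using X GR_GC by (auto simp: lie_algebra_def)
  moreover have "vconj X - X \<in> {0}"
    by (rule mexp_difference_quotient_mem[where f="\<lambda>X. vconj X - X"])
       (use X GR_real in \<open>auto simp: lie_algebra_def vconj_mat_1 subspace_0 intro!: linear_compose_sub linear_vconj linear_ident\<close>)
  ultimately show "X \<in> gC n F0 \<and> vconj X = X" by simp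
next
  assume X: "X \<in> gC n F0 \<and> vconj X = X"
  have "mexp (t *\<^sub>R X) \<in> GR n F0" for t
    unfolding GR_iff
  proof (intro exI conjI)
    show "connected ((\<lambda>t. mexp (t *\<^sub>R X)) ` UNIV)"
      by (intro connected_continuous_image continuous_mexp connected_UNIV)
    show "(\<lambda>t. mexp (t *\<^sub>R X)) ` UNIV \<subseteq> real_points (GC n F0)"
      using X by (auto simp: real_points_def lie_algebra_def vconj_scaleR simp flip: mexp_vconj)
    show "mat 1 \<in> (\<lambda>t. mexp (t *\<^sub>R X)) ` UNIV"
      by (rule image_eqI[of _ _ 0]) auto
  qed auto
  then show "X \<in> gR n F0" by (simp add: lie_algebra_def)
qed

lemma gR_eq: "gR n F0 = real_points (gC n F0)"
  by (auto simp: gR_iff real_points_def)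

lemma act_mexp_fix:
  assumes x: "\<And>p. cvs.subspace (x p)"
  shows "(\<forall>t::real. act (mexp (t *\<^sub>R X)) x = x) \<longleftrightarrow> (\<forall>p. \<forall>v\<in>x p. X *v v \<in> x p)"
proof (intro iffI allI ballI)
  fix p v assume a: "\<forall>t::real. act (mexp (t *\<^sub>R X)) x = x" and v: "v \<in> x p"
  show "X *v v \<in> x p"
  proof (rule mexp_difference_quotient_mem[where f="\<lambda>X. X *v v"])
    show "linear (\<lambda>X. X *v v)" 
      by (rule linearI) (auto simp: matrix_vector_mult_add_rdistrib scaleR_eq_scaleC scaleC_mat_vec)
    show "subspace (x p)" by (rule subspace_of_csubspace[OF x])
    fix t :: real
    have "mexp (t *\<^sub>R X) *v v \<in> act (mexp (t *\<^sub>R X)) x p" using v by (auto simp: act_def)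
    then show "mexp (t *\<^sub>R X) *v v - mat 1 *v v \<in> x p"
      using a v x by (auto intro: cvs.subspace_diff)
  qed
next
  fix t :: real assume a: "\<forall>p. \<forall>v\<in>x p. X *v v \<in> x p" 
  have m: "mexp (s *\<^sub>R X) *v v \<in> x p" if "v \<in> x p" for v p s
    using that a x by (intro mexp_vec_mem) (auto simp: scaleR_eq_scaleC scaleC_mat_vec intro: cvs.subspace_scale)
  have "v \<in> (*v) (mexp (t *\<^sub>R X)) ` x p" if v: "v \<in> x p" for v p
  proof (rule image_eqI)
    have "mexp (t *\<^sub>R X) *v (mexp ((-t) *\<^sub>R X) *v v) = (mexp (t *\<^sub>R X) ** mexp ((-t) *\<^sub>R X)) *v v"
      by (simp add: matrix_vector_mul_assoc)
    then show "v = mexp (t *\<^sub>R X) *v (mexp ((-t) *\<^sub>R X) *v v)"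
      using mexp_inverse(1)[of t X] by (simp add: scaleR_eq_scaleC)
    show "mexp ((-t) *\<^sub>R X) *v v \<in> x p" using v by (rule m)
  qed
  then show "act (mexp (t *\<^sub>R X)) x = x"
    using m by (auto simp: act_def fun_eq_iff)
qed

lemma lie_stabC:
  assumes x: "\<And>p. cvs.subspace (x p)"
  shows "lie_algebra (stabC n F0 x) = isotropy n F0 x"
  using act_mexp_fix[of x, OF x] unfolding stabC_def isotropy_def lie_algebra_def by blast

lemma lie_stabR:
  assumes x: "\<And>p. cvs.subspace (x p)"
  shows "lie_algebra (stabR n F0 x) = real_points (isotropy n F0 x)"
proof -
  have "lie_algebra (stabR n F0 x) = {X \<in> gR n F0. \<forall>t::real. act (mexp (t *\<^sub>R X)) x = x}"
    unfolding stabR_def lie_algebra_def by blast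
  then show ?thesis
    using act_mexp_fix[of x, OF x] by (auto simp: gR_eq real_points_def isotropy_def)
qed

lemma isotropy_csubspace:
  assumes x: "\<And>p. cvs.subspace (x p)"
  shows "cvs.subspace (isotropy n F0 x)"
  unfolding cvs.subspace_def isotropy_def
  using gC_csubspace x
  by (auto simp: matrix_vector_mult_add_rdistrib scaleC_mat_vec cvs.subspace_0
     intro: cvs.subspace_add cvs.subspace_scale)

lemma csubspace_act: "cvs.subspace (x p) \<Longrightarrow> cvs.subspace (act g x p)"
  unfolding act_def cvs.subspace_def
  by (auto simp flip: matrix_vector_right_distrib mat_vec_scaleC intro!: image_eqI[of 0 _ 0])

lemma act_act: "act g (act h x) = act (g ** h) x"
  by (auto simp: act_def fun_eq_iff image_image matrix_vector_mul_assoc)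

lemma act_one [simp]: "act (mat 1) x = x"
  by (auto simp: act_def)

lemma adjoint_F_iff:
  "X \<in> adjoint_F n F0 x a \<longleftrightarrow> X \<in> gC n F0 \<and> (\<forall>p. \<forall>v\<in>x p. X *v v \<in> x (p + a))"
  by (auto simp: adjoint_F_def add.commute)

lemma isotropy_eq_adjoint_F: "isotropy n F0 x = adjoint_F n F0 x 0"
  by (auto simp: adjoint_F_iff isotropy_def)

lemma adjoint_F_act_sub:
  assumes g: "g \<in> GC n F0" and X: "X \<in> adjoint_F n F0 x a"
  shows "g ** X ** matrix_inv g \<in> adjoint_F n F0 (act g x) a"
proof -
  have "(g ** X ** matrix_inv g) *v (g *v v) = g *v (X *v v)" for v
    using GC_inverse[OF g] by (metis matrix_mul_assoc matrix_mul_rid matrix_vector_mul_assoc)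
  moreover have "g ** X ** matrix_inv g \<in> gC n F0"
    using X by (intro lie_algebra_Ad[OF alg g] GC_inverse g) (simp add: adjoint_F_iff)
  ultimately show ?thesis using X
    by (auto simp: adjoint_F_iff act_def)
qed

lemma adjoint_F_act:
  assumes g: "g \<in> GC n F0"
  shows "adjoint_F n F0 (act g x) a = (\<lambda>X. g ** X ** matrix_inv g) ` adjoint_F n F0 x a"
proof
  show "(\<lambda>X. g ** X ** matrix_inv g) ` adjoint_F n F0 x a \<subseteq> adjoint_F n F0 (act g x) a"
    using adjoint_F_act_sub[OF g] by blast
  show "adjoint_F n F0 (act g x) a \<subseteq> (\<lambda>X. g ** X ** matrix_inv g) ` adjoint_F n F0 x a"
  proof
    fix X assume X: "X \<in> adjoint_F n F0 (act g x) a"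
    have i: "matrix_inv (matrix_inv g) = g"
      using GC_inverse[OF g] by (intro matrix_inv_eqI)
    show "X \<in> (\<lambda>X. g ** X ** matrix_inv g) ` adjoint_F n F0 x a"
    proof (rule image_eqI)
      have "g ** (matrix_inv g ** X ** g) ** matrix_inv g = (g ** matrix_inv g) ** X ** (g ** matrix_inv g)"
        by (simp only: matrix_mul_assoc)
      then show "X = g ** (matrix_inv g ** X ** g) ** matrix_inv g"
        by (simp add: GC_inverse[OF g])
      show "matrix_inv g ** X ** g \<in> adjoint_F n F0 x a"
        using adjoint_F_act_sub[OF GC_inv[OF g] X] GC_inverse[OF g] by (simp add: act_act i)
    qed
  qed
qed

lemma isotropy_act:
  "g \<in> GC n F0 \<Longrightarrow> isotropy n F0 (act g x) = (\<lambda>X. g ** X ** matrix_inv g) ` isotropy n F0 x"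
  by (simp add: isotropy_eq_adjoint_F adjoint_F_act)

lemma csubspace_adjoint_F:
  assumes x: "\<And>p. cvs.subspace (x p)"
  shows "cvs.subspace (adjoint_F n F0 x a)"
  unfolding cvs.subspace_def Ball_def adjoint_F_iff
  using gC_csubspace x
  by (auto simp: matrix_vector_mult_add_rdistrib scaleC_mat_vec cvs.subspace_0
     intro: cvs.subspace_add cvs.subspace_scale)

lemma dim_Ad_image:
  assumes g: "g \<in> GC n F0"
  shows "dim ((\<lambda>X. g ** X ** matrix_inv g) ` S) = dim S"
proof (rule dim_image_eq)
  show "linear (\<lambda>X. g ** X ** matrix_inv g)"
    by (rule linearI) (auto simp: matrix_add_ldistrib matrix_add_rdistrib scaleR_eq_scaleC
        scaleC_mat_mul_right scaleC_mat_mul_left)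
  have "matrix_inv g ** (g ** X ** matrix_inv g) ** g = X" for X
  proof -
    have "matrix_inv g ** (g ** X ** matrix_inv g) ** g = (matrix_inv g ** g) ** X ** (matrix_inv g ** g)"
      by (simp only: matrix_mul_assoc)
    then show ?thesis by (simp add: GC_inverse[OF g])
  qed
  then show "inj_on (\<lambda>X. g ** X ** matrix_inv g) (span S)"
    by (rule inj_on_inverseI)
qed

lemma csubspace_compact_dual:
  assumes "\<And>p. cvs.subspace (F0 p)" "x \<in> compact_dual n F0"
  shows "cvs.subspace (x p)"
  using assms csubspace_act by (auto simp: compact_dual_def)

end

section \<open>Totally real orbits\<close>

lemma dim_complexify:
  fixes R :: "'a::{conj_space,euclidean_space} set"
  assumes R: "subspace R" and i: "\<And>x. x \<in> R \<Longrightarrow> \<i> *\<^sub>C x \<in> R \<Longrightarrow> x = 0"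
  shows "dim (complexify R) = 2 * dim R"
proof -
  let ?iR = "(\<lambda>x. \<i> *\<^sub>C x) ` R"
  have inj: "inj_on (\<lambda>x. \<i> *\<^sub>C (x::'a)) A" for A
    by (intro inj_onI) (simp add: cvs.scale_left_imp_eq)
  have e: "complexify R = {x + y | x y. x \<in> R \<and> y \<in> ?iR}"
    by (auto simp: complexify_def)
  have "R \<inter> ?iR = {0}" using i subspace_0[OF R] by (auto intro!: image_eqI[of 0 _ 0])
  moreover have "dim ?iR = dim R" by (rule dim_image_eq[OF linear_scaleC inj])
  moreover have "subspace ?iR" using R by (intro linear_subspace_image linear_scaleC)
  ultimately show ?thesis unfolding e using dim_sums_Int[OF R, of ?iR] by simp
qed

lemma csubspace_complexify:
  assumes "subspace A" shows "cvs.subspace (complexify A)"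
  unfolding cvs.subspace_def
proof (intro conjI ballI allI)
  show "0 \<in> complexify A" unfolding complexify_def using subspace_0[OF assms]
    by (intro CollectI exI[of _ 0]) simp
  fix x y assume "x \<in> complexify A" "y \<in> complexify A"
  then obtain u v u' v' where *: "x = u + \<i> *\<^sub>C v" "u \<in> A" "v \<in> A" "y = u' + \<i> *\<^sub>C v'" "u' \<in> A" "v' \<in> A"
    by (auto simp: complexify_def)
  have "x + y = (u + u') + \<i> *\<^sub>C (v + v')" by (simp add: * scaleC_add_right)
  moreover have "u + u' \<in> A" "v + v' \<in> A" using * by (auto intro: subspace_add[OF assms])
  ultimately show "x + y \<in> complexify A" unfolding complexify_def by blast
next
  fix c x assume "x \<in> complexify A"
  then obtain u v where *: "x = u + \<i> *\<^sub>C v" "u \<in> A" "v \<in> A" by (auto simp: complexify_def)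
  have c: "c = of_real (Re c) + \<i> * of_real (Im c)" by (simp add: complex_eq_iff)
  have "c *\<^sub>C x = (Re c *\<^sub>R u - Im c *\<^sub>R v) + \<i> *\<^sub>C (Im c *\<^sub>R u + Re c *\<^sub>R v)"
    by (subst c) (simp add: *(1) scaleC_add_right scaleC_add_left scaleC_scaleC scaleR_eq_scaleC algebra_simps)
  moreover have "Re c *\<^sub>R u - Im c *\<^sub>R v \<in> A" "Im c *\<^sub>R u + Re c *\<^sub>R v \<in> A"
    using * by (auto intro!: subspace_add[OF assms] subspace_diff[OF assms] subspace_scale[OF assms])
  ultimately show "c *\<^sub>C x \<in> complexify A" unfolding complexify_def by blast
qed

lemma conj_stable_eq_complexify:
  assumes U: "cvs.subspace U" "\<And>x. x \<in> U \<Longrightarrow> vconj x \<in> U"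
  shows "complexify (real_points U) = (U :: 'a::conj_space set)"
proof
  show "complexify (real_points U) \<subseteq> U"
    using U by (auto simp: complexify_def real_points_def intro: cvs.subspace_add cvs.subspace_scale)
  show "U \<subseteq> complexify (real_points U)"
  proof
    fix x assume x: "x \<in> U"
    let ?a = "(1/2) *\<^sub>C (x + vconj x)" and ?b = "(-\<i>/2) *\<^sub>C (x - vconj x)"
    have "x = ?a + \<i> *\<^sub>C ?b"
      by (simp add: scaleC_scaleC cvs.scale_right_diff_distrib scaleC_add_right flip: scaleC_add_left)
    moreover have "?a \<in> real_points U" "?b \<in> real_points U"
      using x U by (auto simp: real_points_def vconj_scaleC vconj_add vconj_diff vconj_vconj add.commute
         cvs.scale_right_diff_distrib cvs.scale_minus_left
         intro!: cvs.subspace_scale cvs.subspace_add cvs.subspace_diff)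
    ultimately show "x \<in> complexify (real_points U)" unfolding complexify_def by blast
  qed
qed

lemma subspace_real_points: "cvs.subspace U \<Longrightarrow> subspace (real_points (U :: 'a::conj_space set))"
  using subspace_of_csubspace[of U]
  by (auto simp: real_points_def subspace_def vconj_add vconj_scaleR)

lemma dim_complexify_real_points:
  fixes U :: "'a::{conj_space,euclidean_space} set"
  assumes U: "cvs.subspace U"
  shows "dim (complexify (real_points U)) = 2 * dim (real_points U)"
proof (rule dim_complexify[OF subspace_real_points[OF U]])
  fix x assume "x \<in> real_points U" "\<i> *\<^sub>C x \<in> real_points U"
  then have "vconj x = x" "vconj (\<i> *\<^sub>C x) = \<i> *\<^sub>C x" by (auto simp: real_points_def)
  then have "\<i> *\<^sub>C x = - (\<i> *\<^sub>C x)" by (simp add: vconj_scaleC)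
  then have "2 *\<^sub>R (\<i> *\<^sub>C x) = 0" by (simp only: scaleR_2 eq_neg_iff_add_eq_0)
  then show "x = 0" by simp
qed

text \<open>A complex basis spans over \<open>\<real>\<close> a real form \<open>R\<close> of \<open>U\<close>, that is \<open>U = R \<oplus> \<i> R\<close>.\<close>

lemma dim_csubspace:
  fixes U :: "'a::{conj_space,euclidean_space} set"
  assumes U: "cvs.subspace U"
  shows "dim U = 2 * cvs.dim U"
proof -
  obtain B where B: "B \<subseteq> U" "cvs.independent B" "U \<subseteq> cvs.span B" "card B = cvs.dim U"
    using cvs.basis_exists by blast
  have sp: "cvs.span B = U" using B U by (metis cvs.span_subspace)
  have comb: "a b = 0" if "finite t" "t \<subseteq> B" "(\<Sum>v\<in>t. a v *\<^sub>C v) = 0" "b \<in> t" for a t b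
    using B(2) that unfolding cvs.dependent_explicit by blast
  have ind: "independent B"
    unfolding dependent_explicit
  proof safe
    fix t u v assume t: "finite t" "t \<subseteq> B" "(\<Sum>v\<in>t. u v *\<^sub>R v) = 0" "v \<in> t" "u v \<noteq> 0"
    then have "complex_of_real (u v) = 0"
      by (intro comb[of t "\<lambda>v. complex_of_real (u v)"]) (auto simp: scaleR_eq_scaleC)
    then show False using t by simp
  qed
  have fin: "finite B" using ind independent_imp_finite by blast
  let ?R = "span B"
  have "complexify ?R = U"
  proof (rule set_eqI)
    fix x
    show "x \<in> complexify ?R \<longleftrightarrow> x \<in> U"
    proof
      assume "x \<in> complexify ?R"
      then obtain u v where x: "x = u + \<i> *\<^sub>C v" "u \<in> span B" "v \<in> span B"
        by (auto simp: complexify_def)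
      have "span B \<subseteq> U" using B(1) subspace_of_csubspace[OF U] by (rule span_minimal)
      then show "x \<in> U" using x U by (auto intro!: cvs.subspace_add cvs.subspace_scale)
    next
      assume "x \<in> U"
      then obtain c where x: "x = (\<Sum>v\<in>B. c v *\<^sub>C v)" using sp cvs.span_finite[OF fin] by blast
      also have "\<dots> = (\<Sum>v\<in>B. Re (c v) *\<^sub>R v) + \<i> *\<^sub>C (\<Sum>v\<in>B. Im (c v) *\<^sub>R v)"
        by (simp add: scaleR_eq_scaleC sum_scaleC scaleC_scaleC flip: scaleC_add_left sum.distrib complex_eq)
      finally show "x \<in> complexify ?R"
        unfolding complexify_def by (blast intro: span_sum span_scale span_base)
    qed
  qed
  moreover have "dim (complexify ?R) = 2 * dim ?R"
  proof (rule dim_complexify)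
    fix x assume "x \<in> span B" "\<i> *\<^sub>C x \<in> span B"
    then obtain a b where ab: "x = (\<Sum>v\<in>B. a v *\<^sub>R v)" "\<i> *\<^sub>C x = (\<Sum>v\<in>B. b v *\<^sub>R v)"
      using span_finite[OF fin] by auto
    then have "\<i> *\<^sub>C (\<Sum>v\<in>B. a v *\<^sub>R v) - (\<Sum>v\<in>B. b v *\<^sub>R v) = 0" by simp
    then have "(\<Sum>v\<in>B. (\<i> * a v - b v) *\<^sub>C v) = 0"
      by (simp add: scaleR_eq_scaleC sum_scaleC scaleC_scaleC cvs.scale_left_diff_distrib sum_subtractf)
    then have "\<i> * a v - b v = 0" if "v \<in> B" for v
      using comb[of B "\<lambda>v. \<i> * a v - b v"] fin that by blast
    then have "a v = 0" if "v \<in> B" for v using that by (auto simp: complex_eq_iff)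
    then show "x = 0" by (simp add: ab)
  qed simp
  ultimately show ?thesis using dim_eq_card_independent[OF ind] B(4) by simp
qed

lemma coset_eq_iff:
  assumes "subspace P"
  shows "(\<lambda>Y. X + Y) ` P = (\<lambda>Y. X' + Y) ` P \<longleftrightarrow> X - X' \<in> (P::'a::real_vector set)"
proof
  assume "(\<lambda>Y. X + Y) ` P = (\<lambda>Y. X' + Y) ` P"
  moreover have "X \<in> (\<lambda>Y. X + Y) ` P" using subspace_0[OF assms] by force
  ultimately obtain Y where "X = X' + Y" "Y \<in> P" by auto
  then show "X - X' \<in> P" by simp
next
  assume d: "X - X' \<in> P"
  show "(\<lambda>Y. X + Y) ` P = (\<lambda>Y. X' + Y) ` P"
  proof (intro subset_antisym image_subsetI)
    fix Y assume "Y \<in> P"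
    then show "X + Y \<in> (\<lambda>Y. X' + Y) ` P"
      using subspace_add[OF assms d] by (intro image_eqI[of _ _ "(X - X') + Y"]) auto
    show "X' + Y \<in> (\<lambda>Y. X + Y) ` P"
      using subspace_diff[OF assms \<open>Y \<in> P\<close> d] by (intro image_eqI[of _ _ "Y - (X - X')"]) auto
  qed
qed

context mt_group
begin

text \<open>A Cauchy--Riemann tangent vector is the coset of a real \<open>X\<close> with \<open>X - \<i> Y \<in> \<pp>\<close> for some real \<open>Y\<close>.  If \<open>\<pp>\<close> is
  conjugation stable, then \<open>X\<close>, the mean of \<open>X - \<i> Y\<close> and its conjugate, lies in \<open>\<pp>\<close> and the vector is zero.  Conversely,
  let \<open>Z = X + \<i> Y \<in> \<pp>\<close> with \<open>X\<close> and \<open>Y\<close> real; then the coset of \<open>X\<close> is such a vector, so \<open>X \<in> \<pp>\<close>, and the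
  conjugate of \<open>Z\<close> is \<open>2X - Z\<close>.\<close>

lemma cr_tangent_trivial_iff:
  assumes x: "\<And>p. cvs.subspace (x p)"
  shows "cr_tangent n F0 x = {tangent_vector n F0 x 0} \<longleftrightarrow> (\<forall>X\<in>isotropy n F0 x. vconj X \<in> isotropy n F0 x)"
proof -
  let ?P = "isotropy n F0 x"
  have P: "cvs.subspace ?P" by (rule isotropy_csubspace) (rule x)
  note rP = subspace_of_csubspace[OF P]
  have tv: "tangent_vector n F0 x X = (\<lambda>Y. X + Y) ` ?P" for X
    by (simp add: tangent_vector_def lie_stabC[of x, OF x])
  have iP: "(\<lambda>X. \<i> *\<^sub>C X) ` ?P = ?P"
  proof -
    have "X = \<i> *\<^sub>C ((- \<i>) *\<^sub>C X)" for X :: "complex^'n^'n" by (simp add: scaleC_scaleC del: cvs.scale_minus_left)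
    then show ?thesis using P by (blast intro: cvs.subspace_scale)
  qed
  have itv: "(\<lambda>X. \<i> *\<^sub>C X) ` tangent_vector n F0 x X = tangent_vector n F0 x (\<i> *\<^sub>C X)" for X
  proof -
    have "(\<lambda>X. \<i> *\<^sub>C X) ` tangent_vector n F0 x X = (\<lambda>Y. \<i> *\<^sub>C X + Y) ` (\<lambda>X. \<i> *\<^sub>C X) ` ?P"
      by (simp add: tv image_image scaleC_add_right)
    then show ?thesis by (simp only: iP tv)
  qed
  have eq: "tangent_vector n F0 x X = tangent_vector n F0 x Y \<longleftrightarrow> X - Y \<in> ?P" for X Y
    unfolding tv by (rule coset_eq_iff[OF rP])
  have PgC: "?P \<subseteq> gC n F0" by (auto simp: isotropy_def)
  have z: "0 \<in> gR n F0" by (simp add: gR_iff subspace_0[OF gC_subspace])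
  have cr: "cr_tangent n F0 x = {tangent_vector n F0 x X | X Y. X \<in> gR n F0 \<and> Y \<in> gR n F0 \<and> X - \<i> *\<^sub>C Y \<in> ?P}"
    unfolding cr_tangent_def orbit_tangent_def image_image itv using eq by blast
  show ?thesis
  proof
    assume a: "cr_tangent n F0 x = {tangent_vector n F0 x 0}"
    show "\<forall>X\<in>?P. vconj X \<in> ?P"
    proof
      fix Z assume Z: "Z \<in> ?P"
      then have "Z \<in> complexify (real_points (gC n F0))"
        using conj_stable_eq_complexify[OF gC_csubspace gC_vconj] PgC by auto
      then obtain X Y where XY: "Z = X + \<i> *\<^sub>C Y" "X \<in> gR n F0" "Y \<in> gR n F0"
        by (auto simp: complexify_def gR_eq)
      have "- Y \<in> gR n F0" using XY(3) by (auto simp: gR_iff vconj_minus intro: subspace_neg[OF gC_subspace])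
      then have "tangent_vector n F0 x X \<in> cr_tangent n F0 x"
        unfolding cr using XY Z by (intro CollectI exI[of _ X] exI[of _ "- Y"]) simp
      then have X: "X \<in> ?P" using a eq[of X 0] by simp
      have "vconj Z = X + X - Z" using XY by (simp add: vconj_add vconj_scaleC gR_iff)
      then show "vconj Z \<in> ?P" using subspace_diff[OF rP subspace_add[OF rP X X] Z] by simp
    qed
  next
    assume a: "\<forall>X\<in>?P. vconj X \<in> ?P"
    have "X \<in> ?P" if "X \<in> gR n F0" "Y \<in> gR n F0" "X - \<i> *\<^sub>C Y \<in> ?P" for X Y
    proof -
      have "vconj (X - \<i> *\<^sub>C Y) \<in> ?P" using a that(3) by blast
      then have "X + \<i> *\<^sub>C Y \<in> ?P" using that by (simp add: vconj_diff vconj_scaleC gR_iff)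
      then have "(1/2) *\<^sub>R ((X + \<i> *\<^sub>C Y) + (X - \<i> *\<^sub>C Y)) \<in> ?P"
        using subspace_scale[OF rP subspace_add[OF rP _ that(3)]] by blast
      also have "(1/2) *\<^sub>R ((X + \<i> *\<^sub>C Y) + (X - \<i> *\<^sub>C Y)) = X"
        by (simp add: scaleR_2 [symmetric] del: mult_2 mult_2_right)
      finally show ?thesis .
    qed
    then show "cr_tangent n F0 x = {tangent_vector n F0 x 0}"
      unfolding cr using z subspace_0[OF rP] eq[of _ 0]
      by (auto intro!: exI[of _ 0])
  qed
qed

text \<open>The isotropy algebras at \<open>x\<close> and at \<open>F0\<close> are conjugate, and the real dimension of \<open>\<gg>\<^sub>\<real>\<close> is the complex dimension of
  \<open>\<gg>\<close>.  So the dimensions agree if and only if \<open>2 dim (\<pp> \<inter> \<gg>\<^sub>\<real>) = dim \<pp>\<close>, where \<open>\<pp>\<close> is the isotropy algebra at \<open>x\<close>.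
  This means that the real points of \<open>\<pp>\<close> span it over \<open>\<complex>\<close>.\<close>

lemma orbit_dim_eq_iff:
  assumes F0: "\<And>p. cvs.subspace (F0 p)" and x: "x \<in> compact_dual n F0"
  shows "real_orbit_dim n F0 x = compact_dual_dim n F0 \<longleftrightarrow> (\<forall>X\<in>isotropy n F0 x. vconj X \<in> isotropy n F0 x)"
proof -
  let ?P = "isotropy n F0 x" and ?B = "isotropy n F0 F0"
  have xs: "cvs.subspace (x p)" for p by (rule csubspace_compact_dual[OF F0 x])
  have P: "cvs.subspace ?P" by (rule isotropy_csubspace) (rule xs)
  have P0: "cvs.subspace ?B" using isotropy_csubspace[of F0] F0 by blast
  obtain g where g: "g \<in> GC n F0" "x = act g F0" using x by (auto simp: compact_dual_def)
  have "dim ?P = dim ?B" using isotropy_act[OF g(1), of F0] dim_Ad_image[OF g(1)] g(2) by simp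
  then have c: "dim ?P = 2 * cvs.dim ?B" using dim_csubspace[OF P0] by simp
  have gg: "dim (gR n F0) = cvs.dim (gC n F0)"
    using dim_csubspace[OF gC_csubspace] dim_complexify_real_points[OF gC_csubspace]
      conj_stable_eq_complexify[OF gC_csubspace gC_vconj] by (simp add: gR_eq)
  have "?P \<subseteq> gC n F0" by (auto simp: isotropy_def)
  then have le0: "dim ?P \<le> dim (gC n F0)" by (rule dim_subset)
  have sub: "complexify (real_points ?P) \<subseteq> ?P"
    using P by (auto simp: complexify_def real_points_def intro: cvs.subspace_add cvs.subspace_scale)
  have sc: "subspace (complexify (real_points ?P))"
    by (intro subspace_of_csubspace csubspace_complexify subspace_real_points P)
  have d2: "dim (complexify (real_points ?P)) = 2 * dim (real_points ?P)"
    by (rule dim_complexify_real_points[OF P])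
  have le: "2 * dim (real_points ?P) \<le> dim ?P" using dim_subset[OF sub] d2 by simp
  have "real_orbit_dim n F0 x = compact_dual_dim n F0 \<longleftrightarrow> 2 * dim (real_points ?P) = dim ?P"
    unfolding real_orbit_dim_def compact_dual_dim_def lie_stabR[of x, OF xs] lie_stabC[of F0, OF F0]
    using le le0 c gg dim_csubspace[OF gC_csubspace] by linarith
  also have "\<dots> \<longleftrightarrow> complexify (real_points ?P) = ?P"
    using subspace_dim_equal[OF sc subspace_of_csubspace[OF P] sub] d2 by auto
  also have "\<dots> \<longleftrightarrow> (\<forall>X\<in>?P. vconj X \<in> ?P)"
  proof
    assume a: "complexify (real_points ?P) = ?P"
    show "\<forall>X\<in>?P. vconj X \<in> ?P"
    proof
      fix X assume "X \<in> ?P"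
      then obtain u v where uv: "X = u + \<i> *\<^sub>C v" "u \<in> real_points ?P" "v \<in> real_points ?P"
        using a unfolding complexify_def by blast
      then have "vconj X = u - \<i> *\<^sub>C v" by (simp add: vconj_add vconj_scaleC real_points_def)
      then show "vconj X \<in> ?P" using uv P
        by (auto simp: real_points_def intro!: cvs.subspace_diff cvs.subspace_scale)
    qed
  qed (use conj_stable_eq_complexify[OF P] in blast)
  finally show ?thesis .
qed

end

section \<open>Gradings and opposite filtrations\<close>

text \<open>If \<open>e\<close> is the family of projectors of a grading, \<open>up e p\<close> is the sum of its pieces of degree at least \<open>p\<close> and
  \<open>down e p\<close> the sum of its pieces of degree at most \<open>p\<close>.\<close>

definition up :: "(int \<Rightarrow> complex^'n^'n) \<Rightarrow> int \<Rightarrow> (complex^'n) set" where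
  "up e p = {v. \<forall>r<p. e r *v v = 0}"

definition down :: "(int \<Rightarrow> complex^'n^'n) \<Rightarrow> int \<Rightarrow> (complex^'n) set" where
  "down e p = {v. \<forall>r>p. e r *v v = 0}"

text \<open>The part of degree \<open>a\<close> of \<open>X\<close> for the grading that \<open>e\<close> induces on \<open>End(V)\<close>.\<close>

definition component ::
  "nat \<Rightarrow> (int \<Rightarrow> complex^'n^'n) \<Rightarrow> int \<Rightarrow> complex^'n^'n \<Rightarrow> complex^'n^'n" where
  "component n e a X = (\<Sum>p = 0..int n. e (p + a) ** X ** e p)"

text \<open>If elements of \<open>U\<close> can be split inside \<open>U\<close> at every degree, then \<open>U\<close> contains the truncations of its
  elements, and a component is the difference of two consecutive truncations.\<close>

lemma truncations_mem:
  fixes c :: "int \<Rightarrow> 'a \<Rightarrow> 'a::real_vector"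
  assumes U: "subspace U" and K: "finite K"
    and add: "\<And>b x y. c b (x + y) = c b x + c b y"
    and tot: "\<And>x. (\<Sum>b\<in>K. c b x) = x"
    and split: "\<And>a u. u \<in> U \<Longrightarrow> \<exists>f\<in>U. \<exists>s\<in>U. u = f + s \<and> (\<forall>b\<le>a. c b f = 0) \<and> (\<forall>b>a. c b s = 0)"
    and b: "b \<in> K" and u: "u \<in> U"
  shows "c b u \<in> U"
proof -
  have t: "(\<Sum>b\<in>{b\<in>K. b \<le> a}. c b u) \<in> U" for a
  proof -
    obtain f s where fs: "s \<in> U" "u = f + s" "\<forall>b\<le>a. c b f = 0" "\<forall>b>a. c b s = 0"
      using split[OF u, of a] by blast
    have "s = (\<Sum>b\<in>K. c b s)" by (simp add: tot)
    also have "\<dots> = (\<Sum>b\<in>{b\<in>K. b \<le> a}. c b s)"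
      using fs K by (intro sum.mono_neutral_right) (auto simp: not_le [symmetric])
    also have "\<dots> = (\<Sum>b\<in>{b\<in>K. b \<le> a}. c b u)"
      using fs by (intro sum.cong) (auto simp: add)
    finally show ?thesis using fs by simp
  qed
  have "{i\<in>K. i \<le> b} = insert b {i\<in>K. i \<le> b - 1}" using b by auto
  then have "(\<Sum>i\<in>{i\<in>K. i \<le> b}. c i u) = c b u + (\<Sum>i\<in>{i\<in>K. i \<le> b - 1}. c i u)"
    using K by simp
  then have "c b u = (\<Sum>i\<in>{i\<in>K. i \<le> b}. c i u) - (\<Sum>i\<in>{i\<in>K. i \<le> b - 1}. c i u)" by simp
  then show ?thesis using subspace_diff[OF U t[of b] t[of "b - 1"]] by simp
qed

text \<open>Subtracting \<open>k0\<close> from \<open>A\<close> removes the summand of eigenvalue \<open>k0\<close> and scales the others by nonzero factors.\<close>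

lemma eigen_summand_mem:
  fixes x :: "int \<Rightarrow> 'a::conj_space"
  assumes U: "cvs.subspace U"
    and A: "\<And>x y. A (x + y) = A x + A y" "\<And>c x. A (c *\<^sub>C x) = c *\<^sub>C A x" "\<And>u. u \<in> U \<Longrightarrow> A u \<in> U"
    and "finite K" "\<And>k. k \<in> K \<Longrightarrow> A (x k) = of_int k *\<^sub>C x k" "(\<Sum>k\<in>K. x k) \<in> U" "k \<in> K"
  shows "x k \<in> U"
  using assms(5-8)
proof (induction K arbitrary: x k rule: finite_induct)
  case (insert k0 K)
  have A0: "A 0 = 0" using A(2)[of 0 0] by simp
  have As: "A (sum x K) = (\<Sum>k\<in>K. A (x k))" for x K
    by (induction K rule: infinite_finite_induct) (auto simp: A0 A)
  let ?S = "x k0 + (\<Sum>k\<in>K. x k)"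
  have S: "?S \<in> U" using insert by simp
  have "A ?S - of_int k0 *\<^sub>C ?S = (\<Sum>k\<in>K. (of_int k - of_int k0) *\<^sub>C x k)"
    using insert.prems(1) by (simp add: As A(1) cvs.scale_left_diff_distrib sum_subtractf scaleC_add_right sum_scaleC)
  moreover have "A ?S - of_int k0 *\<^sub>C ?S \<in> U"
    using S U A(3) by (intro cvs.subspace_diff cvs.subspace_scale)
  ultimately have s: "(\<Sum>k\<in>K. (of_int k - of_int k0) *\<^sub>C x k) \<in> U" by simp
  have K: "x k \<in> U" if "k \<in> K" for k
  proof -
    have "(of_int k - of_int k0) *\<^sub>C x k \<in> U"
      by (rule insert.IH[of "\<lambda>k. (of_int k - of_int k0) *\<^sub>C x k"])
        (use insert.prems s that in \<open>auto simp: A(2) scaleC_scaleC mult.commute\<close>)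
    then have "(1 / (of_int k - of_int k0)) *\<^sub>C ((of_int k - of_int k0) *\<^sub>C x k) \<in> U"
      by (rule cvs.subspace_scale[OF U])
    moreover have "k \<noteq> k0" using that insert by blast
    ultimately show ?thesis by (simp add: scaleC_scaleC)
  qed
  have "x k0 = ?S - (\<Sum>k\<in>K. x k)" by simp
  also have "\<dots> \<in> U" using S K U by (intro cvs.subspace_diff cvs.subspace_sum)
  finally show ?case using K insert.prems by auto
qed simp

text \<open>A grading of \<open>V\<close> in degrees \<open>0..n\<close>, given by its projectors.  Projectors outside this range are
  zero, so that shifts of degree need no side conditions.\<close>

locale grading =
  fixes n :: nat and e :: "int \<Rightarrow> complex^'n^'n"
  assumes support: "i < 0 \<or> i > int n \<Longrightarrow> e i = 0"
    and orth: "e i ** e j = (if i = j then e i else 0)"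
    and total: "(\<Sum>i = 0..int n. e i) = mat 1"
begin

lemma e_e_vec: "e i *v (e j *v v) = (if i = j then e i *v v else 0)"
  by (simp add: matrix_vector_mul_assoc orth)

lemma decomp: "(\<Sum>i = 0..int n. e i *v v) = v"
  using arg_cong[OF total, of "\<lambda>A. A *v v"] by (simp add: mat_vec_sum_left)

lemma vec_eqI:
  assumes "\<And>i. e i *v v = e i *v w" shows "v = w"
proof -
  have "(\<Sum>i = 0..int n. e i *v v) = (\<Sum>i = 0..int n. e i *v w)"
    by (intro sum.cong assms refl)
  then show ?thesis by (simp only: decomp)
qed

lemma vec_eq_0I: "(\<And>i. e i *v v = 0) \<Longrightarrow> v = 0"
  by (rule vec_eqI) simp

lemma block_eqI:
  assumes "\<And>q p. e q ** X ** e p = e q ** Y ** e p"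
  shows "X = Y"
proof (rule mat_eqI)
  fix v
  have "e q *v (X *v (e p *v v)) = e q *v (Y *v (e p *v v))" for q p
    using arg_cong[OF assms[of q p], of "\<lambda>A. A *v v"] by (simp add: matrix_vector_mul_assoc matrix_mul_assoc)
  then have "X *v (e p *v v) = Y *v (e p *v v)" for p by (rule vec_eqI)
  then have "(\<Sum>p = 0..int n. X *v (e p *v v)) = (\<Sum>p = 0..int n. Y *v (e p *v v))" by simp
  then show "X *v v = Y *v v" by (simp add: decomp flip: mat_vec_sum_right)
qed

lemma component_block:
  "e q ** component n e a X ** e p = (if q = p + a then e q ** X ** e p else 0)"
proof -
  have "e q ** component n e a X ** e p = (\<Sum>r = 0..int n. (e q ** e (r + a)) ** X ** (e r ** e p))"
    by (simp add: component_def mat_mul_sum_left mat_mul_sum_right matrix_mul_assoc)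
  also have "\<dots> = (\<Sum>r = 0..int n. if r = p then (if q = p + a then e q ** X ** e p else 0) else 0)"
    by (intro sum.cong) (auto simp: orth)
  also have "\<dots> = (if q = p + a then e q ** X ** e p else 0)"
    using support[of p] by (auto simp: sum.delta)
  finally show ?thesis .
qed

lemma component_add: "component n e a (X + Y) = component n e a X + component n e a Y"
  by (simp add: component_def matrix_add_ldistrib matrix_add_rdistrib sum.distrib)

lemma component_scale: "component n e a (c *\<^sub>C X) = c *\<^sub>C component n e a X"
  by (simp add: component_def scaleC_mat_mul_left scaleC_mat_mul_right sum_scaleC)

lemma component_diff: "component n e a (X - Y) = component n e a X - component n e a Y"
  by (simp add: component_def mat_mul_diff sum_subtractf)

lemma component_sum: "(\<Sum>a = - int n..int n. component n e a X) = X"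
proof (rule block_eqI)
  fix q p
  have "e q ** (\<Sum>a = - int n..int n. component n e a X) ** e p
     = (\<Sum>a = - int n..int n. if a = q - p then e q ** X ** e p else 0)"
    unfolding mat_mul_sum_right mat_mul_sum_left component_block by (intro sum.cong) auto
  also have "\<dots> = e q ** X ** e p"
  proof (cases "q - p \<in> {- int n..int n}")
    case False
    then have "p < 0 \<or> p > int n \<or> q < 0 \<or> q > int n" by auto
    then have "e q = 0 \<or> e p = 0" using support[of p] support[of q] by blast
    then show ?thesis by auto
  qed (simp add: sum.delta)
  finally show "e q ** (\<Sum>a = - int n..int n. component n e a X) ** e p = e q ** X ** e p" .
qed

lemma component_eq_0I:
  assumes "\<And>p. e (p + a) ** X ** e p = 0"
  shows "component n e a X = 0"
  using assms by (simp add: component_def)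

lemma component_out_of_range:
  assumes "a \<notin> {- int n..int n}" shows "component n e a X = 0"
proof (rule component_eq_0I)
  fix p
  have "p < 0 \<or> p > int n \<or> p + a < 0 \<or> p + a > int n" using assms by auto
  then have "e (p + a) = 0 \<or> e p = 0" using support[of p] support[of "p + a"] by blast
  then show "e (p + a) ** X ** e p = 0" by auto
qed

lemma component_component: "component n e a (component n e b X) = (if a = b then component n e a X else 0)"
  by (rule block_eqI) (auto simp: component_block)

lemma e_mem_up: "e p *v v \<in> up e p" and e_mem_down: "e p *v v \<in> down e p"
  by (auto simp: up_def down_def e_e_vec)

lemma csubspace_up: "cvs.subspace (up e p)" and csubspace_down: "cvs.subspace (down e p)"
  by (auto simp: up_def down_def cvs.subspace_def matrix_vector_right_distrib mat_vec_scaleC)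

lemma apply_block_sum: "e q *v (X *v v) = (\<Sum>p = 0..int n. (e q ** X ** e p) *v v)"
proof -
  have "e q *v (X *v v) = (e q ** X) *v (\<Sum>p = 0..int n. e p *v v)"
    by (simp add: decomp matrix_vector_mul_assoc)
  then show ?thesis by (simp add: mat_vec_sum_right matrix_vector_mul_assoc)
qed

lemma raises_up_iff:
  "(\<forall>p. \<forall>v\<in>up e p. X *v v \<in> up e (p + a)) \<longleftrightarrow> (\<forall>p q. q < p + a \<longrightarrow> e q ** X ** e p = 0)"
proof (intro iffI allI ballI impI)
  fix p q assume a: "\<forall>p. \<forall>v\<in>up e p. X *v v \<in> up e (p + a)" and q: "q < p + a"
  show "e q ** X ** e p = 0"
  proof (rule mat_eqI)
    fix v
    have "X *v (e p *v v) \<in> up e (p + a)" using a e_mem_up by blast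
    then show "(e q ** X ** e p) *v v = 0 *v v"
      using q by (simp add: up_def matrix_vector_mul_assoc matrix_mul_assoc)
  qed
next
  fix p v assume a: "\<forall>p q. q < p + a \<longrightarrow> e q ** X ** e p = 0" and v: "v \<in> up e p"
  show "X *v v \<in> up e (p + a)"
    unfolding up_def
  proof (intro CollectI allI impI)
    fix q assume q: "q < p + a"
    have "(e q ** X ** e r) *v v = 0" for r
    proof (cases "r < p")
      case True
      then have "e r *v v = 0" using v by (simp add: up_def)
      then show ?thesis by (simp flip: matrix_vector_mul_assoc)
    next
      case False
      then have "e q ** X ** e r = 0" using a q by simp
      then show ?thesis by simp
    qed
    then show "e q *v (X *v v) = 0" by (simp add: apply_block_sum)
  qed
qed

lemma raises_down_iff:
  "(\<forall>p. \<forall>v\<in>down e p. X *v v \<in> down e (p + a)) \<longleftrightarrow> (\<forall>p q. q > p + a \<longrightarrow> e q ** X ** e p = 0)"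
proof (intro iffI allI ballI impI)
  fix p q assume a: "\<forall>p. \<forall>v\<in>down e p. X *v v \<in> down e (p + a)" and q: "q > p + a"
  show "e q ** X ** e p = 0"
  proof (rule mat_eqI)
    fix v
    have "X *v (e p *v v) \<in> down e (p + a)" using a e_mem_down by blast
    then show "(e q ** X ** e p) *v v = 0 *v v"
      using q by (simp add: down_def matrix_vector_mul_assoc matrix_mul_assoc)
  qed
next
  fix p v assume a: "\<forall>p q. q > p + a \<longrightarrow> e q ** X ** e p = 0" and v: "v \<in> down e p"
  show "X *v v \<in> down e (p + a)"
    unfolding down_def
  proof (intro CollectI allI impI)
    fix q assume q: "q > p + a"
    have "(e q ** X ** e r) *v v = 0" for r
    proof (cases "r > p")
      case True
      then have "e r *v v = 0" using v by (simp add: down_def)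
      then show ?thesis by (simp flip: matrix_vector_mul_assoc)
    next
      case False
      then have "e q ** X ** e r = 0" using a q by simp
      then show ?thesis by simp
    qed
    then show "e q *v (X *v v) = 0" by (simp add: apply_block_sum)
  qed
qed

definition degree_op :: "complex^'n^'n" where
  "degree_op = (\<Sum>p = 0..int n. of_int p *\<^sub>C e p)"

lemma degree_op_e: "degree_op ** e p = of_int p *\<^sub>C e p" "e p ** degree_op = of_int p *\<^sub>C e p"
proof -
  have "(\<Sum>r = 0..int n. of_int r *\<^sub>C (if r = p then e r else 0)) = (of_int p *\<^sub>C e p :: complex^'n^'n)"
  proof -
    have "(\<Sum>r = 0..int n. of_int r *\<^sub>C (if r = p then e r else 0)) = 
       (\<Sum>r = 0..int n. if r = p then of_int p *\<^sub>C e p else 0)"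
      by (intro sum.cong) auto
    then show ?thesis using support[of p] by (auto simp: sum.delta)
  qed
  moreover have "e p ** e r = e r ** e p" for r by (simp add: orth)
  ultimately show "degree_op ** e p = of_int p *\<^sub>C e p" "e p ** degree_op = of_int p *\<^sub>C e p"
    by (simp_all add: degree_op_def mat_mul_sum_left mat_mul_sum_right scaleC_mat_mul_left scaleC_mat_mul_right orth)
qed

lemma degree_op_e_vec: "degree_op *v (e p *v v) = of_int p *\<^sub>C (e p *v v)"
  by (simp add: matrix_vector_mul_assoc degree_op_e scaleC_mat_vec)

lemma degree_op_component:
  "degree_op ** component n e a X - component n e a X ** degree_op = of_int a *\<^sub>C component n e a X"
proof (rule block_eqI)
  fix q p
  have "e q ** (degree_op ** component n e a X - component n e a X ** degree_op) ** e p
      = (e q ** degree_op) ** component n e a X ** e p - e q ** component n e a X ** (degree_op ** e p)"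
    by (simp add: mat_mul_diff matrix_mul_assoc)
  also have "\<dots> = (of_int q - of_int p) *\<^sub>C (e q ** component n e a X ** e p)"
    by (simp add: degree_op_e scaleC_mat_mul_left scaleC_mat_mul_right cvs.scale_left_diff_distrib)
  also have "\<dots> = e q ** (of_int a *\<^sub>C component n e a X) ** e p"
    by (auto simp: component_block scaleC_mat_mul_left scaleC_mat_mul_right)
  finally show "e q ** (degree_op ** component n e a X - component n e a X ** degree_op) ** e p =
     e q ** (of_int a *\<^sub>C component n e a X) ** e p" .
qed

text \<open>The components are the eigenvectors of the bracket with the degree operator.\<close>

lemma component_mem_of_ad_stable:
  assumes U: "cvs.subspace U" and ad: "\<And>X. X \<in> U \<Longrightarrow> degree_op ** X - X ** degree_op \<in> U" and X: "X \<in> U"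
  shows "component n e a X \<in> U"
proof (cases "a \<in> {- int n..int n}")
  case True
  show ?thesis
    by (rule eigen_summand_mem[OF U, where A="\<lambda>X. degree_op ** X - X ** degree_op" and K="{- int n..int n}"
        and x="\<lambda>a. component n e a X"])
      (use True X ad in \<open>auto simp: component_sum degree_op_component matrix_add_ldistrib
         matrix_add_rdistrib scaleC_mat_mul_left scaleC_mat_mul_right cvs.scale_right_diff_distrib\<close>)
next
  case False
  then show ?thesis using component_out_of_range U by (simp add: cvs.subspace_0)
qed

end

text \<open>The projections \<open>P p\<close> onto \<open>Psi p\<close> along \<open>F (p + 1)\<close> satisfy \<open>P p P q = P (min p q)\<close>; the projectors of the
  grading are their differences.\<close>

lemma grading_of_opposite_filtrations:
  fixes F Psi :: "int \<Rightarrow> (complex^'n) set"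
  assumes Fs: "\<And>p. cvs.subspace (F p)" and Ps: "\<And>p. cvs.subspace (Psi p)"
    and Fm: "\<And>p q. p \<le> q \<Longrightarrow> F q \<subseteq> F p" and Pm: "\<And>p q. p \<le> q \<Longrightarrow> Psi p \<subseteq> Psi q"
    and F0: "\<And>p. p \<le> 0 \<Longrightarrow> F p = UNIV" and Fn: "\<And>p. p > int n \<Longrightarrow> F p = {0}"
    and int: "\<And>p v. v \<in> F (p + 1) \<Longrightarrow> v \<in> Psi p \<Longrightarrow> v = 0"
    and sum: "\<And>p v. \<exists>s\<in>Psi p. v - s \<in> F (p + 1)"
  obtains e where "grading n e" "\<And>p. F p = up e p" "\<And>p. Psi p = down e p"
proof -
  have "\<exists>P::complex^'n^'n. \<forall>v. P *v v \<in> Psi p \<and> v - P *v v \<in> F (p + 1)" for p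
  proof -
    obtain s where s: "\<And>v. s v \<in> Psi p" "\<And>v. v - s v \<in> F (p + 1)"
      using sum[of p] by metis
    have u: "t = s v" if "t \<in> Psi p" "v - t \<in> F (p + 1)" for t v
    proof -
      have "(v - s v) - (v - t) \<in> F (p + 1)" "t - s v \<in> Psi p"
        using that s Fs Ps by (blast intro: cvs.subspace_diff)+
      then have "t - s v = 0" by (intro int[of _ p]) simp_all
      then show ?thesis by simp
    qed
    have s_add: "s (x + y) = s x + s y" for x y
    proof (rule u[symmetric])
      show "s x + s y \<in> Psi p" using s Ps by (blast intro: cvs.subspace_add)
      have "(x - s x) + (y - s y) \<in> F (p + 1)" using s Fs by (blast intro: cvs.subspace_add)
      then show "x + y - (s x + s y) \<in> F (p + 1)" by (simp add: algebra_simps)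
    qed
    have s_scale: "s (c *\<^sub>C x) = c *\<^sub>C s x" for c x
    proof (rule u[symmetric])
      show "c *\<^sub>C s x \<in> Psi p" using s Ps by (blast intro: cvs.subspace_scale)
      have "c *\<^sub>C (x - s x) \<in> F (p + 1)" using s Fs by (blast intro: cvs.subspace_scale)
      then show "c *\<^sub>C x - c *\<^sub>C s x \<in> F (p + 1)" by (simp add: cvs.scale_right_diff_distrib)
    qed
    have cs: "c *s x = c *\<^sub>C x" for c and x :: "complex^'n" by (simp add: vec_eq_iff)
    have "Vector_Spaces.linear (*s) (*s) s"
      unfolding Vector_Spaces.linear_iff using vec.vector_space_axioms
      by (auto simp: s_add s_scale cs)
    then have "matrix s *v v = s v" for v by (rule matrix_works)
    then show ?thesis using s by (intro exI[of _ "matrix s"]) simp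
  qed
  then obtain P :: "int \<Rightarrow> complex^'n^'n" 
    where P: "\<And>p v. P p *v v \<in> Psi p" "\<And>p v. v - P p *v v \<in> F (p + 1)" by metis
  have Pid: "P p *v v = v" if "v \<in> Psi p" for p v
  proof -
    have "v - P p *v v \<in> Psi p" using that P Ps by (blast intro: cvs.subspace_diff)
    then have "v - P p *v v = 0" using P(2) int by blast
    then show ?thesis by simp
  qed
  have Pz: "P p *v v = 0" if "v \<in> F (p + 1)" for p v
  proof -
    have "v - (v - P p *v v) \<in> F (p + 1)" using that P Fs by (blast intro: cvs.subspace_diff)
    then show ?thesis using P(1) int[of "P p *v v" p] by simp
  qed
  have PP1: "P q ** P p = P p" if "p \<le> q" for p q
  proof (rule mat_eqI)
    fix v
    have "P p *v v \<in> Psi q" using Pm[OF that] P(1) by blast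
    from Pid[OF this] show "(P q ** P p) *v v = P p *v v" by (simp flip: matrix_vector_mul_assoc)
  qed
  have PP2: "P p ** P q = P p" if "p \<le> q" for p q
  proof (rule mat_eqI)
    fix v
    have "v - P q *v v \<in> F (p + 1)" using P(2)[of v q] Fm[of "p + 1" "q + 1"] that by auto
    then have "P p *v (v - P q *v v) = 0" by (rule Pz)
    then show "(P p ** P q) *v v = P p *v v" by (simp add: mat_vec_diff flip: matrix_vector_mul_assoc)
  qed
  have PP: "P p ** P q = P (min p q)" for p q
    using PP1[of q p] PP2[of p q] by (cases "p \<le> q") (auto simp: min_def)
  have Pneg: "P p = 0" if "p < 0" for p
    using Pz[of _ p] F0[of "p + 1"] that by (intro mat_eqI) auto
  have Ppos: "P p = mat 1" if "p \<ge> int n" for p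
    using P(2)[of _ p] Fn[of "p + 1"] that by (intro mat_eqI) auto
  define e where "e = (\<lambda>p. P p - P (p - 1))"
  have g: "grading n e"
  proof
    fix i j :: int
    show "i < 0 \<or> i > int n \<Longrightarrow> e i = 0" by (auto simp: e_def Pneg Ppos)
    show "e i ** e j = (if i = j then e i else 0)"
      by (auto simp: e_def mat_mul_diff PP min_def)
    have "(\<Sum>i = 0..int m. e i) = P (int m) - P (- 1)" for m
    proof (induction m)
      case (Suc m)
      have "{0..int (Suc m)} = insert (int (Suc m)) {0..int m}" by auto
      then show ?case using Suc by (simp add: e_def)
    qed (simp add: e_def)
    then show "(\<Sum>i = 0..int n. e i) = mat 1" by (simp add: Pneg Ppos)
  qed
  moreover have "F p = up e p" for p
  proof (intro set_eqI iffI)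
    fix v assume v: "v \<in> F p"
    have "P r *v v = 0" if "r < p" for r
      using v Fm[of "r + 1" p] that by (intro Pz) auto
    then show "v \<in> up e p" by (simp add: up_def e_def mat_vec_diff)
  next
    fix v assume v: "v \<in> up e p"
    have st: "P r *v v = P (r - 1) *v v" if "r < p" for r
    proof -
      have "e r *v v = 0" using v that by (simp add: up_def)
      then show ?thesis by (simp add: e_def mat_vec_diff)
    qed
    have z: "int m - 1 < p \<Longrightarrow> P (int m - 1) *v v = 0" for m
    proof (induction m)
      case (Suc m)
      then show ?case using st[of "int m"] by simp
    qed (simp add: Pneg)
    have "P (p - 1) *v v = 0"
    proof (cases "p - 1 < 0")
      case False
      then show ?thesis using z[of "nat p"] by simp
    qed (simp add: Pneg)
    then show "v \<in> F p" using P(2)[of v "p - 1"] by simp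
  qed
  moreover have "Psi p = down e p" for p
  proof (intro set_eqI iffI)
    fix v assume v: "v \<in> Psi p"
    have "P r *v v = v" if "r \<ge> p" for r
      using v Pm[of p r] that by (intro Pid) auto
    then show "v \<in> down e p" by (simp add: down_def e_def mat_vec_diff)
  next
    fix v assume v: "v \<in> down e p"
    have st: "P (r - 1) *v v = P r *v v" if "r > p" for r
    proof -
      have "e r *v v = 0" using v that by (simp add: down_def)
      then show ?thesis by (simp add: e_def mat_vec_diff)
    qed
    have z: "int n - int m \<ge> p \<Longrightarrow> P (int n - int m) *v v = v" for m
    proof (induction m)
      case (Suc m)
      then show ?case using st[of "int n - int m"] by (simp add: algebra_simps)
    qed (simp add: Ppos)
    have "P p *v v = v"
    proof (cases "p \<ge> int n")
      case False
      then show ?thesis using z[of "nat (int n - p)"] by simp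
    qed (simp add: Ppos)
    then show "v \<in> Psi p" using P(1)[of p v] by simp
  qed
  ultimately show ?thesis by (rule that)
qed

section \<open>Bigradings and primitive strings\<close>

locale bigrading = E: grading n e + S: grading n s for n and e s :: "int \<Rightarrow> complex^'n^'n" +
  assumes comm: "e p ** s q = s q ** e p"
begin

definition J :: "int \<Rightarrow> int \<Rightarrow> (complex^'n) set" where
  "J p q = {v. e p *v v = v \<and> s q *v v = v}"

lemma comm_vec: "e p *v (s q *v v) = s q *v (e p *v v)"
  by (simp add: matrix_vector_mul_assoc comm)

lemma es_mem_J: "e p *v (s q *v v) \<in> J p q"
  unfolding J_def mem_Collect_eq by (simp add: E.e_e_vec) (simp add: comm_vec S.e_e_vec)

lemma J_eval: "v \<in> J p q \<Longrightarrow> e p' *v (s q' *v v) = (if p' = p \<and> q' = q then v else 0)"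
  unfolding J_def mem_Collect_eq by (metis E.e_e_vec S.e_e_vec comm_vec matrix_vector_mult_0_right)

lemma J_e: "v \<in> J p q \<Longrightarrow> e r *v v = (if r = p then v else 0)"
  and J_s: "v \<in> J p q \<Longrightarrow> s r *v v = (if r = q then v else 0)"
  unfolding J_def mem_Collect_eq by (metis E.e_e_vec S.e_e_vec)+

lemma csubspace_J: "cvs.subspace (J p q)"
  by (auto simp: J_def cvs.subspace_def matrix_vector_right_distrib mat_vec_scaleC)

lemma J_out: "p < 0 \<or> p > int n \<or> q < 0 \<or> q > int n \<Longrightarrow> v \<in> J p q \<Longrightarrow> v = 0"
  using E.support[of p] S.support[of q] unfolding J_def by (metis (mono_tags) matrix_vector_mult_0 mem_Collect_eq)

lemma bi_decomp: "(\<Sum>p = 0..int n. \<Sum>q = 0..int n. e p *v (s q *v v)) = v"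
  by (simp add: S.decomp E.decomp flip: mat_vec_sum_right)

lemma mem_of_J_mem:
  assumes U: "cvs.subspace U" and "\<And>p q. e p *v (s q *v v) \<in> U"
  shows "v \<in> U"
  by (subst bi_decomp[symmetric]) (intro cvs.subspace_sum[OF U] assms(2))

end

locale lefschetz = bigrading n e s for n and e s :: "int \<Rightarrow> complex^'n^'n" +
  fixes N :: "complex^'n^'n"
  assumes N_e: "N ** e p = e (p - 1) ** N" and N_s: "N ** s q = s (q - 1) ** N"
    and surj: "u \<in> J p q \<Longrightarrow> p + q = int n - int l \<Longrightarrow> \<exists>v\<in>J (p + int l) (q + int l). mpow N l *v v = u"
begin

lemma N_e_vec: "e p *v (N *v v) = N *v (e (p + 1) *v v)" and N_s_vec: "s p *v (N *v v) = N *v (s (p + 1) *v v)"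
  using N_e[of "p + 1"] N_s[of "p + 1"] by (simp_all add: matrix_vector_mul_assoc)

lemma Npow_e_vec: "e p *v (mpow N k *v v) = mpow N k *v (e (p + int k) *v v)"
  and Npow_s_vec: "s p *v (mpow N k *v v) = mpow N k *v (s (p + int k) *v v)"
  by (induction k arbitrary: p)
     (simp_all add: mpow_Suc N_e_vec N_s_vec algebra_simps flip: matrix_vector_mul_assoc)

lemma Npow_J: "v \<in> J p q \<Longrightarrow> mpow N k *v v \<in> J (p - int k) (q - int k)"
  by (simp add: J_def Npow_e_vec Npow_s_vec)

lemma N_J: "v \<in> J p q \<Longrightarrow> N *v v \<in> J (p - 1) (q - 1)"
  using Npow_J[of v p q 1] by (simp add: mpow_Suc)

definition primitive :: "int \<Rightarrow> int \<Rightarrow> (complex^'n) set" where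
  "primitive p q = {v \<in> J p q. p + q \<ge> int n \<and> mpow N (nat (p + q - int n) + 1) *v v = 0}"

text \<open>Every piece of the bigrading is spanned by strings \<open>N\<^sup>j v\<close> with \<open>v\<close> primitive and \<open>N\<^sup>j\<close> not yet
  past the end of the string.  Let \<open>u\<close> be of weight \<open>n + l\<close>.  By surjectivity \<open>N\<^bsup>l+1\<^esup> u = N\<^bsup>l+2\<^esup> u'\<close>
  with \<open>u'\<close> of weight \<open>n + l + 2\<close>, so that \<open>u - N u'\<close> is primitive, and \<open>u'\<close> is treated by induction, its weight being larger.\<close>

lemma J_le_of_primitive_strings:
  assumes U: "cvs.subspace U"
    and prim: "\<And>v j. v \<in> primitive (p + int j) (q + int j) \<Longrightarrow> j \<le> nat (p + q + 2 * int j - int n) \<Longrightarrow> mpow N j *v v \<in> U"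
  shows "J p q \<subseteq> U"
proof -
  have ge: "mpow N j *v u \<in> U" if "u \<in> J (p + int j) (q + int j)" "p + q + 2 * int j \<ge> int n" for j u
    using that
  \<comment> \<open>The pieces \<open>J (p + j) (q + j)\<close> vanish for large \<open>j\<close>, so the weight is bounded.\<close>
  proof (induction "nat (2 * int n + 1 - p - q - 2 * int j)" arbitrary: j u rule: less_induct)
    case less
    let ?p = "p + int j" and ?q = "q + int j"
    define l where "l = nat (?p + ?q - int n)"
    have l: "?p + ?q = int n + int l" using less.prems(2) by (simp add: l_def)
    show ?case
    proof (cases "?p > int n \<or> ?q > int n")
      case True
      then have "u = 0" using less.prems(1) J_out by blast
      then show ?thesis using U by (simp add: cvs.subspace_0)
    next
      case False
      have "mpow N (l + 1) *v u \<in> J (?p - int (l + 1)) (?q - int (l + 1))"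
        using less.prems(1) by (rule Npow_J)
      moreover have "(?p - int (l + 1)) + (?q - int (l + 1)) = int n - int (l + 2)"
        using l by simp
      ultimately obtain u' where u': "u' \<in> J (?p - int (l + 1) + int (l + 2)) (?q - int (l + 1) + int (l + 2))"
         "mpow N (l + 2) *v u' = mpow N (l + 1) *v u"
        using surj by blast
      then have u'J: "u' \<in> J (p + int (Suc j)) (q + int (Suc j))" by (simp add: algebra_simps)
      have "mpow N (Suc j) *v u' \<in> U"
      proof (rule less.hyps)
        have "2 * int n + 1 - p - q - 2 * int j > 0" using False by simp
        then show "nat (2 * int n + 1 - p - q - 2 * int (Suc j)) < nat (2 * int n + 1 - p - q - 2 * int j)"
          by simp
      qed (use u'J less.prems in auto)
      moreover have "mpow N j *v (u - N *v u') \<in> U"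
      proof (cases "j \<le> l")
        case True
        have "N *v u' \<in> J ?p ?q" using N_J[OF u'J] by simp
        then have "u - N *v u' \<in> J ?p ?q" using less.prems(1) csubspace_J by (blast intro: cvs.subspace_diff)
        moreover have "mpow N (l + 1) *v (N *v u') = mpow N (l + 2) *v u'"
          by (simp add: matrix_vector_mul_assoc flip: mpow_Suc')
        ultimately have "u - N *v u' \<in> primitive ?p ?q"
          using u'(2) less.prems(2) unfolding primitive_def l_def[symmetric] mem_Collect_eq
          by (simp add: mat_vec_diff)
        moreover have "j \<le> nat (p + q + 2 * int j - int n)" using True by (simp add: l_def algebra_simps)
        ultimately show ?thesis by (rule prim)
      next
        case False
        have "mpow N (l + 1) *v (N *v u') = mpow N (l + 2) *v u'"
          by (simp add: matrix_vector_mul_assoc flip: mpow_Suc')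
        then have z: "mpow N (l + 1) *v (u - N *v u') = 0" using u'(2) by (simp add: mat_vec_diff)
        have "mpow N j = mpow N (j - (l + 1)) ** mpow N (l + 1)" using False by (simp flip: mpow_add)
        then have "mpow N j *v (u - N *v u') = 0" using z by (simp flip: matrix_vector_mul_assoc)
        then show ?thesis using U by (simp add: cvs.subspace_0)
      qed
      moreover have "mpow N j *v u = mpow N (Suc j) *v u' + mpow N j *v (u - N *v u')"
        by (simp add: mpow_Suc' mat_vec_diff flip: matrix_vector_mul_assoc)
      ultimately show ?thesis using U by (simp add: cvs.subspace_add)
    qed
  qed
  show ?thesis
  proof
    fix u assume u: "u \<in> J p q"
    show "u \<in> U"
    proof (cases "p + q \<ge> int n")
      case True
      then show ?thesis using ge[of u 0] u by simp
    next
      case False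
      define m where "m = nat (int n - p - q)"
      have m: "p + q = int n - int m" using False by (simp add: m_def)
      then obtain v where "v \<in> J (p + int m) (q + int m)" "mpow N m *v v = u"
        using surj[OF u] by blast
      then show ?thesis using ge[of v m] m by simp
    qed
  qed
qed

end

section \<open>The bigrading of a mixed Hodge structure\<close>

text \<open>A mixed Hodge structure on \<open>V\<close> with complexified weight filtration; the last two conditions say that
  \<open>F\<close> and its conjugate induce opposite filtrations on \<open>Gr\<^sub>k\<close>.\<close>

locale mhs_data =
  fixes n :: nat and F Wc :: "int \<Rightarrow> (complex^'n) set"
  assumes F_csubspace: "cvs.subspace (F p)" and F_antimono: "p \<le> q \<Longrightarrow> F q \<subseteq> F p"
    and F_low: "p \<le> 0 \<Longrightarrow> F p = UNIV" and F_high: "p > int n \<Longrightarrow> F p = {0}"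
    and W_csubspace: "cvs.subspace (Wc k)" and W_mono: "k \<le> l \<Longrightarrow> Wc k \<subseteq> Wc l"
    and W_bot: "\<exists>k. Wc k = {0}" and W_top: "\<exists>k. Wc k = UNIV"
    and W_vconj: "v \<in> Wc k \<Longrightarrow> vconj v \<in> Wc k"
    and gr_sum: "w \<in> Wc k \<Longrightarrow> \<exists>a\<in>F p \<inter> Wc k. \<exists>b\<in>Wc k. vconj b \<in> F (k - p + 1) \<and> w - a - b \<in> Wc (k - 1)"
    and gr_int: "a \<in> F p \<Longrightarrow> a \<in> Wc k \<Longrightarrow> b \<in> Wc k \<Longrightarrow> vconj b \<in> F (k - p + 1) \<Longrightarrow> a - b \<in> Wc (k - 1)
       \<Longrightarrow> a \<in> Wc (k - 1)"
begin

definition G :: "int \<Rightarrow> int \<Rightarrow> (complex^'n) set" where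
  "G p k = {v \<in> Wc k. vconj v \<in> F (k - p)}"

text \<open>The increasing filtration opposite to \<open>F\<close>.  That \<open>V\<close> is the direct sum of \<open>F (p + 1)\<close> and \<open>Psi p\<close> is
  shown along the weight filtration: \<open>T p m\<close> collects the contributions of weight at most \<open>m\<close>, and
  on \<open>Gr\<^sub>k\<close> the filtrations become \<open>F\<^bsup>p+1\<^esup>\<close> and the conjugate of \<open>F\<^bsup>k-p\<^esup>\<close>.\<close>

definition Psi :: "int \<Rightarrow> (complex^'n) set" where
  "Psi p = cvs.span (\<Union>k. G p k)"

definition T :: "int \<Rightarrow> int \<Rightarrow> (complex^'n) set" where
  "T p m = cvs.span (\<Union>k\<in>{..m}. G p k)"

lemma csubspace_G: "cvs.subspace (G p k)"
  using W_csubspace F_csubspace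
  by (auto simp: G_def cvs.subspace_def vconj_add vconj_scaleC)

lemma T_step: "T p (m + 1) = {x + y | x y. x \<in> T p m \<and> y \<in> G p (m + 1)}"
proof -
  have "{..m + 1} = insert (m + 1) {..m}" by auto
  then have "(\<Union>k\<in>{..m+1}. G p k) = (\<Union>k\<in>{..m}. G p k) \<union> G p (m + 1)" by auto
  moreover have "cvs.span (G p (m + 1)) = G p (m + 1)"
    by (rule cvs.span_eq_iff[THEN iffD2, OF csubspace_G])
  ultimately show ?thesis unfolding T_def by (simp only: cvs.span_Un)
qed

lemma T_le_W: "T p m \<subseteq> Wc m"
  unfolding T_def
  by (rule cvs.span_minimal[OF _ W_csubspace]) (use W_mono in \<open>auto simp: G_def\<close>)

lemma T_le_Psi: "T p m \<subseteq> Psi p"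
  unfolding T_def Psi_def by (rule cvs.span_mono) auto

lemma G_le_T: "k \<le> m \<Longrightarrow> G p k \<subseteq> T p m"
  unfolding T_def using cvs.span_superset by fastforce

lemma Psi_eq_T:
  assumes "Wc m = UNIV" shows "Psi p = T p m"
proof (rule subset_antisym[OF _ T_le_Psi])
  have "G p k \<subseteq> G p m" if "k \<ge> m" for k
    using assms F_antimono[of "m - p" "k - p"] that by (auto simp: G_def)
  then have "G p k \<subseteq> T p m" for k
    using G_le_T[of k m p] G_le_T[of m m p] by (meson linear order_refl subset_trans)
  then show "Psi p \<subseteq> T p m"
    unfolding Psi_def by (intro cvs.span_minimal) (auto simp: T_def)
qed

lemma W_sum: "w \<in> Wc m \<Longrightarrow> \<exists>f\<in>F (p + 1). f \<in> Wc m \<and> w - f \<in> T p m"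
proof -
  obtain k0 where k0: "Wc k0 = {0}" using W_bot by blast
  have low: "\<exists>f\<in>F (p + 1). f \<in> Wc m \<and> w - f \<in> T p m" if "w \<in> Wc m" "m \<le> k0" for m w
  proof -
    have "w = 0" using W_mono[OF that(2)] that(1) k0 by auto
    then show ?thesis using F_csubspace W_csubspace
      by (intro bexI[of _ 0]) (auto simp: T_def cvs.subspace_0 cvs.span_zero)
  qed
  show "\<exists>f\<in>F (p + 1). f \<in> Wc m \<and> w - f \<in> T p m" if "w \<in> Wc m"
  proof (cases "m \<le> k0")
    case False
    then have "k0 \<le> m" by simp
    then show ?thesis using that
    proof (induction m arbitrary: w rule: int_ge_induct)
      case base
      then show ?case using low by blast
    next
      case (step m)
      obtain a b where ab: "a \<in> F (p + 1)" "a \<in> Wc (m + 1)" "b \<in> Wc (m + 1)" 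
        "vconj b \<in> F (m + 1 - (p + 1) + 1)" "w - a - b \<in> Wc m"
        using gr_sum[OF step.prems, of "p + 1"] by auto
      obtain f where f: "f \<in> F (p + 1)" "f \<in> Wc m" "w - a - b - f \<in> T p m"
        using step.IH[OF ab(5)] by blast
      have "m + 1 - (p + 1) + 1 = m + 1 - p" by simp
      then have "b \<in> G p (m + 1)" using ab by (simp only: G_def mem_Collect_eq)
      then have "(w - a - b - f) + b \<in> T p (m + 1)" using f(3) unfolding T_step by blast
      moreover have "a + f \<in> F (p + 1)" using ab f F_csubspace by (blast intro: cvs.subspace_add)
      moreover have "a + f \<in> Wc (m + 1)" using ab f W_mono[of m "m + 1"] W_csubspace
        by (intro cvs.subspace_add) auto
      ultimately show ?case by (intro bexI[of _ "a + f"]) (auto simp: algebra_simps)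
    qed
  qed (use low that in blast)
qed

lemma F_T_trivial: "v \<in> F (p + 1) \<Longrightarrow> v \<in> T p m \<Longrightarrow> v = 0"
proof -
  obtain k0 where k0: "Wc k0 = {0}" using W_bot by blast
  show "v = 0" if "v \<in> F (p + 1)" "v \<in> T p m"
  proof (cases "m \<le> k0")
    case True
    then show ?thesis using that T_le_W W_mono[OF True] k0 by auto
  next
    case False
    then have "k0 \<le> m" by simp
    then show ?thesis using that
    proof (induction m arbitrary: v rule: int_ge_induct)
      case base
      then show ?case using T_le_W k0 by auto
    next
      case (step m)
      obtain x g where xg: "v = x + g" "x \<in> T p m" "g \<in> G p (m + 1)"
        using step.prems(2) unfolding T_step by blast
      have x: "x \<in> Wc m" using xg T_le_W by blast
      have g: "g \<in> Wc (m + 1)" "vconj g \<in> F (m + 1 - p)" using xg by (auto simp: G_def)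
      have "v \<in> Wc (m + 1)" using xg x g W_mono[of m "m + 1"] W_csubspace by (auto intro: cvs.subspace_add)
      moreover have "m + 1 - (p + 1) + 1 = m + 1 - p" by simp
      ultimately have "v \<in> Wc (m + 1 - 1)"
        using step.prems(1) g x xg(1) by (intro gr_int[of v "p + 1" "m + 1" g]) (simp_all only:, simp)
      then have "g \<in> Wc m" using xg(1) x W_csubspace[of m] cvs.subspace_diff[of "Wc m" v x] by simp
      then have "g \<in> T p m"
        using g F_antimono[of "m - p" "m + 1 - p"] G_le_T[of m m p] by (auto simp: G_def)
      then have "v \<in> T p m" using xg by (auto simp: T_def intro: cvs.span_add)
      then show ?case using step by blast
    qed
  qed
qed

lemma grading_exists: "\<exists>e. grading n e \<and> (\<forall>p. F p = up e p) \<and> (\<forall>p. Psi p = down e p)"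
proof -
  obtain m where m: "Wc m = UNIV" using W_top by blast
  have G_mono: "G p k \<subseteq> G q k" if "p \<le> q" for p q k
    using that F_antimono[of "k - q" "k - p"] by (auto simp: G_def)
  obtain e where "grading n e" "\<And>p. F p = up e p" "\<And>p. Psi p = down e p"
  proof (rule grading_of_opposite_filtrations[of F Psi n])
    show "Psi p \<subseteq> Psi q" if "p \<le> q" for p q
      unfolding Psi_def using G_mono[OF that] by (intro cvs.span_mono) blast
    show "\<exists>s\<in>Psi p. v - s \<in> F (p + 1)" for p v
    proof -
      obtain f where "f \<in> F (p + 1)" "v - f \<in> T p m" using W_sum[of v m p] m by auto
      then show ?thesis using T_le_Psi by (intro bexI[of _ "v - f"]) auto
    qed
    show "v = 0" if "v \<in> F (p + 1)" "v \<in> Psi p" for p v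
      using F_T_trivial that Psi_eq_T[OF m] by blast
  qed (use F_csubspace F_antimono F_low F_high in \<open>auto simp: Psi_def\<close>)
  then show ?thesis by blast
qed

definition eF :: "int \<Rightarrow> complex^'n^'n" where
  "eF = (SOME e. grading n e \<and> (\<forall>p. F p = up e p) \<and> (\<forall>p. Psi p = down e p))"

lemma grading_eF: "grading n eF" and F_eq: "F p = up eF p" and Psi_eq: "Psi p = down eF p"
  using someI_ex[OF grading_exists] unfolding eF_def by blast+

lemma F_iff: "v \<in> F p \<longleftrightarrow> (\<forall>r<p. eF r *v v = 0)"
  by (subst F_eq) (simp add: up_def)

lemma Psi_iff: "v \<in> Psi p \<longleftrightarrow> (\<forall>r>p. eF r *v v = 0)"
  by (subst Psi_eq) (simp add: down_def)

sublocale gF: grading n eF by (rule grading_eF)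

text \<open>The conjugate grading; it splits the conjugates of \<open>F\<close> and \<open>Psi\<close>.\<close>

definition eB :: "int \<Rightarrow> complex^'n^'n" where "eB p = vconj (eF p)"

lemma grading_eB: "grading n eB"
proof
  show "i < 0 \<or> i > int n \<Longrightarrow> eB i = 0" for i by (simp add: eB_def gF.support)
  show "eB i ** eB j = (if i = j then eB i else 0)" for i j
    by (simp add: eB_def gF.orth flip: vconj_mat_mul)
  show "(\<Sum>i = 0..int n. eB i) = mat 1"
    by (simp add: eB_def gF.total vconj_mat_1 flip: vconj_sum)
qed

sublocale gB: grading n eB by (rule grading_eB)

lemma vconj_eB_vec: "vconj (eB p *v v) = eF p *v vconj v" and vconj_eF_vec: "vconj (eF p *v v) = eB p *v vconj v"
  by (simp_all add: vconj_mat_vec eB_def vconj_vconj)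

text \<open>The decomposition of \<open>w \<in> W\<^sub>k\<close> along \<open>F (a + 1)\<close> and \<open>Psi a\<close> can be chosen inside \<open>W\<^sub>k\<close>.\<close>

lemma eF_W: "v \<in> Wc k \<Longrightarrow> eF p *v v \<in> Wc k"
proof (cases "p \<in> {0..int n}")
  case True
  assume v: "v \<in> Wc k"
  show ?thesis
  proof (rule truncations_mem[where c="\<lambda>p v. eF p *v v" and K="{0..int n}"])
    show "subspace (Wc k)" by (rule subspace_of_csubspace[OF W_csubspace])
    fix a u assume u: "u \<in> Wc k"
    obtain f where f: "f \<in> F (a + 1)" "f \<in> Wc k" "u - f \<in> T a k" using W_sum[OF u] by blast
    then have "u - f \<in> Wc k" "u - f \<in> Psi a"
      using T_le_W T_le_Psi by blast+
    moreover have "\<forall>b\<le>a. eF b *v f = 0" using f(1) by (simp add: F_iff)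
    moreover have "\<forall>b>a. eF b *v (u - f) = 0" using calculation(2) by (simp add: Psi_iff)
    moreover have "u = f + (u - f)" by simp
    ultimately show "\<exists>f\<in>Wc k. \<exists>s\<in>Wc k. u = f + s \<and> (\<forall>b\<le>a. eF b *v f = 0) \<and> (\<forall>b>a. eF b *v s = 0)"
      using f(2) by blast
  next
    show "eF b *v (x + y) = eF b *v x + eF b *v y" for b x y by (rule matrix_vector_right_distrib)
    show "(\<Sum>b = 0..int n. eF b *v x) = x" for x by (rule gF.decomp)
  qed (use v True in simp_all)
next
  case False
  then show ?thesis using gF.support[of p] W_csubspace by (auto simp: cvs.subspace_0)
qed

lemma eB_W: "v \<in> Wc k \<Longrightarrow> eB p *v v \<in> Wc k"
  using W_vconj[OF eF_W[OF W_vconj], of v k p] by (simp only: vconj_eF_vec vconj_vconj)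

lemma eF_F: "v \<in> F p \<Longrightarrow> eF q *v v \<in> F p"
  by (auto simp: F_iff gF.e_e_vec)

lemma eB_Psi: "v \<in> Psi p \<Longrightarrow> eB q *v v \<in> Psi p"
proof -
  have "eB q *v g \<in> G p k" if "g \<in> G p k" for g k
    using that eB_W eF_F by (auto simp: G_def vconj_eB_vec)
  then have "(\<Union>k. G p k) \<subseteq> {v. eB q *v v \<in> Psi p}"
    unfolding Psi_def by (auto intro!: cvs.span_base)
  moreover have "cvs.subspace {v. eB q *v v \<in> Psi p}"
    unfolding cvs.subspace_def Psi_def
    by (auto simp: matrix_vector_right_distrib mat_vec_scaleC cvs.span_zero intro: cvs.span_add cvs.span_scale)
  ultimately have "Psi p \<subseteq> {v. eB q *v v \<in> Psi p}"
    unfolding Psi_def by (rule cvs.span_minimal)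
  then show "v \<in> Psi p \<Longrightarrow> eB q *v v \<in> Psi p" by blast
qed

lemma eB_triangular: "r > p \<Longrightarrow> eF r ** eB q ** eF p = 0"
proof -
  have "\<forall>p. \<forall>v\<in>down eF p. eB q *v v \<in> down eF (p + 0)"
    using eB_Psi by (simp add: down_def Psi_iff)
  then show "r > p \<Longrightarrow> eF r ** eB q ** eF p = 0"
    unfolding gF.raises_down_iff by simp
qed

text \<open>The conjugate grading preserves \<open>Psi\<close>, so it is block triangular with respect to \<open>eF\<close>.  Passing to the diagonal
  blocks is multiplicative on triangular matrices; it yields a grading that commutes with \<open>eF\<close> and still splits the
  conjugate \<open>Phi\<close> of \<open>Psi\<close>.\<close>

definition eS :: "int \<Rightarrow> complex^'n^'n" where
  "eS q = component n eF 0 (eB q)"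

lemma eF_eS: "eF p ** eS q = eF p ** eB q ** eF p" and eS_eF: "eS q ** eF p = eF p ** eB q ** eF p"
proof -
  have d: "(\<Sum>r = 0..int n. if r = p then eF p ** eB q ** eF p else 0) = eF p ** eB q ** eF p"
    using gF.support[of p] by (auto simp: sum.delta)
  have "eF p ** eS q = (\<Sum>r = 0..int n. if r = p then eF p ** eB q ** eF p else 0)"
    unfolding eS_def component_def mat_mul_sum_right by (intro sum.cong) (auto simp: matrix_mul_assoc gF.orth)
  then show "eF p ** eS q = eF p ** eB q ** eF p" by (simp add: d)
  have "eF r ** eB q ** eF r ** eF p = (if r = p then eF p ** eB q ** eF p else 0)" for r
    by (auto simp: gF.orth simp flip: matrix_mul_assoc)
  then have "eS q ** eF p = (\<Sum>r = 0..int n. if r = p then eF p ** eB q ** eF p else 0)"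
    unfolding eS_def component_def mat_mul_sum_left by (intro sum.cong) auto
  then show "eS q ** eF p = eF p ** eB q ** eF p" by (simp add: d)
qed

text \<open>In a product of triangular matrices, only diagonal blocks contribute to a diagonal block.\<close>

lemma eB_diagonal_mult: "eF p ** eB q ** eF p ** eB q' ** eF p = eF p ** (eB q ** eB q') ** eF p"
proof -
  have "eF p ** (eB q ** eB q') ** eF p = eF p ** eB q ** (\<Sum>r = 0..int n. eF r) ** eB q' ** eF p"
    by (simp add: gF.total matrix_mul_assoc)
  also have "\<dots> = (\<Sum>r = 0..int n. (eF p ** eB q ** eF r) ** (eF r ** eB q' ** eF p))"
    by (simp add: mat_mul_sum_right mat_mul_sum_left matrix_mul_assoc gF.orth)
       (simp add: gF.orth flip: matrix_mul_assoc)
  also have "\<dots> = (\<Sum>r = 0..int n. if r = p then eF p ** eB q ** eF p ** eB q' ** eF p else 0)"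
  proof (intro sum.cong refl)
    fix r
    consider "r < p" | "r > p" | "r = p" by linarith
    then show "(eF p ** eB q ** eF r) ** (eF r ** eB q' ** eF p) = (if r = p then eF p ** eB q ** eF p ** eB q' ** eF p else 0)"
    proof cases
      case 3
      have "(eF p ** eB q ** eF p) ** (eF p ** eB q' ** eF p) = eF p ** eB q ** (eF p ** eF p) ** eB q' ** eF p"
        by (simp only: matrix_mul_assoc)
      then show ?thesis using 3 by (simp add: gF.orth)
    qed (simp_all add: eB_triangular)
  qed
  also have "\<dots> = eF p ** eB q ** eF p ** eB q' ** eF p"
    using gF.support[of p] by (auto simp: sum.delta)
  finally show ?thesis by simp
qed

lemma grading_eS: "grading n eS"
proof
  show "i < 0 \<or> i > int n \<Longrightarrow> eS i = 0" for i by (simp add: eS_def gB.support component_def)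
  show "eS i ** eS j = (if i = j then eS i else 0)" for i j
  proof (rule gF.block_eqI)
    fix q p
    have "eF q ** (eS i ** eS j) ** eF p = (eF q ** eS i) ** (eS j ** eF p)"
      by (simp only: matrix_mul_assoc)
    also have "\<dots> = eF q ** eB i ** (eF q ** eF p) ** eB j ** eF p"
      by (simp only: eF_eS eS_eF matrix_mul_assoc)
    also have "\<dots> = (if q = p then eF p ** (eB i ** eB j) ** eF p else 0)"
      by (auto simp: gF.orth eB_diagonal_mult)
    also have "\<dots> = (if q = p \<and> i = j then eF p ** eB i ** eF p else 0)"
      by (auto simp: gB.orth)
    also have "\<dots> = eF q ** (if i = j then eS i else 0) ** eF p"
      by (auto simp: gF.component_block eS_def)
    finally show "eF q ** (eS i ** eS j) ** eF p = eF q ** (if i = j then eS i else 0) ** eF p" .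
  qed
  have "(\<Sum>i = 0..int n. eS i) = component n eF 0 (\<Sum>i = 0..int n. eB i)"
    unfolding eS_def component_def mat_mul_sum_left mat_mul_sum_right by (rule sum.swap)
  also have "\<dots> = mat 1" by (simp add: gB.total component_def gF.orth gF.total)
  finally show "(\<Sum>i = 0..int n. eS i) = mat 1" .
qed

sublocale gS: grading n eS by (rule grading_eS)

sublocale bigrading n eF eS
  by unfold_locales (simp add: eF_eS eS_eF)

definition Phi :: "int \<Rightarrow> (complex^'n) set" where "Phi q = vconj ` Psi q"

lemma Phi_iff: "v \<in> Phi q \<longleftrightarrow> vconj v \<in> Psi q"
  by (simp add: Phi_def vconj_image_iff)

lemma csubspace_Phi: "cvs.subspace (Phi q)"
  unfolding Phi_def Psi_def by (intro csubspace_vconj cvs.subspace_span)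

lemma eF_Phi: "v \<in> Phi q \<Longrightarrow> eF p *v v \<in> Phi q"
  using eB_Psi by (simp add: Phi_iff vconj_eF_vec)

lemma W_F_Phi: "v \<in> Wc k \<Longrightarrow> v \<in> F p \<Longrightarrow> v \<in> Phi (k - p)"
  using W_vconj unfolding Phi_iff Psi_def
  by (intro cvs.span_base) (auto simp: G_def vconj_vconj intro!: exI[of _ k])

lemma eF_Phi_W: "v \<in> Phi q \<Longrightarrow> eF p *v v \<in> Wc (p + q)"
proof -
  let ?S = "{u. eF p *v vconj u \<in> Wc (p + q)}"
  have "(\<Union>k. G q k) \<subseteq> ?S"
  proof safe
    fix k u assume u: "u \<in> G q k"
    show "eF p *v vconj u \<in> Wc (p + q)"
    proof (cases "p < k - q")
      case True
      then have "eF p *v vconj u = 0" using u by (auto simp: G_def F_iff)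
      then show ?thesis using W_csubspace by (simp add: cvs.subspace_0)
    next
      case False
      then show ?thesis using u W_mono[of k "p + q"] eF_W W_vconj by (auto simp: G_def)
    qed
  qed
  moreover have "cvs.subspace ?S"
    using W_csubspace[of "p + q"] by (auto simp: cvs.subspace_def vconj_add vconj_scaleC matrix_vector_right_distrib mat_vec_scaleC)
  ultimately have "Psi q \<subseteq> ?S" unfolding Psi_def by (rule cvs.span_minimal)
  then show "v \<in> Phi q \<Longrightarrow> eF p *v v \<in> Wc (p + q)"
    using vconj_vconj[of v] by (auto simp: Phi_iff subset_iff)
qed

lemma Phi_eq_B: "Phi q = down eB q"
proof -
  have "eF r *v vconj v = 0 \<longleftrightarrow> eB r *v v = 0" for r v
    using vconj_eB_vec[of r v] vconj_eF_vec[of r "vconj v"] by (auto simp: vconj_vconj)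
  then show ?thesis by (auto simp: Phi_iff Psi_iff down_def)
qed

text \<open>\<open>Phi\<close> is stable under \<open>eF\<close>, as \<open>Psi\<close> is under \<open>eB\<close>; so it does not change when \<open>eB\<close> is replaced by its
  diagonal blocks.\<close>

lemma Phi_eq: "Phi q = down eS q"
proof (intro set_eqI iffI)
  fix v assume v: "v \<in> Phi q"
  have "eS r *v v = 0" if "r > q" for r
  proof -
    have "eB r *v (eF p *v v) = 0" for p using eF_Phi[OF v] that unfolding Phi_eq_B by (simp add: down_def)
    then show ?thesis
      by (simp add: eS_def component_def mat_vec_sum_left flip: matrix_vector_mul_assoc)
  qed
  then show "v \<in> down eS q" by (simp add: down_def)
next
  fix v assume v: "v \<in> down eS q"
  have "eS r *v v \<in> Phi q" for r
  proof (cases "r > q")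
    case True
    then show ?thesis using v csubspace_Phi by (auto simp: down_def cvs.subspace_0)
  next
    case False
    then have "eB r *v w \<in> Phi q" for w by (auto simp: Phi_eq_B down_def gB.e_e_vec)
    then show ?thesis
      unfolding eS_def component_def mat_vec_sum_left
      by (intro cvs.subspace_sum[OF csubspace_Phi]) (auto intro: eF_Phi simp flip: matrix_vector_mul_assoc)
  qed
  then have "(\<Sum>r = 0..int n. eS r *v v) \<in> Phi q" by (intro cvs.subspace_sum[OF csubspace_Phi])
  then show "v \<in> Phi q" by (simp add: gS.decomp)
qed

text \<open>On \<open>W\<^sub>k\<close>, the component of \<open>eF\<close>-degree \<open>p\<close> lies in \<open>W\<^sub>k \<inter> F p\<close>, hence in \<open>Phi (k - p)\<close>; conversely the component of
  \<open>eF\<close>-degree \<open>p\<close> of an element of \<open>Phi q\<close> has weight at most \<open>p + q\<close>.\<close>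

lemma W_iff: "v \<in> Wc k \<longleftrightarrow> (\<forall>p q. p + q > k \<longrightarrow> eF p *v (eS q *v v) = 0)"
proof (intro iffI allI impI)
  fix p q assume v: "v \<in> Wc k" and pq: "p + q > k"
  have "eF p *v v \<in> Phi (k - p)"
    using eF_W[OF v] by (intro W_F_Phi) (auto simp: F_iff gF.e_e_vec)
  then show "eF p *v (eS q *v v) = 0"
    using pq by (auto simp: Phi_eq down_def comm_vec)
next
  assume v: "\<forall>p q. p + q > k \<longrightarrow> eF p *v (eS q *v v) = 0"
  show "v \<in> Wc k"
  proof (rule mem_of_J_mem[OF W_csubspace])
    fix p q
    show "eF p *v (eS q *v v) \<in> Wc k"
    proof (cases "p + q > k")
      case True
      then show ?thesis using v W_csubspace by (auto simp: cvs.subspace_0)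
    next
      case False
      have "eS q *v v \<in> Phi q" unfolding Phi_eq by (rule gS.e_mem_down)
      then show ?thesis using eF_Phi_W W_mono[of "p + q" k] False by auto
    qed
  qed
qed

lemma J_W: "v \<in> J p q \<Longrightarrow> p + q \<le> k \<Longrightarrow> v \<in> Wc k"
  by (auto simp: W_iff J_eval)

end

locale limit_mhs_data = mhs_data n F Wc for n and F Wc :: "int \<Rightarrow> (complex^'n) set" +
  fixes N :: "complex^'n^'n"
  assumes N_real: "vconj N = N" and N_F: "v \<in> F p \<Longrightarrow> N *v v \<in> F (p - 1)"
    and N_W: "v \<in> Wc k \<Longrightarrow> N *v v \<in> Wc (k - 2)"
    and N_surj: "u \<in> Wc (int n - int l) \<Longrightarrow> \<exists>v\<in>Wc (int n + int l). u - mpow N l *v v \<in> Wc (int n - int l - 1)"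
begin

lemma N_Psi: "v \<in> Psi p \<Longrightarrow> N *v v \<in> Psi (p - 1)"
proof -
  have "N *v g \<in> G (p - 1) (k - 2)" if "g \<in> G p k" for g k
    using that N_W N_F[of "vconj g" "k - p"] by (simp add: G_def vconj_mat_vec N_real)
  then have "(\<Union>k. G p k) \<subseteq> {v. N *v v \<in> Psi (p - 1)}"
    unfolding Psi_def by (auto intro!: cvs.span_base)
  moreover have "cvs.subspace {v. N *v v \<in> Psi (p - 1)}"
    unfolding cvs.subspace_def Psi_def
    by (auto simp: matrix_vector_right_distrib mat_vec_scaleC cvs.span_zero intro: cvs.span_add cvs.span_scale)
  ultimately have "Psi p \<subseteq> {v. N *v v \<in> Psi (p - 1)}"
    unfolding Psi_def[of p] by (rule cvs.span_minimal)
  then show "v \<in> Psi p \<Longrightarrow> N *v v \<in> Psi (p - 1)" by blast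
qed

lemma N_eF: "N ** eF p = eF (p - 1) ** N"
proof -
  have "\<forall>p q. q < p + - 1 \<longrightarrow> eF q ** N ** eF p = 0"
    using N_F by (subst gF.raises_up_iff[symmetric]) (simp add: F_iff up_def)
  moreover have "\<forall>p q. q > p + - 1 \<longrightarrow> eF q ** N ** eF p = 0"
    using N_Psi by (subst gF.raises_down_iff[symmetric]) (simp add: Psi_iff down_def)
  ultimately have b: "eF q ** N ** eF p = 0" if "q \<noteq> p - 1" for p q
    using that by (cases "q < p - 1") auto
  show ?thesis
  proof (rule gF.block_eqI)
    fix q r
    have "eF q ** (N ** eF p) ** eF r = (eF q ** N) ** (eF p ** eF r)"
      "eF q ** (eF (p - 1) ** N) ** eF r = (eF q ** eF (p - 1)) ** N ** eF r"
      by (simp_all only: matrix_mul_assoc)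
    then show "eF q ** (N ** eF p) ** eF r = eF q ** (eF (p - 1) ** N) ** eF r"
      using b by (auto simp: gF.orth)
  qed
qed

lemma N_eB: "N ** eB p = eB (p - 1) ** N"
  using arg_cong[OF N_eF[of p], of vconj] by (simp add: vconj_mat_mul N_real eB_def)

lemma N_eS: "N ** eS q = eS (q - 1) ** N"
proof (rule gF.block_eqI)
  fix r p
  have "eF r ** (N ** eS q) ** eF p = (eF r ** N) ** (eS q ** eF p)"
    by (simp only: matrix_mul_assoc)
  also have "\<dots> = (N ** eF (r + 1)) ** (eF p ** eB q ** eF p)"
    using N_eF[of "r + 1"] by (simp add: eS_eF)
  also have "\<dots> = N ** (eF (r + 1) ** eF p) ** eB q ** eF p" by (simp only: matrix_mul_assoc)
  also have "\<dots> = (if r + 1 = p then N ** eF p ** eB q ** eF p else 0)" by (simp add: gF.orth)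
  finally have 1: "eF r ** (N ** eS q) ** eF p = (if r + 1 = p then N ** eF p ** eB q ** eF p else 0)" .
  have "eF r ** (eS (q - 1) ** N) ** eF p = (eF r ** eS (q - 1)) ** (N ** eF p)"
    by (simp only: matrix_mul_assoc)
  also have "\<dots> = (eF r ** eB (q - 1) ** eF r) ** (eF (p - 1) ** N)" by (simp add: eF_eS N_eF)
  also have "\<dots> = eF r ** eB (q - 1) ** (eF r ** eF (p - 1)) ** N" by (simp only: matrix_mul_assoc)
  also have "\<dots> = (if r + 1 = p then eF r ** eB (q - 1) ** eF r ** N else 0)" by (auto simp: gF.orth)
  also have "\<dots> = (if r + 1 = p then N ** eF p ** eB q ** eF p else 0)"
  proof -
    have "eF r ** eB (q - 1) ** eF r ** N = N ** eF p ** eB q ** eF p" if "r = p - 1"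
    proof -
      have "eF r ** eB (q - 1) ** eF r ** N = eF r ** (eB (q - 1) ** N) ** eF p"
        using N_eF[of p] that by (simp flip: matrix_mul_assoc)
      also have "\<dots> = (eF r ** N) ** eB q ** eF p" by (simp add: N_eB[symmetric] matrix_mul_assoc)
      finally show ?thesis using N_eF[of p] that by simp
    qed
    then show ?thesis by auto
  qed
  finally show "eF r ** (N ** eS q) ** eF p = eF r ** (eS (q - 1) ** N) ** eF p" using 1 by simp
qed

sublocale lefschetz n eF eS N
proof
  fix u p q l assume u: "u \<in> J p q" "p + q = int n - int l"
  obtain v where v: "u - mpow N l *v v \<in> Wc (int n - int l - 1)"
    using N_surj[of u l] J_W[OF u(1)] u(2) by auto
  have sh: "eF p *v (mpow N l *v w) = mpow N l *v (eF (p + int l) *v w)" 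
    "eS p *v (mpow N l *v w) = mpow N l *v (eS (p + int l) *v w)" for p w
  proof -
    have a: "eF p *v (N *v w) = N *v (eF (p + 1) *v w)" "eS p *v (N *v w) = N *v (eS (p + 1) *v w)" for p w
      using N_eF[of "p + 1"] N_eS[of "p + 1"] by (simp_all add: matrix_vector_mul_assoc)
    show "eF p *v (mpow N l *v w) = mpow N l *v (eF (p + int l) *v w)" 
      "eS p *v (mpow N l *v w) = mpow N l *v (eS (p + int l) *v w)"
      by (induction l arbitrary: p) (simp_all add: mpow_Suc a algebra_simps flip: matrix_vector_mul_assoc)
  qed
  have "eF p *v (eS q *v (u - mpow N l *v v)) = 0" using v u(2) by (auto simp: W_iff)
  then have "u = mpow N l *v (eF (p + int l) *v (eS (q + int l) *v v))"
    using J_eval[OF u(1), of p q] by (simp add: mat_vec_diff sh)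
  then show "\<exists>v\<in>J (p + int l) (q + int l). mpow N l *v v = u" using es_mem_J by metis
qed (rule N_eF N_eS)+

end

section \<open>The unipotent element exp(N)\<close>

lemma pcompose_power: "pcompose (p ^ k) q = pcompose p q ^ k"
  by (induction k) (auto simp: pcompose_mult pcompose_1)

lemma coeff_pcompose_shift:
  fixes P :: "complex poly"
  assumes "degree P \<le> l"
  shows "coeff (pcompose P [:1, 1:]) i = (\<Sum>k\<le>l. coeff P k * of_nat (k choose i))"
proof -
  have m: "pcompose (monom c k) [:1, 1:] = smult c ([:1, 1:] ^ k)" for c :: complex and k
    by (induction k) (auto simp: monom_Suc pcompose_pCons monom_0 mult.commute)
  have "pcompose P [:1, 1:] = (\<Sum>k\<le>l. smult (coeff P k) ([:1, 1:] ^ k))"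
    by (subst poly_as_sum_of_monoms'[OF assms, symmetric]) (simp add: pcompose_sum m)
  moreover have "coeff ([:1, 1:] ^ k :: complex poly) i = of_nat (k choose i)" for k
  proof (cases "i \<le> k")
    case False
    have "degree ([:1, 1:] ^ k :: complex poly) \<le> k" by (rule order.trans[OF degree_power_le]) simp
    then show ?thesis using False by (simp add: coeff_eq_0)
  qed (simp add: coeff_linear_poly_power)
  ultimately show ?thesis by (simp add: coeff_sum)
qed

text \<open>The string of \<open>v\<close>, where \<open>N\<^bsup>l+1\<^esup> v = 0\<close>, normalised so that \<open>N\<close> acts on the combinations \<open>string_poly N l v P\<close> as
  \<open>d/dx\<close> acts on polynomials \<open>P\<close> of degree at most \<open>l\<close>.  Then \<open>exp(N)\<close> acts as the substitution of \<open>x + 1\<close> for \<open>x\<close>.\<close>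

definition string_vec :: "complex^'n^'n \<Rightarrow> nat \<Rightarrow> complex^'n \<Rightarrow> nat \<Rightarrow> complex^'n" where
  "string_vec N l v k = (fact k / fact l) *\<^sub>C (mpow N (l - k) *v v)"

definition string_poly :: "complex^'n^'n \<Rightarrow> nat \<Rightarrow> complex^'n \<Rightarrow> complex poly \<Rightarrow> complex^'n" where
  "string_poly N l v P = (\<Sum>k\<le>l. coeff P k *\<^sub>C string_vec N l v k)"

lemma mexp_string_vec:
  assumes v: "mpow N (l + 1) *v v = 0" and k: "k \<le> l"
  shows "mexp N *v string_vec N l v k = (\<Sum>i\<le>l. of_nat (k choose i) *\<^sub>C string_vec N l v i)"
proof -
  have Nm: "mpow N m *v string_vec N l v k = (fact k / fact (k - m)) *\<^sub>C string_vec N l v (k - m)" if "m \<le> k" for m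
  proof -
    have "l - (k - m) = m + (l - k)" using that k by simp
    then show ?thesis 
      by (simp add: string_vec_def mat_vec_scaleC scaleC_scaleC matrix_vector_mul_assoc flip: mpow_add)
  qed
  have "mpow N (k + 1) *v string_vec N l v k = (fact k / fact l) *\<^sub>C (mpow N (l + 1) *v v)"
  proof -
    have "l + 1 = k + 1 + (l - k)" using k by simp
    then show ?thesis
      by (simp add: string_vec_def mat_vec_scaleC matrix_vector_mul_assoc flip: mpow_add)
  qed
  then have "mpow N (k + 1) *v string_vec N l v k = 0" by (simp only: v scaleC_zero_right)
  from mexp_nilpotent_vec[OF this, of 1]
  have "mexp N *v string_vec N l v k = (\<Sum>m\<le>k. (1 / fact m) *\<^sub>C (mpow N m *v string_vec N l v k))"
    by (simp add: lessThan_Suc_atMost)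
  also have "\<dots> = (\<Sum>m\<le>k. of_nat (k choose m) *\<^sub>C string_vec N l v (k - m))"
    by (intro sum.cong) (auto simp: Nm scaleC_scaleC binomial_fact field_simps)
  also have "\<dots> = (\<Sum>i\<le>k. of_nat (k choose i) *\<^sub>C string_vec N l v i)"
    by (rule sum.reindex_bij_witness[of _ "\<lambda>i. k - i" "\<lambda>i. k - i"]) (auto simp flip: binomial_symmetric)
  also have "\<dots> = (\<Sum>i\<le>l. of_nat (k choose i) *\<^sub>C string_vec N l v i)"
    using k by (intro sum.mono_neutral_left) auto
  finally show ?thesis .
qed

lemma mexp_string_poly:
  assumes v: "mpow N (l + 1) *v v = 0" and P: "degree P \<le> l"
  shows "mexp N *v string_poly N l v P = string_poly N l v (pcompose P [:1, 1:])"
proof -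
  have "mexp N *v string_poly N l v P
      = (\<Sum>k\<le>l. \<Sum>i\<le>l. (coeff P k * of_nat (k choose i)) *\<^sub>C string_vec N l v i)"
    by (simp add: string_poly_def mat_vec_sum_right mat_vec_scaleC mexp_string_vec[OF v] sum_scaleC scaleC_scaleC)
  also have "\<dots> = (\<Sum>i\<le>l. \<Sum>k\<le>l. (coeff P k * of_nat (k choose i)) *\<^sub>C string_vec N l v i)"
    by (rule sum.swap)
  finally show ?thesis
    by (simp add: string_poly_def coeff_pcompose_shift[OF P] cvs.scale_sum_left)
qed

context grading
begin

definition torus :: "complex \<Rightarrow> complex^'n^'n" where
  "torus z = (\<Sum>i = 0..int n. (z powi (- i)) *\<^sub>C e i)"

lemma torus_e: "torus z ** e p = (z powi (- p)) *\<^sub>C e p" "e p ** torus z = (z powi (- p)) *\<^sub>C e p"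
proof -
  have a: "(\<Sum>r = 0..int n. (z powi (- r)) *\<^sub>C (if r = p then e r else 0)) = ((z powi (- p)) *\<^sub>C e p :: complex^'n^'n)"
  proof -
    have "(\<Sum>r = 0..int n. (z powi (- r)) *\<^sub>C (if r = p then e r else 0)) = 
       (\<Sum>r = 0..int n. if r = p then (z powi (- p)) *\<^sub>C e p else 0)"
      by (intro sum.cong) auto
    then show ?thesis using support[of p] by (auto simp: sum.delta)
  qed
  have "(\<Sum>r = 0..int n. (z powi (- r)) *\<^sub>C (if p = r then e p else 0)) = ((z powi (- p)) *\<^sub>C e p :: complex^'n^'n)"
    by (subst a[symmetric]) (intro sum.cong, auto)
  then show "torus z ** e p = (z powi (- p)) *\<^sub>C e p" "e p ** torus z = (z powi (- p)) *\<^sub>C e p"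
    unfolding torus_def mat_mul_sum_left mat_mul_sum_right scaleC_mat_mul_left scaleC_mat_mul_right orth
    using a by simp_all
qed

lemma torus_inverse:
  assumes "z \<noteq> 0" shows "torus z ** torus (inverse z) = mat 1"
proof (rule block_eqI)
  fix q p
  have "e q ** (torus z ** torus (inverse z)) ** e p = (e q ** torus z) ** (torus (inverse z) ** e p)"
    by (simp only: matrix_mul_assoc)
  also have "\<dots> = e q ** mat 1 ** e p"
    using assms by (auto simp: torus_e scaleC_mat_mul_left scaleC_mat_mul_right scaleC_scaleC orth power_int_minus
      power_int_inverse)
  finally show "e q ** (torus z ** torus (inverse z)) ** e p = e q ** mat 1 ** e p" .
qed

lemma up_antimono: "p \<le> q \<Longrightarrow> up e q \<subseteq> up e p"
  by (auto simp: up_def)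

lemma dim_up_down: "dim (up e (p + 1)) + dim (down e p) = dim (UNIV :: (complex^'n) set)"
proof -
  have "{x + y | x y. x \<in> up e (p + 1) \<and> y \<in> down e p} = UNIV"
  proof (intro set_eqI iffI UNIV_I CollectI)
    fix v
    let ?x = "\<Sum>i\<in>{i\<in>{0..int n}. i > p}. e i *v v" and ?y = "\<Sum>i\<in>{i\<in>{0..int n}. \<not> i > p}. e i *v v"
    have "v = ?x + ?y"
      by (subst decomp[of v, symmetric], subst sum.union_disjoint[symmetric]) (auto intro!: sum.cong finite_subset[of _ "{0..int n}"])
    moreover have "?x \<in> up e (p + 1)" "?y \<in> down e p"
      by (auto simp: up_def down_def mat_vec_sum_right e_e_vec intro!: sum.neutral)
    ultimately show "\<exists>x y. v = x + y \<and> x \<in> up e (p + 1) \<and> y \<in> down e p" by blast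
  qed
  moreover have "up e (p + 1) \<inter> down e p = {0}"
  proof (intro set_eqI iffI)
    fix v assume "v \<in> up e (p + 1) \<inter> down e p"
    then have "e i *v v = 0" for i by (cases "i < p + 1") (auto simp: up_def down_def)
    then have "v = 0" by (rule vec_eq_0I)
    then show "v \<in> {0}" by simp
  qed (auto simp: up_def down_def)
  ultimately show ?thesis
    using dim_sums_Int[OF subspace_of_csubspace[OF csubspace_up[of "p + 1"]] subspace_of_csubspace[OF csubspace_down[of p]]]
    by simp
qed

end

lemma mexp_inj: "mexp A *v v = 0 \<Longrightarrow> v = 0"
  using mexp_inverse(2)[of 1 A] by (metis matrix_vector_mul_assoc matrix_vector_mul_lid matrix_vector_mult_0_right scaleC_one)

lemma linear_mat_vec: "linear (\<lambda>v. A *v (v::complex^'n))"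
  by (rule linearI) (auto simp: matrix_vector_right_distrib scaleR_eq_scaleC mat_vec_scaleC)

context lefschetz
begin

lemma string_vec_J:
  assumes "v \<in> J p q" "k \<le> l" shows "string_vec N l v k \<in> J (p - int l + int k) (q - int l + int k)"
  using Npow_J[OF assms(1), of "l - k"] assms(2) csubspace_J
  unfolding string_vec_def by (auto simp: algebra_simps of_nat_diff intro!: cvs.subspace_scale)

lemma J_up_e: "v \<in> J p q \<Longrightarrow> r \<le> p \<Longrightarrow> v \<in> up e r" and J_up_s: "v \<in> J p q \<Longrightarrow> r \<le> q \<Longrightarrow> v \<in> up s r"
  by (auto simp: up_def J_e J_s)

text \<open>The vector \<open>f\<close> is the combination of the string of \<open>v\<close> with the coefficients of \<open>x\<^sup>j (x - 1)\<^bsup>l-j\<^esup>\<close>.  Since \<open>x\<^sup>j\<close>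
  divides this polynomial, only terms of \<open>e\<close>-degree at least \<open>n - q\<close> occur.  The operator \<open>exp(N)\<close> turns it into \<open>(x + 1)\<^sup>j x\<^bsup>l-j\<^esup>\<close>, whose
  lowest term \<open>x\<^bsup>l-j\<^esup>\<close> has coefficient \<open>1\<close> and corresponds to \<open>N\<^sup>j v\<close>, of \<open>s\<close>-degree \<open>q\<close>.\<close>

lemma mexp_N_leading_term_primitive:
  assumes v: "v \<in> primitive (p + int j) (q + int j)" and j: "j \<le> nat (p + q + 2 * int j - int n)"
  shows "\<exists>f\<in>up e (int n - q). mexp N *v f - mpow N j *v v \<in> up s (q + 1)"
proof -
  define l where "l = nat (p + q + 2 * int j - int n)"
  have l: "p + q + 2 * int j = int n + int l" "v \<in> J (p + int j) (q + int j)" "mpow N (l + 1) *v v = 0" "j \<le> l"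
    using v j unfolding primitive_def l_def by (auto simp: algebra_simps)
  define P :: "complex poly" where "P = monom 1 j * [:- 1, 1:] ^ (l - j)"
  have "degree P \<le> j + (l - j)"
    unfolding P_def by (rule order.trans[OF degree_mult_le])
      (intro add_mono, simp add: degree_monom_le, rule order.trans[OF degree_power_le], simp)
  then have dP: "degree P \<le> l" using l by simp
  have m: "monom 1 k = [:0, 1:] ^ k" for k :: nat and c :: complex
    by (induction k) (auto simp: monom_Suc monom_0 one_pCons)
  have sP: "pcompose P [:1, 1:] = monom 1 (l - j) * [:1, 1:] ^ j"
    unfolding P_def pcompose_mult m pcompose_power by (simp add: pcompose_pCons mult.commute)
  \<comment> \<open>The factor compensates the normalisation of \<open>string_vec\<close>.\<close>
  define c :: complex where "c = fact l / fact (l - j)"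
  let ?f = "c *\<^sub>C string_poly N l v P"
  have f: "?f \<in> up e (int n - q)"
    unfolding string_poly_def
  proof (rule cvs.subspace_scale[OF E.csubspace_up], rule cvs.subspace_sum[OF E.csubspace_up])
    fix k assume k: "k \<in> {..l}"
    show "coeff P k *\<^sub>C string_vec N l v k \<in> up e (int n - q)"
    proof (cases "k < j")
      case True
      then show ?thesis using E.csubspace_up by (simp add: P_def coeff_monom_mult cvs.subspace_0)
    next
      case False
      then have "string_vec N l v k \<in> up e (int n - q)"
        using k l by (intro J_up_e[OF string_vec_J[OF l(2)]]) auto
      then show ?thesis by (rule cvs.subspace_scale[OF E.csubspace_up])
    qed
  qed
  have "string_poly N l v (pcompose P [:1, 1:]) =
      coeff (pcompose P [:1, 1:]) (l - j) *\<^sub>C string_vec N l v (l - j) + 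
      (\<Sum>k\<in>{..l} - {l - j}. coeff (pcompose P [:1, 1:]) k *\<^sub>C string_vec N l v k)"
    unfolding string_poly_def by (rule sum.remove) auto
  moreover have "coeff (pcompose P [:1, 1:]) (l - j) = 1"
    by (simp add: sP coeff_monom_mult coeff_linear_poly_power)
  moreover have "c *\<^sub>C string_vec N l v (l - j) = mpow N j *v v"
    using l(4) by (simp add: string_vec_def c_def scaleC_scaleC)
  ultimately have "mexp N *v ?f - mpow N j *v v
     = c *\<^sub>C (\<Sum>k\<in>{..l} - {l - j}. coeff (pcompose P [:1, 1:]) k *\<^sub>C string_vec N l v k)"
    by (simp add: mat_vec_scaleC mexp_string_poly[OF l(3) dP] scaleC_add_right)
  also have "\<dots> \<in> up s (q + 1)"
  proof (rule cvs.subspace_scale[OF S.csubspace_up], rule cvs.subspace_sum[OF S.csubspace_up])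
    fix k assume k: "k \<in> {..l} - {l - j}"
    show "coeff (pcompose P [:1, 1:]) k *\<^sub>C string_vec N l v k \<in> up s (q + 1)"
    proof (cases "k < l - j")
      case True
      then show ?thesis using S.csubspace_up by (simp add: sP coeff_monom_mult cvs.subspace_0)
    next
      case False
      then have "string_vec N l v k \<in> up s (q + 1)"
        using k l by (intro J_up_s[OF string_vec_J[OF l(2)]]) auto
      then show ?thesis by (rule cvs.subspace_scale[OF S.csubspace_up])
    qed
  qed
  finally show ?thesis using f by blast
qed

lemma mexp_N_leading_term:
  assumes "u \<in> J p q"
  shows "\<exists>f\<in>up e (int n - q). mexp N *v f - u \<in> up s (q + 1)"
proof -
  let ?U = "{u. \<exists>f\<in>up e (int n - q). mexp N *v f - u \<in> up s (q + 1)}"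
  have U: "cvs.subspace ?U"
    unfolding cvs.subspace_def
  proof (intro conjI ballI allI)
    show "0 \<in> ?U" using E.csubspace_up S.csubspace_up by (auto intro!: bexI[of _ 0] simp: cvs.subspace_0)
    fix x y assume "x \<in> ?U" "y \<in> ?U"
    then obtain f g where fg: "f \<in> up e (int n - q)" "mexp N *v f - x \<in> up s (q + 1)" 
       "g \<in> up e (int n - q)" "mexp N *v g - y \<in> up s (q + 1)" by blast
    have "f + g \<in> up e (int n - q)" using fg by (blast intro: cvs.subspace_add[OF E.csubspace_up])
    moreover have "(mexp N *v f - x) + (mexp N *v g - y) \<in> up s (q + 1)"
      using fg by (blast intro: cvs.subspace_add[OF S.csubspace_up])
    then have "mexp N *v (f + g) - (x + y) \<in> up s (q + 1)"
      by (simp add: matrix_vector_right_distrib algebra_simps)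
    ultimately show "x + y \<in> ?U" by blast
  next
    fix c x assume "x \<in> ?U"
    then obtain f where fg: "f \<in> up e (int n - q)" "mexp N *v f - x \<in> up s (q + 1)" by blast
    have "c *\<^sub>C f \<in> up e (int n - q)" using fg by (blast intro: cvs.subspace_scale[OF E.csubspace_up])
    moreover have "c *\<^sub>C (mexp N *v f - x) \<in> up s (q + 1)"
      using fg by (blast intro: cvs.subspace_scale[OF S.csubspace_up])
    then have "mexp N *v (c *\<^sub>C f) - c *\<^sub>C x \<in> up s (q + 1)"
      by (simp add: mat_vec_scaleC cvs.scale_right_diff_distrib)
    ultimately show "c *\<^sub>C x \<in> ?U" by blast
  qed
  have "J p q \<subseteq> ?U"
    by (rule J_le_of_primitive_strings[OF U]) (use mexp_N_leading_term_primitive in blast)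
  then show ?thesis using assms by blast
qed

lemma torus_N: "S.torus z ** N = z *\<^sub>C (N ** S.torus z)" if "z \<noteq> 0"
proof (rule S.block_eqI)
  fix r p
  have "s r ** N ** s p = N ** (s (r + 1) ** s p)"
    using N_s[of "r + 1"] by (simp add: matrix_mul_assoc)
  then have b: "s r ** N ** s p = 0" if "r + 1 \<noteq> p" using that by (simp add: S.orth)
  have 1: "s r ** (S.torus z ** N) ** s p = (z powi (- r)) *\<^sub>C (s r ** N ** s p)"
    by (simp add: matrix_mul_assoc S.torus_e scaleC_mat_mul_left)
  have "s r ** (z *\<^sub>C (N ** S.torus z)) ** s p = z *\<^sub>C (s r ** N ** (S.torus z ** s p))"
    by (simp add: scaleC_mat_mul_left scaleC_mat_mul_right matrix_mul_assoc)
  then have 2: "s r ** (z *\<^sub>C (N ** S.torus z)) ** s p = (z * z powi (- p)) *\<^sub>C (s r ** N ** s p)"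
    by (simp add: S.torus_e scaleC_mat_mul_right scaleC_scaleC)
  have "z powi (- r) = z * z powi (- p)" if "r + 1 = p"
  proof -
    have "- r = 1 - p" using that by simp
    then show ?thesis using \<open>z \<noteq> 0\<close> by (simp add: power_int_diff power_int_minus field_simps)
  qed
  then show "s r ** (S.torus z ** N) ** s p = s r ** (z *\<^sub>C (N ** S.torus z)) ** s p"
    unfolding 1 2 using b by (cases "r + 1 = p") auto
qed

text \<open>The torus of the second grading rescales \<open>N\<close>, which has degree \<open>-1\<close>.\<close>

lemma mexp_scale_N:
  assumes "z \<noteq> 0"
  shows "mexp (z *\<^sub>C N) ** S.torus z = S.torus z ** mexp N"
proof -
  have h: "S.torus (inverse z) ** S.torus z = mat 1" 
    using S.torus_inverse[of "inverse z"] assms by simp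
  have "S.torus z ** N ** S.torus (inverse z) = z *\<^sub>C (N ** (S.torus z ** S.torus (inverse z)))"
    by (simp add: torus_N[OF assms] scaleC_mat_mul_left matrix_mul_assoc)
  then have "z *\<^sub>C N = S.torus z ** N ** S.torus (inverse z)"
    by (simp add: S.torus_inverse[OF assms])
  then have "mexp (z *\<^sub>C N) = S.torus z ** mexp N ** S.torus (inverse z)"
    using mexp_conj[OF h, of N] by simp
  then have "mexp (z *\<^sub>C N) ** S.torus z = S.torus z ** mexp N ** (S.torus (inverse z) ** S.torus z)"
    by (simp add: matrix_mul_assoc)
  then show ?thesis by (simp add: h)
qed

lemma torus_up_e: "f \<in> up e p \<Longrightarrow> S.torus z *v f \<in> up e p"
proof -
  have "e r ** S.torus z = S.torus z ** e r" for r
    by (simp add: S.torus_def mat_mul_sum_left mat_mul_sum_right scaleC_mat_mul_left scaleC_mat_mul_right comm)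
  then have "e r *v (S.torus z *v f) = S.torus z *v (e r *v f)" for r
    by (simp add: matrix_vector_mul_assoc)
  then show "f \<in> up e p \<Longrightarrow> S.torus z *v f \<in> up e p" by (simp add: up_def)
qed

text \<open>Let \<open>f\<close> be as in \<open>mexp_N_leading_term\<close> and \<open>t(z)\<close> the torus of the second grading.  The vectors
  \<open>w z = z\<^sup>q exp(zN) t(z) f\<close> equal \<open>z\<^sup>q t(z) exp(N) f\<close>, in which the component of degree \<open>q\<close> is \<open>u\<close> and all others carry a negative power
  of \<open>z\<close>.\<close>

lemma limit_vectors:
  assumes u: "u \<in> J p q"
  shows "\<exists>w. (\<forall>z. z \<noteq> 0 \<longrightarrow> w z \<in> (\<lambda>v. mexp (z *\<^sub>C N) *v v) ` up e (int n - q)) \<and> (w \<longlongrightarrow> u) at_infinity"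
proof -
  obtain f where f: "f \<in> up e (int n - q)" "mexp N *v f - u \<in> up s (q + 1)"
    using mexp_N_leading_term[OF u] by blast
  let ?g = "mexp N *v f - u"
  define w where "w = (\<lambda>z. z powi q *\<^sub>C (mexp (z *\<^sub>C N) *v (S.torus z *v f)))"
  have "w z \<in> (\<lambda>v. mexp (z *\<^sub>C N) *v v) ` up e (int n - q)" for z
    unfolding w_def mat_vec_scaleC[symmetric]
    by (intro imageI cvs.subspace_scale[OF E.csubspace_up] torus_up_e f)
  moreover have w_eq: "w z = u + (\<Sum>r\<in>{r\<in>{0..int n}. r > q}. z powi (q - r) *\<^sub>C (s r *v ?g))" if z: "z \<noteq> 0" for z
  proof -
    have "w z = z powi q *\<^sub>C (S.torus z *v (u + ?g))"
      unfolding w_def by (simp add: matrix_vector_mul_assoc mexp_scale_N[OF z])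
    also have "\<dots> = z powi q *\<^sub>C (S.torus z *v u) + z powi q *\<^sub>C (S.torus z *v ?g)"
      by (simp only: matrix_vector_right_distrib scaleC_add_right)
    also have "S.torus z *v u = z powi (- q) *\<^sub>C u"
    proof -
      have "S.torus z *v u = (S.torus z ** s q) *v u" 
        using J_s[OF u, of q] by (simp flip: matrix_vector_mul_assoc)
      then show ?thesis using J_s[OF u, of q] by (simp add: S.torus_e scaleC_mat_vec)
    qed
    also have "z powi q *\<^sub>C z powi (- q) *\<^sub>C u = u"
      using z by (simp add: scaleC_scaleC flip: power_int_add)
    also have "z powi q *\<^sub>C (S.torus z *v ?g) = (\<Sum>r = 0..int n. z powi (q - r) *\<^sub>C (s r *v ?g))"
      using z by (simp add: S.torus_def mat_vec_sum_left scaleC_mat_vec sum_scaleC scaleC_scaleC power_int_diff power_int_minus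
           field_simps)
    also have "\<dots> = (\<Sum>r\<in>{r\<in>{0..int n}. r > q}. z powi (q - r) *\<^sub>C (s r *v ?g))"
      using f(2) by (intro sum.mono_neutral_right) (auto simp: up_def not_less)
    finally show ?thesis .
  qed
  moreover have "((\<lambda>z. u + (\<Sum>r\<in>{r\<in>{0..int n}. r > q}. z powi (q - r) *\<^sub>C (s r *v ?g))) \<longlongrightarrow> u + (\<Sum>r\<in>{r\<in>{0..int n}. r > q}. 0)) at_infinity"
  proof (intro tendsto_add tendsto_const tendsto_sum)
    fix r assume r: "r \<in> {r\<in>{0..int n}. r > q}"
    define m where "m = nat (r - q)"
    have "q - r = - int m" "m > 0" using r by (auto simp: m_def)
    then have "(\<lambda>z::complex. z powi (q - r)) = (\<lambda>z. inverse z ^ m)"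
      by (simp add: power_int_minus power_inverse)
    moreover have "((\<lambda>z::complex. inverse z ^ m) \<longlongrightarrow> 0 ^ m) at_infinity"
      by (intro tendsto_power tendsto_inverse_0)
    ultimately have "((\<lambda>z::complex. z powi (q - r)) \<longlongrightarrow> 0) at_infinity" using \<open>m > 0\<close> by (simp add: zero_power)
    then have "((\<lambda>z. z powi (q - r) * (s r *v ?g) $ i) \<longlongrightarrow> 0) at_infinity" for i
      by (rule tendsto_mult_left_zero)
    then show "((\<lambda>z. z powi (q - r) *\<^sub>C (s r *v ?g)) \<longlongrightarrow> 0) at_infinity"
      by (intro vec_tendstoI) simp
  qed
  then have "((\<lambda>z. u + (\<Sum>r\<in>{r\<in>{0..int n}. r > q}. z powi (q - r) *\<^sub>C (s r *v ?g))) \<longlongrightarrow> u) at_infinity"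
    by simp
  then have "(w \<longlongrightarrow> u) at_infinity"
  proof (rule Lim_transform_eventually)
    have "eventually (\<lambda>z::complex. z \<noteq> 0) at_infinity"
      by (auto simp: eventually_at_infinity intro!: exI[of _ 1])
    then show "\<forall>\<^sub>F z in at_infinity. u + (\<Sum>r\<in>{r\<in>{0..int n}. r > q}. z powi (q - r) *\<^sub>C (s r *v ?g)) = w z"
      by eventually_elim (simp add: w_eq)
  qed
  ultimately show ?thesis by blast
qed

text \<open>Descending induction on \<open>q\<close> shows that \<open>U\<close> contains \<open>up s q\<close>.\<close>

lemma leading_terms_span:
  assumes U: "cvs.subspace U" and t: "\<And>p q u. u \<in> J p q \<Longrightarrow> \<exists>t\<in>U. t - u \<in> up s (q + 1)"
  shows "U = UNIV"
proof -
  have "up s (int n + 1 - int m) \<subseteq> U" for m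
  proof (induction m)
    case 0
    have "v = 0" if "v \<in> up s (int n + 1)" for v
    proof (rule S.vec_eq_0I)
      fix i show "s i *v v = 0" using that S.support[of i] by (cases "i < int n + 1") (auto simp: up_def)
    qed
    then show ?case using cvs.subspace_0[OF U] by auto
  next
    case (Suc m)
    define q where "q = int n + 1 - int (Suc m)"
    have "q + 1 = int n + 1 - int m" by (simp add: q_def)
    then have IH: "up s (q + 1) \<subseteq> U" using Suc by (simp only:)
    have "v \<in> U" if v: "v \<in> up s q" for v
    proof -
      have "e p *v (s q *v v) \<in> U" for p
      proof -
        obtain t where t: "t \<in> U" "t - e p *v (s q *v v) \<in> up s (q + 1)" using t[OF es_mem_J] by blast
        then have "t - (t - e p *v (s q *v v)) \<in> U" using IH by (blast intro: cvs.subspace_diff[OF U])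
        then show ?thesis by simp
      qed
      then have "(\<Sum>p = 0..int n. e p *v (s q *v v)) \<in> U" by (intro cvs.subspace_sum[OF U])
      then have 1: "s q *v v \<in> U" by (simp add: E.decomp)
      have "v - s q *v v \<in> up s (q + 1)"
        using v by (auto simp: up_def mat_vec_diff S.e_e_vec)
      then have "(v - s q *v v) + s q *v v \<in> U" using IH 1 by (intro cvs.subspace_add[OF U]) auto
      then show ?thesis by simp
    qed
    then show ?case by (auto simp: q_def)
  qed
  from this[of "n + 1"] have "up s 0 \<subseteq> U" by simp
  moreover have "up s 0 = UNIV" using S.support by (auto simp: up_def)
  ultimately show ?thesis by auto
qed

text \<open>The translate \<open>exp(N) (up e p)\<close> is complementary to \<open>up s (n - p + 1)\<close>: both together contain an element with every
  possible leading term, by \<open>mexp_N_leading_term\<close> if the \<open>s\<close>-degree is at most \<open>n - p\<close> and trivially otherwise.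
  So they span \<open>V\<close>, and their dimensions leave no room for an intersection.\<close>

lemma mexp_N_opposition:
  assumes dims: "dim (up e p) + dim (up s (int n - p + 1)) = dim (UNIV :: (complex^'n) set)"
    and f: "f \<in> up e p" "mexp N *v f \<in> up s (int n - p + 1)"
  shows "f = 0"
proof -
  let ?A = "(\<lambda>v. mexp N *v v) ` up e p" and ?B = "up s (int n - p + 1)"
  let ?S = "{x + y | x y. x \<in> ?A \<and> y \<in> ?B}"
  have cA: "cvs.subspace ?A"
    using E.csubspace_up[of p] unfolding cvs.subspace_def
    by (auto simp flip: matrix_vector_right_distrib mat_vec_scaleC intro!: image_eqI[of 0 _ 0])
  have cS: "cvs.subspace ?S" by (rule cvs.subspace_sums[OF cA S.csubspace_up])
  have "?S = UNIV"
  proof (rule leading_terms_span[OF cS])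
    fix p' q u assume u: "u \<in> J p' q"
    show "\<exists>t\<in>?S. t - u \<in> up s (q + 1)"
    proof (cases "q \<ge> int n - p + 1")
      case True
      then have "u \<in> ?B" using J_up_s[OF u] by auto
      then have "0 + u \<in> ?S" using cvs.subspace_0[OF cA] by blast
      then show ?thesis using cvs.subspace_0[OF S.csubspace_up] by (intro bexI[of _ "0 + u"]) auto
    next
      case False
      obtain f where f: "f \<in> up e (int n - q)" "mexp N *v f - u \<in> up s (q + 1)"
        using mexp_N_leading_term[OF u] by blast
      have "f \<in> up e p" using f(1) E.up_antimono[of p "int n - q"] False by auto
      then have "mexp N *v f + 0 \<in> ?S" using cvs.subspace_0[OF S.csubspace_up] by blast
      then show ?thesis using f(2) by (intro bexI[of _ "mexp N *v f + 0"]) auto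
    qed
  qed
  moreover have "dim ?A = dim (up e p)"
  proof (intro dim_image_eq[OF linear_mat_vec] inj_onI)
    fix x y assume "mexp N *v x = mexp N *v y"
    then have "mexp N *v (x - y) = 0" by (simp add: mat_vec_diff)
    then show "x = y" using mexp_inj by fastforce
  qed
  ultimately have "dim (?A \<inter> ?B) = 0"
    using dim_sums_Int[OF subspace_of_csubspace[OF cA] subspace_of_csubspace[OF S.csubspace_up[of "int n - p + 1"]]] dims
    by simp
  then have "?A \<inter> ?B \<subseteq> {0}" by (simp only: dim_eq_0)
  then have "mexp N *v f = 0" using f by blast
  then show ?thesis by (rule mexp_inj)
qed

end

section \<open>Powers of the bracket with N\<close>

lemma choose_sum_Suc:
  fixes f :: "nat \<Rightarrow> 'a::conj_space"
  shows "(\<Sum>i\<le>Suc m. of_nat (Suc m choose i) *\<^sub>C f i) = (\<Sum>i\<le>m. of_nat (m choose i) *\<^sub>C (f i + f (Suc i)))"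
proof -
  have "(\<Sum>i\<le>m. of_nat (m choose i) *\<^sub>C f i) = (\<Sum>i\<le>Suc m. of_nat (m choose i) *\<^sub>C f i)"
    by (simp add: binomial_eq_0)
  also have "\<dots> = f 0 + (\<Sum>i\<le>m. of_nat (m choose Suc i) *\<^sub>C f (Suc i))"
    by (simp add: sum.atMost_Suc_shift del: sum.atMost_Suc)
  finally have 1: "(\<Sum>i\<le>m. of_nat (m choose i) *\<^sub>C f i) = f 0 + (\<Sum>i\<le>m. of_nat (m choose Suc i) *\<^sub>C f (Suc i))" .
  have "(\<Sum>i\<le>Suc m. of_nat (Suc m choose i) *\<^sub>C f i) = f 0 + (\<Sum>i\<le>m. of_nat (Suc m choose Suc i) *\<^sub>C f (Suc i))"
    by (simp add: sum.atMost_Suc_shift del: sum.atMost_Suc binomial_Suc_Suc)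
  then show ?thesis
    by (simp add: scaleC_add_right scaleC_add_left sum.distrib 1 algebra_simps)
qed

text \<open>The binomial formula for left multiplication by \<open>N\<close>, the sum of the commuting operators \<open>ad N\<close> and right multiplication by \<open>N\<close>.\<close>

lemma mpow_mult_leibniz:
  "mpow N m ** X = (\<Sum>i\<le>m. of_nat (m choose i) *\<^sub>C ((lie_bracket N ^^ i) X ** mpow N (m - i)))"
proof (induction m)
  case (Suc m)
  let ?X = "\<lambda>i. (lie_bracket N ^^ i) X"
  have "mpow N (Suc m) ** X = N ** (mpow N m ** X)" by (simp add: mpow_Suc matrix_mul_assoc)
  also have "\<dots> = (\<Sum>i\<le>m. of_nat (m choose i) *\<^sub>C (N ** ?X i ** mpow N (m - i)))"
    by (simp add: Suc mat_mul_sum_right scaleC_mat_mul_right matrix_mul_assoc)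
  also have "\<dots> = (\<Sum>i\<le>m. of_nat (m choose i) *\<^sub>C (?X i ** mpow N (Suc m - i) + ?X (Suc i) ** mpow N (Suc m - Suc i)))"
  proof (intro sum.cong refl arg_cong[where f="\<lambda>v. _ *\<^sub>C v"])
    fix i assume "i \<in> {..m}"
    then have "Suc m - i = Suc (m - i)" by auto
    then show "N ** ?X i ** mpow N (m - i) = ?X i ** mpow N (Suc m - i) + ?X (Suc i) ** mpow N (Suc m - Suc i)"
      by (simp add: mpow_Suc lie_bracket_def mat_mul_diff matrix_mul_assoc)
  qed
  also have "\<dots> = (\<Sum>i\<le>Suc m. of_nat (Suc m choose i) *\<^sub>C (?X i ** mpow N (Suc m - i)))"
    by (rule choose_sum_Suc[symmetric])
  finally show ?case .
qed simp

lemma mexp_nilpotent: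
  assumes "mpow N K = 0" and "K \<le> M"
  shows "mexp N = (\<Sum>m<M. (1 / fact m) *\<^sub>C mpow N m)"
proof (rule mat_eqI)
  fix v
  have "mpow N M = mpow N (M - K) ** mpow N K" using assms(2) by (simp flip: mpow_add)
  then have "mpow N M *v v = 0" by (simp add: assms(1))
  from mexp_nilpotent_vec[OF this, of 1] show "mexp N *v v = (\<Sum>m<M. (1 / fact m) *\<^sub>C mpow N m) *v v"
    by (simp add: mat_vec_sum_left scaleC_mat_vec)
qed

text \<open>This is \<open>exp(N) X exp(-N) = exp(ad N) X\<close>, where the series on the right stops before \<open>w\<close>.\<close>

lemma mexp_mult_ad_nilpotent:
  assumes N: "mpow N K = 0" and X: "(lie_bracket N ^^ w) X = 0"
  shows "mexp N ** X = (\<Sum>i<w. (1 / fact i) *\<^sub>C (lie_bracket N ^^ i) X) ** mexp N"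
proof -
  define h where "h = (\<lambda>i j. (1 / (fact i * fact j)) *\<^sub>C ((lie_bracket N ^^ i) X ** mpow N j))"
  have "lie_bracket N 0 = 0" by (simp add: lie_bracket_def)
  then have "(lie_bracket N ^^ k) 0 = 0" for k by (induction k) auto
  moreover have "(lie_bracket N ^^ i) X = (lie_bracket N ^^ (i - w)) ((lie_bracket N ^^ w) X)" if "i \<ge> w" for i
    using that funpow_add[of "i - w" w "lie_bracket N"] by simp
  ultimately have zX: "(lie_bracket N ^^ i) X = 0" if "i \<ge> w" for i using that X by simp
  have zN: "mpow N j = 0" if "j \<ge> K" for j
    using that N mpow_add[of N "j - K" K] by simp
  let ?M = "w + K"
  have "mexp N ** X = (\<Sum>m<?M. (1 / fact m) *\<^sub>C (mpow N m ** X))"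
    by (simp add: mexp_nilpotent[OF N, of ?M] mat_mul_sum_left scaleC_mat_mul_left)
  also have "\<dots> = (\<Sum>m<?M. \<Sum>i\<le>m. h i (m - i))"
    by (intro sum.cong refl) (auto simp: mpow_mult_leibniz sum_scaleC scaleC_scaleC h_def binomial_fact intro!: sum.cong)
  also have "\<dots> = (\<Sum>(i, j)\<in>{(i, j). i + j < ?M}. h i j)"
    by (rule sum.triangle_reindex[symmetric])
  \<comment> \<open>Outside the rectangle one of the two factors is zero; the rectangle lies in the triangle.\<close>
  also have "\<dots> = (\<Sum>(i, j)\<in>{..<w} \<times> {..<K}. h i j)"
  proof (rule sum.mono_neutral_right)
    show "finite {(i, j). i + j < ?M}"
      by (rule finite_subset[of _ "{..<?M} \<times> {..<?M}"]) auto
    show "\<forall>x\<in>{(i, j). i + j < ?M} - {..<w} \<times> {..<K}. (case x of (i, j) \<Rightarrow> h i j) = 0"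
    proof
      fix x assume "x \<in> {(i, j). i + j < ?M} - {..<w} \<times> {..<K}"
      moreover obtain i j where x: "x = (i, j)" by fastforce
      ultimately have "i \<ge> w \<or> j \<ge> K" by auto
      then show "(case x of (i, j) \<Rightarrow> h i j) = 0" using zX zN x by (auto simp: h_def)
    qed
  qed auto
  also have "\<dots> = (\<Sum>i<w. \<Sum>j<K. h i j)" by (rule sum.cartesian_product[symmetric])
  also have "\<dots> = (\<Sum>i<w. \<Sum>j<K. ((1 / fact i) *\<^sub>C (lie_bracket N ^^ i) X) ** ((1 / fact j) *\<^sub>C mpow N j))"
    by (simp add: h_def scaleC_mat_mul_left scaleC_mat_mul_right scaleC_scaleC mult.commute)
  also have "\<dots> = (\<Sum>i<w. (1 / fact i) *\<^sub>C (lie_bracket N ^^ i) X) ** (\<Sum>j<K. (1 / fact j) *\<^sub>C mpow N j)"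
    unfolding mat_mul_sum_left[of "\<lambda>i. (1 / fact i) *\<^sub>C (lie_bracket N ^^ i) X"] by (simp only: mat_mul_sum_right)
  also have "\<dots> = (\<Sum>i<w. (1 / fact i) *\<^sub>C (lie_bracket N ^^ i) X) ** mexp N"
    by (simp only: mexp_nilpotent[OF N order_refl])
  finally show ?thesis .
qed

context lefschetz
begin

lemma N_nilpotent: "mpow N (n + 1) = 0"
proof (rule mat_eqI)
  fix v
  have "e p *v (mpow N (n + 1) *v v) = 0" for p
  proof (cases "p < 0")
    case True
    then show ?thesis by (simp add: E.support)
  next
    case False
    then have "e (p + int (n + 1)) = 0" by (intro E.support) auto
    then show ?thesis by (simp only: Npow_e_vec) simp
  qed
  then show "mpow N (n + 1) *v v = 0 *v v" using E.vec_eq_0I by simp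
qed

definition bidegree :: "int \<Rightarrow> int \<Rightarrow> complex^'n^'n \<Rightarrow> bool" where
  "bidegree a b X \<longleftrightarrow> (\<forall>p. X ** e p = e (p + a) ** X) \<and> (\<forall>q. X ** s q = s (q + b) ** X)"

lemma bidegree_bracket_N:
  assumes "bidegree a b X" shows "bidegree (a - 1) (b - 1) (lie_bracket N X)"
proof -
  have X: "X ** e p = e (p + a) ** X" "X ** s p = s (p + b) ** X" for p
    using assms by (auto simp: bidegree_def)
  have 1: "N ** X ** e p = e (p + (a - 1)) ** (N ** X)" "X ** N ** e p = e (p + (a - 1)) ** (X ** N)" for p
  proof -
    have "N ** X ** e p = N ** e (p + a) ** X" by (simp add: X(1) flip: matrix_mul_assoc)
    then show "N ** X ** e p = e (p + (a - 1)) ** (N ** X)" by (simp add: N_e matrix_mul_assoc add_diff_eq)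
    have "X ** N ** e p = X ** e (p - 1) ** N" by (simp add: N_e flip: matrix_mul_assoc)
    then show "X ** N ** e p = e (p + (a - 1)) ** (X ** N)" by (simp add: X(1) matrix_mul_assoc algebra_simps(1-4))
       (simp add: add_diff_eq diff_add_eq add.commute)
  qed
  have 2: "N ** X ** s p = s (p + (b - 1)) ** (N ** X)" "X ** N ** s p = s (p + (b - 1)) ** (X ** N)" for p
  proof -
    have "N ** X ** s p = N ** s (p + b) ** X" by (simp add: X(2) flip: matrix_mul_assoc)
    then show "N ** X ** s p = s (p + (b - 1)) ** (N ** X)" by (simp add: N_s matrix_mul_assoc add_diff_eq)
    have "X ** N ** s p = X ** s (p - 1) ** N" by (simp add: N_s flip: matrix_mul_assoc)
    then show "X ** N ** s p = s (p + (b - 1)) ** (X ** N)" by (simp add: X(2) matrix_mul_assoc algebra_simps(1-4))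
       (simp add: add_diff_eq diff_add_eq add.commute)
  qed
  show ?thesis
    unfolding bidegree_def lie_bracket_def by (simp add: mat_mul_diff 1 2)
qed

lemma bidegree_bracket_N_funpow:
  "bidegree a b X \<Longrightarrow> bidegree (a - int k) (b - int k) ((lie_bracket N ^^ k) X)"
proof (induction k)
  case (Suc k)
  then show ?case using bidegree_bracket_N[of "a - int k" "b - int k"] by (simp add: algebra_simps)
qed simp

lemma bidegree_up_e: "bidegree a b X \<Longrightarrow> v \<in> up e p \<Longrightarrow> X *v v \<in> up e (p + a)"
  and bidegree_up_s: "bidegree a b X \<Longrightarrow> v \<in> up s p \<Longrightarrow> X *v v \<in> up s (p + b)"
proof -
  assume X: "bidegree a b X"
  have "e r *v (X *v v) = X *v (e (r - a) *v v)" "s r *v (X *v v) = X *v (s (r - b) *v v)" for r v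
  proof -
    have "X ** e (r - a) = e (r - a + a) ** X" "X ** s (r - b) = s (r - b + b) ** X"
      using X unfolding bidegree_def by blast+
    then show "e r *v (X *v v) = X *v (e (r - a) *v v)" "s r *v (X *v v) = X *v (s (r - b) *v v)"
      by (simp_all add: matrix_vector_mul_assoc)
  qed
  then show "v \<in> up e p \<Longrightarrow> X *v v \<in> up e (p + a)" "v \<in> up s p \<Longrightarrow> X *v v \<in> up s (p + b)"
    by (auto simp: up_def)
qed

text \<open>The injectivity of \<open>ad(N)\<^bsup>a+b\<^esup>\<close> in weight \<open>a + b > 0\<close>, without reference to an \<open>sl\<^sub>2\<close>-triple.  If \<open>X\<close> is
  annihilated, then \<open>exp(N) X = Y exp(N)\<close> where \<open>Y\<close> involves only the brackets with \<open>i < a + b\<close> factors \<open>N\<close>, so \<open>Y\<close> lowers the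
  \<open>s\<close>-degree by at most \<open>a - 1\<close>.  For \<open>f\<close> as in \<open>mexp_N_leading_term\<close>, the vector \<open>X f\<close> has \<open>e\<close>-degree at least \<open>n - q + a\<close>, while
  \<open>exp(N) X f = Y exp(N) f\<close> has \<open>s\<close>-degree at least \<open>q - a + 1\<close>.  By \<open>mexp_N_opposition\<close>, \<open>X f = 0\<close>.  The vectors \<open>exp(N) f\<close> span \<open>V\<close>.\<close>

lemma bracket_N_power_inj:
  assumes dims: "\<And>p. dim (up e p) + dim (up s (int n - p + 1)) = dim (UNIV :: (complex^'n) set)"
    and X: "bidegree a b X" and ab: "a + b > 0" and z: "(lie_bracket N ^^ nat (a + b)) X = 0"
  shows "X = 0"
proof -
  define w where "w = nat (a + b)"
  define Y where "Y = (\<Sum>i<w. (1 / fact i) *\<^sub>C (lie_bracket N ^^ i) X)"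
  have c: "mexp N ** X = Y ** mexp N"
    unfolding Y_def using mexp_mult_ad_nilpotent[OF N_nilpotent, of w X] z by (simp add: w_def)
  have Y: "Y *v v \<in> up s (q - a + 1)" if v: "v \<in> up s q" for v q
    unfolding Y_def mat_vec_sum_left
  proof (rule cvs.subspace_sum[OF S.csubspace_up])
    fix i assume i: "i \<in> {..<w}"
    have "(lie_bracket N ^^ i) X *v v \<in> up s (q + (b - int i))"
      using bidegree_up_s[OF bidegree_bracket_N_funpow[OF X] v] .
    moreover have "q - a + 1 \<le> q + (b - int i)" using i by (simp add: w_def zless_nat_eq_int_zless)
    ultimately have "(lie_bracket N ^^ i) X *v v \<in> up s (q - a + 1)"
      using S.up_antimono by blast
    then show "((1 / fact i) *\<^sub>C (lie_bracket N ^^ i) X) *v v \<in> up s (q - a + 1)"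
      by (simp add: scaleC_mat_vec cvs.subspace_scale[OF S.csubspace_up])
  qed
  let ?U = "{mexp N *v f | f. X *v f = 0}"
  have U: "cvs.subspace ?U"
    unfolding cvs.subspace_def
  proof (intro conjI ballI allI)
    show "0 \<in> ?U" by (auto intro!: exI[of _ 0])
    fix x y assume "x \<in> ?U" "y \<in> ?U"
    then obtain f g where "x = mexp N *v f" "X *v f = 0" "y = mexp N *v g" "X *v g = 0" by blast
    then show "x + y \<in> ?U" by (auto simp: matrix_vector_right_distrib intro!: exI[of _ "f + g"])
  next
    fix k x assume "x \<in> ?U"
    then obtain f where "x = mexp N *v f" "X *v f = 0" by blast
    then show "k *\<^sub>C x \<in> ?U" by (auto simp: mat_vec_scaleC intro!: exI[of _ "k *\<^sub>C f"])
  qed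
  have "?U = UNIV"
  proof (rule leading_terms_span[OF U])
    fix p q u assume u: "u \<in> J p q"
    obtain f where f: "f \<in> up e (int n - q)" "mexp N *v f - u \<in> up s (q + 1)"
      using mexp_N_leading_term[OF u] by blast
    have "(mexp N *v f - u) + u \<in> up s q"
      using f(2) S.up_antimono[of q "q + 1"] J_up_s[OF u] by (intro cvs.subspace_add[OF S.csubspace_up]) auto
    then have "Y *v (mexp N *v f) \<in> up s (q - a + 1)" by (intro Y) simp
    then have "mexp N *v (X *v f) \<in> up s (int n - (int n - q + a) + 1)"
      using arg_cong[OF c, of "\<lambda>A. A *v f"] by (simp flip: matrix_vector_mul_assoc)
    moreover have "X *v f \<in> up e (int n - q + a)" by (rule bidegree_up_e[OF X f(1)])
    ultimately have "X *v f = 0" by (intro mexp_N_opposition[OF dims])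
    then show "\<exists>t\<in>?U. t - u \<in> up s (q + 1)" using f(2) by blast
  qed
  have "X *v v = 0" for v
  proof -
    obtain f where f: "mexp N *v v = mexp N *v f" "X *v f = 0" using \<open>?U = UNIV\<close> by blast
    then have "mexp N *v (v - f) = 0" by (simp add: mat_vec_diff)
    then have "v - f = 0" by (rule mexp_inj)
    then show ?thesis using f by simp
  qed
  then show ?thesis by (intro mat_eqI) simp
qed

end

section \<open>The reference Hodge structure\<close>

lemma (in grading) degree_component_commute:
  assumes "component n e a X = X" shows "X ** e p = e (p + a) ** X"
proof (rule block_eqI)
  fix q r
  have b: "e q ** X ** e r = 0" if "q \<noteq> r + a" for q r
    using component_block[of q a X r] that by (simp add: assms)
  have 1: "e q ** (X ** e p) ** e r = (if p = r then e q ** X ** e r else 0)"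
    by (simp add: orth flip: matrix_mul_assoc)
  have "e q ** (e (p + a) ** X) ** e r = (e q ** e (p + a)) ** X ** e r" by (simp only: matrix_mul_assoc)
  then have 2: "e q ** (e (p + a) ** X) ** e r = (if q = p + a then e q ** X ** e r else 0)"
    by (simp add: orth)
  show "e q ** (X ** e p) ** e r = e q ** (e (p + a) ** X) ** e r"
    unfolding 1 2 using b[of q r] by auto
qed

lemma (in grading) component_eq_of_commute:
  assumes "\<And>p. X ** e p = e (p + a) ** X" shows "component n e a X = X"
proof (rule block_eqI)
  fix q r
  have "e q ** X ** e r = e q ** (X ** e r)" by (simp only: matrix_mul_assoc)
  also have "\<dots> = (e q ** e (r + a)) ** X" by (simp only: assms matrix_mul_assoc)
  finally have "e q ** X ** e r = 0" if "q \<noteq> r + a" using that by (simp add: orth)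
  then show "e q ** component n e a X ** e r = e q ** X ** e r"
    by (auto simp: component_block)
qed

lemma Rats_subset_complex_Reals: "\<rat> \<subseteq> (\<real> :: complex set)"
proof
  fix x :: complex assume "x \<in> \<rat>"
  then obtain r where r: "x = of_rat r" by (elim Rats_cases)
  obtain a b where "r = Fract a b" "b > 0" by (cases r) auto
  then show "x \<in> \<real>" by (simp add: r of_rat_rat)
qed

locale mt_hodge =
  fixes n :: nat and F0 :: "int \<Rightarrow> (complex^'n) set"
  assumes F0_csubspace: "cvs.subspace (F0 p)" and F0_antimono: "p \<le> q \<Longrightarrow> F0 q \<subseteq> F0 p"
    and F0_low: "p \<le> 0 \<Longrightarrow> F0 p = UNIV" and F0_high: "p > int n \<Longrightarrow> F0 p = {0}"
    and F0_sum: "\<exists>b. v - b \<in> F0 p \<and> vconj b \<in> F0 (int n - p + 1)"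
    and F0_int: "v \<in> F0 p \<Longrightarrow> vconj v \<in> F0 (int n - p + 1) \<Longrightarrow> v = 0"
begin

lemma e0_exists: "\<exists>e. grading n e \<and> (\<forall>p. F0 p = up e p) \<and> (\<forall>p. vconj ` F0 (int n - p) = down e p)"
proof -
  obtain e where "grading n e" "\<And>p. F0 p = up e p" "\<And>p. vconj ` F0 (int n - p) = down e p"
  proof (rule grading_of_opposite_filtrations[of F0 "\<lambda>p. vconj ` F0 (int n - p)" n])
    show "vconj ` F0 (int n - p) \<subseteq> vconj ` F0 (int n - q)" if "p \<le> q" for p q
      using F0_antimono[of "int n - q" "int n - p"] that by auto
    show "v = 0" if "v \<in> F0 (p + 1)" "v \<in> vconj ` F0 (int n - p)" for p v
      using that by (intro F0_int[of v "p + 1"]) (auto simp: vconj_vconj)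
    show "\<exists>s\<in>vconj ` F0 (int n - p). v - s \<in> F0 (p + 1)" for p v
    proof -
      obtain b where b: "v - b \<in> F0 (p + 1)" "vconj b \<in> F0 (int n - (p + 1) + 1)"
        using F0_sum[of v "p + 1"] by blast
      then have "b \<in> vconj ` F0 (int n - p)" by (simp add: vconj_image_iff)
      then show ?thesis using b by blast
    qed
    show "cvs.subspace (vconj ` F0 (int n - p))" for p by (rule csubspace_vconj[OF F0_csubspace])
  qed (use F0_csubspace F0_antimono F0_low F0_high in auto)
  then show ?thesis by blast
qed

definition e0 :: "int \<Rightarrow> complex^'n^'n" where
  "e0 = (SOME e. grading n e \<and> (\<forall>p. F0 p = up e p) \<and> (\<forall>p. vconj ` F0 (int n - p) = down e p))"

lemma grading_e0: "grading n e0"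
  and F0_iff: "v \<in> F0 p \<longleftrightarrow> (\<forall>r<p. e0 r *v v = 0)"
  and F0_conj_iff: "vconj v \<in> F0 (int n - p) \<longleftrightarrow> (\<forall>r>p. e0 r *v v = 0)"
proof -
  have *: "grading n e0 \<and> (\<forall>p. F0 p = up e0 p) \<and> (\<forall>p. vconj ` F0 (int n - p) = down e0 p)"
    unfolding e0_def by (rule someI_ex[OF e0_exists])
  then show "grading n e0" by blast
  have "F0 p = up e0 p" using * by blast
  then show "v \<in> F0 p \<longleftrightarrow> (\<forall>r<p. e0 r *v v = 0)" by (simp add: up_def)
  have "vconj ` F0 (int n - p) = down e0 p" using * by blast
  then show "vconj v \<in> F0 (int n - p) \<longleftrightarrow> (\<forall>r>p. e0 r *v v = 0)"
    by (auto simp: down_def simp flip: vconj_image_iff)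
qed

sublocale g0: grading n e0 by (rule grading_e0)

lemma vconj_e0: "vconj (e0 p) = e0 (int n - p)"
proof -
  have z: "e0 r *v (vconj (e0 p) *v v) = 0" if "r \<noteq> int n - p" for r p v
  proof -
    let ?u = "e0 p *v vconj v"
    have w: "vconj (e0 p) *v v = vconj ?u" by (simp add: vconj_mat_vec vconj_vconj)
    have "?u \<in> F0 p" by (auto simp: F0_iff g0.e_e_vec)
    then have "vconj (vconj ?u) \<in> F0 (int n - (int n - p))" by (simp add: vconj_vconj)
    then have 1: "\<forall>r>int n - p. e0 r *v vconj ?u = 0" unfolding F0_conj_iff .
    have "vconj ?u \<in> F0 (int n - p)"
      by (rule F0_conj_iff[THEN iffD2]) (simp add: g0.e_e_vec)
    then have 2: "\<forall>r<int n - p. e0 r *v vconj ?u = 0" by (simp add: F0_iff)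
    show ?thesis using 1 2 that by (cases "r < int n - p") (auto simp: w)
  qed
  have a: "e0 r ** vconj (e0 p) = 0" if "r \<noteq> int n - p" for r p
    using z[OF that] by (intro mat_eqI) (simp flip: matrix_vector_mul_assoc)
  have cg: "(\<Sum>r = 0..int n. vconj (e0 r)) = mat 1"
    by (simp add: g0.total vconj_mat_1 flip: vconj_sum)
  show ?thesis
  proof (cases "p \<in> {0..int n}")
    case True
    have "vconj (e0 p) = (\<Sum>r = 0..int n. e0 r ** vconj (e0 p))"
      by (simp add: g0.total flip: mat_mul_sum_left)
    also have "\<dots> = (\<Sum>r = 0..int n. if r = int n - p then e0 r ** vconj (e0 p) else 0)"
      using a by (intro sum.cong) auto
    also have "\<dots> = e0 (int n - p) ** vconj (e0 p)" using True by (simp add: sum.delta)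
    finally have 1: "vconj (e0 p) = e0 (int n - p) ** vconj (e0 p)" .
    have "e0 (int n - p) = (\<Sum>r = 0..int n. e0 (int n - p) ** vconj (e0 r))"
      by (simp add: cg flip: mat_mul_sum_right)
    also have "\<dots> = (\<Sum>r = 0..int n. if r = p then e0 (int n - p) ** vconj (e0 r) else 0)"
      using a by (intro sum.cong) auto
    also have "\<dots> = e0 (int n - p) ** vconj (e0 p)" using True by (simp add: sum.delta)
    finally show ?thesis using 1 by simp
  next
    case False
    then have "p < 0 \<or> p > int n" by auto
    then have "e0 p = 0" "e0 (int n - p) = 0" by (auto intro: g0.support)
    then show ?thesis by simp
  qed
qed

text \<open>The infinitesimal generator of the circle representation: multiplication by \<open>p - q = 2p - n\<close> on \<open>V\<^bsup>p,q\<^esup>\<close>.\<close>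

definition H0 :: "complex^'n^'n" where
  "H0 = 2 *\<^sub>C g0.degree_op - of_nat n *\<^sub>C mat 1"

lemma H0_e0: "H0 *v (e0 p *v v) = of_int (2 * p - int n) *\<^sub>C (e0 p *v v)"
  by (simp add: H0_def mat_vec_diff scaleC_mat_vec g0.degree_op_e_vec scaleC_scaleC flip: cvs.scale_left_diff_distrib)

text \<open>The operator described by \<open>circle_rep\<close> is unique because the pieces of the Hodge decomposition span \<open>V\<close>, and \<open>exp(\<i> t H0)\<close> has the right eigenvalues.\<close>

lemma circle_rep_eq: "circle_rep n F0 (cis t) = mexp (t *\<^sub>R (\<i> *\<^sub>C H0))"
  unfolding circle_rep_def
proof (rule the_equality)
  have M: "mexp (t *\<^sub>R (\<i> *\<^sub>C H0)) *v (e0 p *v v) = (cis t powi (2 * p - int n)) *\<^sub>C (e0 p *v v)" for p v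
  proof -
    have "mexp ((of_real t * \<i>) *\<^sub>C H0) *v (e0 p *v v) = exp (of_real t * \<i> * of_int (2 * p - int n)) *\<^sub>C (e0 p *v v)"
      by (rule mexp_eigenvector[OF H0_e0])
    moreover have "exp (of_real t * \<i> * of_int (2 * p - int n)) = cis t powi (2 * p - int n)"
      by (simp only: cis_power_int) (simp add: cis_conv_exp mult_ac)
    ultimately show ?thesis by (simp add: scaleR_eq_scaleC scaleC_scaleC)
  qed
  have hp: "e0 p *v v = v" if "v \<in> hodge_piece F0 p q" "p + q = int n" for p q v
  proof -
    have q: "q = int n - p" using that by simp
    have "v \<in> F0 p" "vconj v \<in> F0 (int n - p)" using that(1) by (auto simp: hodge_piece_def vconj_vconj q)
    then have "\<forall>r<p. e0 r *v v = 0" "\<forall>r>p. e0 r *v v = 0"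
      by - (rule F0_iff[THEN iffD1], assumption, rule F0_conj_iff[THEN iffD1], assumption)
    then have z: "e0 r *v v = 0" if "r \<noteq> p" for r using that by (cases "r < p") auto
    show ?thesis
    proof (rule g0.vec_eqI)
      fix i show "e0 i *v (e0 p *v v) = e0 i *v v" by (cases "i = p") (simp_all add: g0.e_e_vec z)
    qed
  qed
  show "\<forall>p q. p + q = int n \<longrightarrow> (\<forall>v\<in>hodge_piece F0 p q. mexp (t *\<^sub>R (\<i> *\<^sub>C H0)) *v v = cis t powi (p - q) *\<^sub>C v)"
  proof (intro allI impI ballI)
    fix p q v assume pq: "p + q = int n" and v: "v \<in> hodge_piece F0 p q"
    have q: "p - q = 2 * p - int n" using pq by simp
    show "mexp (t *\<^sub>R (\<i> *\<^sub>C H0)) *v v = cis t powi (p - q) *\<^sub>C v"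
      using M[of p v] unfolding hp[OF v pq] q .
  qed
  fix A assume A: "\<forall>p q. p + q = int n \<longrightarrow> (\<forall>v\<in>hodge_piece F0 p q. A *v v = cis t powi (p - q) *\<^sub>C v)"
  show "A = mexp (t *\<^sub>R (\<i> *\<^sub>C H0))"
  proof (rule mat_eqI)
    fix v
    have "A *v (e0 p *v v) = mexp (t *\<^sub>R (\<i> *\<^sub>C H0)) *v (e0 p *v v)" for p
    proof -
      have "e0 p *v v \<in> F0 p" by (simp add: F0_iff g0.e_e_vec)
      moreover have "vconj (e0 p *v v) \<in> F0 (int n - p)"
        by (rule F0_conj_iff[THEN iffD2]) (simp add: g0.e_e_vec)
      ultimately have "e0 p *v v \<in> hodge_piece F0 p (int n - p)"
        by (simp add: hodge_piece_def vconj_image_iff)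
      then have "A *v (e0 p *v v) = cis t powi (p - (int n - p)) *\<^sub>C (e0 p *v v)"
        by (intro A[rule_format]) simp
      also have "p - (int n - p) = 2 * p - int n" by simp
      finally show ?thesis unfolding M .
    qed
    then have "(\<Sum>p = 0..int n. A *v (e0 p *v v)) = (\<Sum>p = 0..int n. mexp (t *\<^sub>R (\<i> *\<^sub>C H0)) *v (e0 p *v v))"
      by (intro sum.cong) auto
    then show "A *v v = mexp (t *\<^sub>R (\<i> *\<^sub>C H0)) *v v" by (simp add: g0.decomp flip: mat_vec_sum_right)
  qed
qed

lemma GC_rational: "algebraic_subgroup \<rat> (GC n F0)"
proof (rule GC_algebraic)
  fix z :: complex assume "cmod z = 1"
  then have "z = cis (Arg z)" using rcis_cmod_Arg[of z] by (simp add: rcis_def)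
  then show "invertible (circle_rep n F0 z)" using circle_rep_eq[of "Arg z"] invertible_mexp by simp
qed

sublocale mt_group n F0
  by unfold_locales (rule algebraic_subgroup_mono[OF Rats_subset_complex_Reals GC_rational])

lemma H0_mem: "H0 \<in> gC n F0"
proof -
  have "\<i> *\<^sub>C H0 \<in> gC n F0"
    unfolding lie_algebra_def
  proof (intro CollectI allI)
    fix t :: real
    have "circle_rep n F0 (cis t) \<in> GC n F0" unfolding GC_def by auto
    then show "mexp (t *\<^sub>R (\<i> *\<^sub>C H0)) \<in> GC n F0" by (simp only: circle_rep_eq)
  qed
  then have "(- \<i>) *\<^sub>C (\<i> *\<^sub>C H0) \<in> gC n F0" by (rule cvs.subspace_scale[OF gC_csubspace])
  then show ?thesis by (simp add: scaleC_scaleC del: cvs.scale_minus_left)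
qed

text \<open>The mean of the degrees \<open>p\<close> and \<open>q\<close> for \<open>p + q = n\<close>.  Only after subtracting this scalar does the degree operator of the
  Hodge structure become half of \<open>H0\<close> and thus an element of \<open>\<gg>\<close>.\<close>

definition half_weight :: "complex^'n^'n" where "half_weight = (of_nat n / 2) *\<^sub>C mat 1"

lemma half_weight_commute: "half_weight ** X = X ** half_weight"
  by (simp add: half_weight_def scaleC_mat_mul_left scaleC_mat_mul_right)

lemma degree_op_mem: "g0.degree_op - half_weight \<in> gC n F0"
proof -
  have "(1/2) *\<^sub>C H0 \<in> gC n F0" by (rule cvs.subspace_scale[OF gC_csubspace H0_mem])
  then show ?thesis by (simp add: H0_def half_weight_def scaleC_scaleC cvs.scale_right_diff_distrib)
qed

lemma ad_shift_mem:
  assumes "Y - half_weight \<in> gC n F0" "X \<in> gC n F0" shows "Y ** X - X ** Y \<in> gC n F0"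
proof -
  have "lie_bracket (Y - half_weight) X = Y ** X - X ** Y"
    by (simp add: lie_bracket_def mat_mul_diff half_weight_commute)
  then show ?thesis using gC_bracket[OF assms] by simp
qed

lemma component_e0_mem: "X \<in> gC n F0 \<Longrightarrow> component n e0 a X \<in> gC n F0"
  by (rule g0.component_mem_of_ad_stable[OF gC_csubspace ad_shift_mem[OF degree_op_mem]])

lemma adjoint_F0_iff: "X \<in> adjoint_F n F0 F0 a \<longleftrightarrow> X \<in> gC n F0 \<and> (\<forall>p q. q < p + a \<longrightarrow> e0 q ** X ** e0 p = 0)"
proof -
  have "(\<forall>p. \<forall>v\<in>F0 p. X *v v \<in> F0 (p + a)) \<longleftrightarrow> (\<forall>p. \<forall>v\<in>up e0 p. X *v v \<in> up e0 (p + a))"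
    unfolding Ball_def by (simp add: F0_iff up_def)
  then show ?thesis by (simp only: adjoint_F_iff g0.raises_up_iff)
qed

text \<open>The Hodge structure on \<open>\<gg>\<close> has weight \<open>0\<close>: the filtration \<open>F\<^bsup>a+1\<^esup>\<close> on \<open>\<gg>\<close> is complementary to the conjugate of \<open>F\<^bsup>-a\<^esup>\<close>.\<close>

lemma dim_adjoint_F0:
  "dim (adjoint_F n F0 F0 (a + 1)) + dim (adjoint_F n F0 F0 (- a)) = dim (gC n F0)"
proof -
  let ?A = "adjoint_F n F0 F0 (a + 1)" and ?B = "vconj ` adjoint_F n F0 F0 (- a)"
  have cb: "e0 q ** vconj X ** e0 p = vconj (e0 (int n - q) ** X ** e0 (int n - p))" for q p X
    by (simp add: vconj_mat_mul vconj_e0)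
  have B: "X \<in> ?B \<longleftrightarrow> X \<in> gC n F0 \<and> (\<forall>p q. q > p + a \<longrightarrow> e0 q ** X ** e0 p = 0)" for X
  proof -
    have "(\<forall>p q. q < p + - a \<longrightarrow> e0 q ** vconj X ** e0 p = 0) \<longleftrightarrow> (\<forall>p q. q > p + a \<longrightarrow> e0 q ** X ** e0 p = 0)"
    proof (intro iffI allI impI)
      fix p q assume a1: "\<forall>p q. q < p + - a \<longrightarrow> e0 q ** vconj X ** e0 p = 0" and q: "q > p + a"
      have "e0 (int n - q) ** vconj X ** e0 (int n - p) = 0" using a1 q by simp
      then have "vconj (e0 q ** X ** e0 p) = 0" by (simp add: cb)
      then show "e0 q ** X ** e0 p = 0" by (metis vconj_vconj vconj_zero)
    next
      fix p q assume a1: "\<forall>p q. q > p + a \<longrightarrow> e0 q ** X ** e0 p = 0" and q: "q < p + - a"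
      have "e0 (int n - q) ** X ** e0 (int n - p) = 0" using a1 q by simp
      then show "e0 q ** vconj X ** e0 p = 0" by (simp add: cb)
    qed
    moreover have "vconj X \<in> gC n F0 \<longleftrightarrow> X \<in> gC n F0" using gC_vconj[of X] gC_vconj[of "vconj X"] by (auto simp: vconj_vconj)
    ultimately show ?thesis by (simp only: vconj_image_iff adjoint_F0_iff)
  qed
  have "{x + y | x y. x \<in> ?A \<and> y \<in> ?B} = gC n F0"
  proof (intro set_eqI iffI)
    fix X assume "X \<in> {x + y | x y. x \<in> ?A \<and> y \<in> ?B}"
    then show "X \<in> gC n F0" using B by (auto simp: adjoint_F0_iff intro: cvs.subspace_add[OF gC_csubspace])
  next
    fix X assume X: "X \<in> gC n F0"
    let ?K = "{- int n..int n}"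
    let ?x = "\<Sum>b\<in>{b\<in>?K. b > a}. component n e0 b X" and ?y = "\<Sum>b\<in>{b\<in>?K. \<not> b > a}. component n e0 b X"
    have "X = ?x + ?y"
      by (subst g0.component_sum[of X, symmetric], subst sum.union_disjoint[symmetric])
         (auto intro!: sum.cong finite_subset[of _ ?K])
    moreover have "?x \<in> ?A"
      unfolding adjoint_F0_iff mat_mul_sum_right mat_mul_sum_left g0.component_block
      by (auto intro!: cvs.subspace_sum[OF gC_csubspace] component_e0_mem X sum.neutral)
    moreover have "?y \<in> ?B"
      unfolding B mat_mul_sum_right mat_mul_sum_left g0.component_block
      by (auto intro!: cvs.subspace_sum[OF gC_csubspace] component_e0_mem X sum.neutral)
    ultimately show "X \<in> {x + y | x y. x \<in> ?A \<and> y \<in> ?B}" by blast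
  qed
  moreover have "?A \<inter> ?B \<subseteq> {0}"
  proof
    fix X assume X: "X \<in> ?A \<inter> ?B"
    have "e0 q ** X ** e0 p = e0 q ** 0 ** e0 p" for q p
      using X B[of X] by (cases "q > p + a") (auto simp: adjoint_F0_iff)
    then have "X = 0" by (rule g0.block_eqI)
    then show "X \<in> {0}" by simp
  qed
  then have "dim (?A \<inter> ?B) = 0" by (simp only: dim_eq_0)
  moreover have "subspace ?A" "subspace ?B"
    using csubspace_adjoint_F[of F0, OF F0_csubspace] by (auto intro: subspace_of_csubspace csubspace_vconj)
  ultimately show ?thesis
    using dim_sums_Int[of ?A ?B] by (simp add: dim_vconj_image del: dim_eq_0)
qed

lemma dim_adjoint_F:
  assumes "x \<in> compact_dual n F0"
  shows "dim (adjoint_F n F0 x a) = dim (adjoint_F n F0 F0 a)"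
  using assms dim_Ad_image by (auto simp: compact_dual_def adjoint_F_act)

lemma dim_F0_sym: "dim (F0 (p + 1)) + dim (F0 (int n - p)) = dim (UNIV :: (complex^'n) set)"
proof -
  have 1: "F0 (p + 1) = up e0 (p + 1)" by (auto simp: F0_iff up_def)
  have "vconj ` F0 (int n - p) = down e0 p" by (rule set_eqI) (simp only: vconj_image_iff F0_conj_iff down_def mem_Collect_eq)
  then have "dim (F0 (int n - p)) = dim (down e0 p)" by (metis dim_vconj_image)
  then show ?thesis using g0.dim_up_down[of p] 1 by simp
qed

lemma dim_compact_dual:
  assumes "x \<in> compact_dual n F0"
  shows "dim (x p) = dim (F0 p)"
proof -
  obtain g where g: "g \<in> GC n F0" "x = act g F0" using assms by (auto simp: compact_dual_def)
  have "inj_on (\<lambda>v. g *v v) (span (F0 p))"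
  proof (rule inj_on_inverseI[where g="\<lambda>v. matrix_inv g *v v"])
    show "matrix_inv g *v (g *v v) = v" for v
      by (simp add: matrix_vector_mul_assoc GC_inverse[OF g(1)])
  qed
  then show ?thesis by (simp add: g(2) act_def dim_image_eq[OF linear_mat_vec])
qed

lemma compact_dual_csubspace: "x \<in> compact_dual n F0 \<Longrightarrow> cvs.subspace (x p)"
  by (rule csubspace_compact_dual[OF F0_csubspace])

end

section \<open>Limits of flags\<close>

text \<open>Points of the flag variety are recorded by their orthogonal projections.  The projection of \<open>u\<close> to the subspaces \<open>f z p\<close>
  converges to its projection to \<open>L p\<close>; it also converges to \<open>u\<close>, being at least as close to \<open>u\<close> as \<open>w z\<close>.\<close>

lemma limit_in_flag:
  assumes lim: "limitin (subtopology flag_topology X) f L Fl" and nb: "Fl \<noteq> bot"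
    and L: "closed (L p)" "L p \<noteq> {}"
    and f: "\<forall>\<^sub>F z in Fl. w z \<in> f z p \<and> closed (f z p)" and w: "(w \<longlongrightarrow> u) Fl"
  shows "u \<in> L p"
proof -
  have "limitin flag_topology f L Fl" using lim by (simp add: limitin_subtopology)
  then have ev: "\<forall>\<^sub>F z in Fl. f z \<in> U" if "openin flag_topology U" "L \<in> U" for U
    using that by (simp add: limitin_def)
  have "((\<lambda>z. closest_point (f z p) u) \<longlongrightarrow> closest_point (L p) u) Fl"
  proof (rule topological_tendstoI)
    fix S assume S: "open S" "closest_point (L p) u \<in> S"
    let ?U = "{F. closest_point (F p) u \<in> S}"
    have "open ((\<lambda>h::int \<times> (complex^'a) \<Rightarrow> complex^'a. h (p, u)) -` S)"
      using S(1) continuous_on_product_coordinates by (rule open_vimage)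
    then have o: "openin euclidean ((\<lambda>h::int \<times> (complex^'a) \<Rightarrow> complex^'a. h (p, u)) -` S)"
      by (rule open_openin[THEN iffD1])
    have "?U = flag_coord -` ((\<lambda>h. h (p, u)) -` S) \<inter> UNIV"
      by (auto simp: flag_coord_def)
    then have "openin flag_topology ?U"
      unfolding flag_topology_def openin_pullback_topology using o by blast
    from ev[OF this] S(2) show "\<forall>\<^sub>F z in Fl. closest_point (f z p) u \<in> S" by simp
  qed
  moreover have "((\<lambda>z. closest_point (f z p) u) \<longlongrightarrow> u) Fl"
    unfolding tendsto_dist_iff[of _ u]
  proof (rule tendsto_sandwich[of "\<lambda>_. 0"])
    show "\<forall>\<^sub>F z in Fl. dist (closest_point (f z p) u) u \<le> dist (w z) u"
      using f by eventually_elim (metis closest_point_le dist_commute)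
    show "((\<lambda>z. dist (w z) u) \<longlongrightarrow> 0) Fl" using w by (simp add: tendsto_dist_iff[of w])
  qed auto
  ultimately have "closest_point (L p) u = u" using tendsto_unique[OF nb] by blast
  then show ?thesis using closest_point_in_set[OF L, of u] by simp
qed

lemma filtercomap_Im_le_at_infinity: "filtercomap Im at_top \<le> at_infinity"
  unfolding le_filter_def
proof (intro allI impI)
  fix P :: "complex \<Rightarrow> bool" assume "eventually P at_infinity"
  then obtain b where b: "\<And>x. norm x \<ge> b \<Longrightarrow> P x" by (auto simp: eventually_at_infinity)
  have "eventually (\<lambda>z. Im z \<ge> b) (filtercomap Im at_top)"
    by (rule eventually_filtercomapI[OF eventually_ge_at_top])
  then show "eventually P (filtercomap Im at_top)"
    by eventually_elim (meson abs_Im_le_cmod abs_ge_self b order_trans)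
qed

lemma filtercomap_Im_neq_bot: "filtercomap Im at_top \<noteq> bot"
  by (rule filtercomap_neq_bot_surj) (auto intro!: surjI[of _ "\<lambda>y. Complex 0 y"])

section \<open>The bigrading of the Lie algebra\<close>

locale period_limit = mt_hodge n F0 + limit_mhs_data n F Wc N
  for n and F0 F Wc :: "int \<Rightarrow> (complex^'n) set" and N +
  fixes Finf :: "int \<Rightarrow> (complex^'n) set"
  assumes F_dual: "F \<in> compact_dual n F0" and Finf_dual: "Finf \<in> compact_dual n F0"
    and N_gC: "N \<in> gC n F0"
    and lim: "limitin (subtopology flag_topology (compact_dual n F0))
       (\<lambda>z. act (mexp (z *\<^sub>C N)) F) Finf (filtercomap Im at_top)"
begin

lemma Finf_csubspace: "cvs.subspace (Finf p)"
  by (rule compact_dual_csubspace[OF Finf_dual])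

lemma Finf_antimono: "p \<le> q \<Longrightarrow> Finf q \<subseteq> Finf p"
  using Finf_dual F0_antimono[of p q] by (auto simp: compact_dual_def act_def)

lemma J_le_Finf: "J p q \<subseteq> Finf (int n - q)"
proof
  fix u assume u: "u \<in> J p q"
  obtain w where w: "\<And>z. z \<noteq> 0 \<Longrightarrow> w z \<in> (\<lambda>v. mexp (z *\<^sub>C N) *v v) ` up eF (int n - q)" "(w \<longlongrightarrow> u) at_infinity"
    using limit_vectors[OF u] by blast
  have F: "F (int n - q) = up eF (int n - q)" by (auto simp: F_iff up_def)
  show "u \<in> Finf (int n - q)"
  proof (rule limit_in_flag[where w=w, OF lim filtercomap_Im_neq_bot])
    show "closed (Finf (int n - q))"
      by (rule closed_subspace[OF subspace_of_csubspace[OF Finf_csubspace]])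
    show "Finf (int n - q) \<noteq> {}" using cvs.subspace_0[OF Finf_csubspace] by blast
    show "(w \<longlongrightarrow> u) (filtercomap Im at_top)"
      by (rule tendsto_mono[OF filtercomap_Im_le_at_infinity w(2)])
    have "eventually (\<lambda>z. Im z \<ge> 1) (filtercomap Im at_top)"
      by (rule eventually_filtercomapI[OF eventually_ge_at_top])
    then show "\<forall>\<^sub>F z in filtercomap Im at_top. w z \<in> act (mexp (z *\<^sub>C N)) F (int n - q)
        \<and> closed (act (mexp (z *\<^sub>C N)) F (int n - q))"
    proof eventually_elim
      case (elim z)
      then have "z \<noteq> 0" by auto
      then have "w z \<in> act (mexp (z *\<^sub>C N)) F (int n - q)" using w(1) by (simp add: act_def F)
      moreover have "closed (act (mexp (z *\<^sub>C N)) F (int n - q))"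
        by (rule closed_subspace[OF subspace_of_csubspace[OF csubspace_act[of F, OF F_csubspace]]])
      ultimately show ?case by blast
    qed
  qed
qed

text \<open>The inclusion of \<open>Phi q\<close> is \<open>J_le_Finf\<close>; equality follows by comparing dimensions, which on the compact dual are those of
  the Hodge structure \<open>F0\<close>.\<close>

lemma Phi_eq_Finf: "Phi q = Finf (int n - q)"
proof (rule subspace_dim_equal)
  show "subspace (Phi q)" "subspace (Finf (int n - q))"
    by (rule subspace_of_csubspace[OF csubspace_Phi], rule subspace_of_csubspace[OF Finf_csubspace])
  show "Phi q \<subseteq> Finf (int n - q)"
  proof
    fix v assume v: "v \<in> Phi q"
    show "v \<in> Finf (int n - q)"
    proof (rule mem_of_J_mem[OF Finf_csubspace])
      fix p r
      show "eF p *v (eS r *v v) \<in> Finf (int n - q)"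
      proof (cases "r > q")
        case True
        moreover have "v \<in> down eS q" using v by (simp only: Phi_eq)
        ultimately have "eS r *v v = 0" by (simp add: down_def)
        then show ?thesis using cvs.subspace_0[OF Finf_csubspace] by simp
      next
        case False
        then have "Finf (int n - r) \<subseteq> Finf (int n - q)" by (intro Finf_antimono) simp
        then show ?thesis using J_le_Finf[of p r] es_mem_J[of p r v] by blast
      qed
    qed
  qed
  have "dim (Phi q) = dim (Psi q)" unfolding Phi_def by (rule dim_vconj_image)
  moreover have "Psi q = down eF q" "F (q + 1) = up eF (q + 1)" by (auto simp: Psi_iff F_iff down_def up_def)
  then have "dim (F (q + 1)) + dim (Psi q) = dim (UNIV :: (complex^'n) set)"
    using gF.dim_up_down[of q] by simp
  ultimately show "dim (Finf (int n - q)) \<le> dim (Phi q)"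
    using dim_F0_sym[of q] dim_compact_dual[OF F_dual] dim_compact_dual[OF Finf_dual] by simp
qed

lemma dims_opposite: "dim (up eF p) + dim (up eS (int n - p + 1)) = dim (UNIV :: (complex^'n) set)"
proof -
  have "F p = up eF p" by (auto simp: F_iff up_def)
  then have "dim (up eF p) = dim (F0 p)" using dim_compact_dual[OF F_dual, of p] by simp
  moreover have "dim (down eS (int n - p)) = dim (F0 p)"
    using Phi_eq_Finf[of "int n - p"] dim_compact_dual[OF Finf_dual, of p] by (simp add: Phi_eq)
  ultimately show ?thesis using gS.dim_up_down[of "int n - p"] by simp
qed

lemma adjoint_F_F_iff: "X \<in> adjoint_F n F0 F a \<longleftrightarrow> X \<in> gC n F0 \<and> (\<forall>p q. q < p + a \<longrightarrow> eF q ** X ** eF p = 0)"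
proof -
  have "(\<forall>p. \<forall>v\<in>F p. X *v v \<in> F (p + a)) \<longleftrightarrow> (\<forall>p. \<forall>v\<in>up eF p. X *v v \<in> up eF (p + a))"
    unfolding Ball_def by (simp add: F_iff up_def)
  then show ?thesis by (simp only: adjoint_F_iff gF.raises_up_iff)
qed

lemma Finf_shift: "(\<forall>p. \<forall>v\<in>Finf p. X *v v \<in> Finf (p - a)) \<longleftrightarrow> (\<forall>q. \<forall>v\<in>Phi q. X *v v \<in> Phi (q + a))"
proof (intro iffI allI ballI)
  fix q v assume a: "\<forall>p. \<forall>v\<in>Finf p. X *v v \<in> Finf (p - a)" and v: "v \<in> Phi q"
  then have "X *v v \<in> Finf (int n - q - a)" by (simp add: Phi_eq_Finf)
  then show "X *v v \<in> Phi (q + a)" by (simp add: Phi_eq_Finf diff_diff_eq)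
next
  fix p v assume a: "\<forall>q. \<forall>v\<in>Phi q. X *v v \<in> Phi (q + a)" and v: "v \<in> Finf p"
  then have "v \<in> Phi (int n - p)" by (simp add: Phi_eq_Finf)
  then have "X *v v \<in> Phi (int n - p + a)" using a by blast
  then show "X *v v \<in> Finf (p - a)" by (simp add: Phi_eq_Finf)
qed

lemma adjoint_F_Finf_iff:
  "X \<in> adjoint_F n F0 Finf (- a) \<longleftrightarrow> X \<in> gC n F0 \<and> (\<forall>p q. q > p + a \<longrightarrow> eS q ** X ** eS p = 0)"
proof -
  have "(\<forall>q. \<forall>v\<in>Phi q. X *v v \<in> Phi (q + a)) \<longleftrightarrow> (\<forall>q. \<forall>v\<in>down eS q. X *v v \<in> down eS (q + a))"
    unfolding Ball_def by (simp add: Phi_eq)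
  then show ?thesis
    using Finf_shift[of X a] by (simp add: adjoint_F_iff gS.raises_down_iff)
qed

lemma vconj_adjoint_F_Finf_iff:
  "vconj X \<in> adjoint_F n F0 Finf (- a) \<longleftrightarrow> X \<in> gC n F0 \<and> (\<forall>p q. q > p + a \<longrightarrow> eF q ** X ** eF p = 0)"
proof -
  have "(\<forall>q. \<forall>v\<in>Phi q. vconj X *v v \<in> Phi (q + a)) \<longleftrightarrow> (\<forall>q. \<forall>v\<in>down eF q. X *v v \<in> down eF (q + a))"
  proof (intro iffI allI ballI)
    fix q v assume a: "\<forall>q. \<forall>v\<in>Phi q. vconj X *v v \<in> Phi (q + a)" and v: "v \<in> down eF q"
    have "vconj v \<in> Phi q" using v by (simp add: Phi_iff vconj_vconj Psi_iff down_def)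
    then have "vconj X *v vconj v \<in> Phi (q + a)" using a by blast
    then show "X *v v \<in> down eF (q + a)"
      by (simp add: Phi_iff vconj_mat_vec vconj_vconj Psi_iff down_def)
  next
    fix q v assume a: "\<forall>q. \<forall>v\<in>down eF q. X *v v \<in> down eF (q + a)" and v: "v \<in> Phi q"
    have "vconj v \<in> down eF q" using v by (simp add: Phi_iff Psi_iff down_def)
    then have "X *v vconj v \<in> down eF (q + a)" using a by blast
    then show "vconj X *v v \<in> Phi (q + a)"
      by (simp add: Phi_iff vconj_mat_vec vconj_vconj Psi_iff down_def)
  qed
  moreover have "vconj X \<in> gC n F0 \<longleftrightarrow> X \<in> gC n F0"
    using gC_vconj[of X] gC_vconj[of "vconj X"] by (auto simp: vconj_vconj)
  ultimately show ?thesis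
    using Finf_shift[of "vconj X" a] by (simp add: adjoint_F_iff gF.raises_down_iff)
qed

text \<open>The subspace \<open>F\<^bsup>a+1\<^esup>\<close> of \<open>\<gg>\<close> consists of elements of \<open>eF\<close>-degree greater than \<open>a\<close>, and the conjugate of the subspace of index \<open>-a\<close> induced by
  \<open>Finf\<close> consists of elements of \<open>eF\<close>-degree at most \<open>a\<close>.  Hence they meet in \<open>0\<close>, and by \<open>dim_adjoint_F0\<close> their dimensions add up to
  that of \<open>\<gg>\<close>.  So every element of \<open>\<gg>\<close> can be split inside \<open>\<gg>\<close> at every degree.\<close>

lemma component_eF_mem:
  assumes X: "X \<in> gC n F0" shows "component n eF a X \<in> gC n F0"
proof (cases "a \<in> {- int n..int n}")
  case True
  show ?thesis
  proof (rule truncations_mem[where c="\<lambda>a X. component n eF a X" and K="{- int n..int n}", OF gC_subspace])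
    fix a X assume X: "X \<in> gC n F0"
    let ?A = "adjoint_F n F0 F (a + 1)" and ?B = "vconj ` adjoint_F n F0 Finf (- a)"
    have A: "subspace ?A"
      by (rule subspace_of_csubspace[OF csubspace_adjoint_F[of F, OF F_csubspace]])
    have B: "subspace ?B"
      by (rule subspace_of_csubspace[OF csubspace_vconj[OF csubspace_adjoint_F[of Finf, OF Finf_csubspace]]])
    have sub: "{x + y | x y. x \<in> ?A \<and> y \<in> ?B} \<subseteq> gC n F0"
    proof clarify
      fix x y assume xy: "x \<in> ?A" "y \<in> adjoint_F n F0 Finf (- a)"
      then have "x \<in> gC n F0" "vconj y \<in> gC n F0" using gC_vconj by (auto simp: adjoint_F_iff)
      then show "x + vconj y \<in> gC n F0" by (rule subspace_add[OF gC_subspace])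
    qed
    have "?A \<inter> ?B \<subseteq> {0}"
    proof
      fix X assume X: "X \<in> ?A \<inter> ?B"
      have "eF q ** X ** eF p = eF q ** 0 ** eF p" for q p
        using X vconj_adjoint_F_Finf_iff[of X a] by (cases "q > p + a") (auto simp: adjoint_F_F_iff vconj_image_iff)
      then have "X = 0" by (rule gF.block_eqI)
      then show "X \<in> {0}" by simp
    qed
    then have "dim (?A \<inter> ?B) = 0" by (simp only: dim_eq_0)
    then have "dim {x + y | x y. x \<in> ?A \<and> y \<in> ?B} = dim (gC n F0)"
      using dim_sums_Int[OF A B] dim_adjoint_F0[of a]
      by (simp add: dim_vconj_image dim_adjoint_F[OF F_dual] dim_adjoint_F[OF Finf_dual] del: dim_eq_0)
    then have "{x + y | x y. x \<in> ?A \<and> y \<in> ?B} = gC n F0"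
      by (intro subspace_dim_equal[OF subspace_sums[OF A B] gC_subspace sub]) simp
    then obtain f s where fs: "X = f + s" "f \<in> ?A" "s \<in> ?B" using X by blast
    then have s: "s \<in> gC n F0" "\<forall>p q. q > p + a \<longrightarrow> eF q ** s ** eF p = 0"
      using vconj_adjoint_F_Finf_iff[of s a] by (auto simp: vconj_image_iff)
    have f: "f \<in> gC n F0" "\<forall>p q. q < p + (a + 1) \<longrightarrow> eF q ** f ** eF p = 0"
      using fs(2) by (auto simp: adjoint_F_F_iff)
    have "\<forall>b\<le>a. component n eF b f = 0" using f(2) by (intro allI impI gF.component_eq_0I) simp
    moreover have "\<forall>b>a. component n eF b s = 0" using s(2) by (intro allI impI gF.component_eq_0I) simp
    ultimately show "\<exists>f\<in>gC n F0. \<exists>s\<in>gC n F0. X = f + s \<and> (\<forall>b\<le>a. component n eF b f = 0) \<and> (\<forall>b>a. component n eF b s = 0)"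
      using fs(1) f(1) s(1) by blast
  qed (use X True gF.component_add gF.component_sum in auto)
next
  case False
  then show ?thesis using gF.component_out_of_range cvs.subspace_0[OF gC_csubspace] by simp
qed

text \<open>Let \<open>F = h F0\<close> with \<open>h\<close> in \<open>GC\<close>.  The conjugate by \<open>h\<close> of the degree operator of \<open>F0\<close> acts on the graded pieces of
  \<open>F\<close> as multiplication by the degree, so its component of \<open>eF\<close>-degree \<open>0\<close> is the degree operator of \<open>eF\<close>.\<close>

lemma gF_degree_mem: "gF.degree_op - half_weight \<in> gC n F0"
proof -
  obtain h where h: "h \<in> GC n F0" "F = act h F0" using F_dual by (auto simp: compact_dual_def)
  define Y where "Y = h ** g0.degree_op ** matrix_inv h"
  have "h ** (g0.degree_op - half_weight) ** matrix_inv h \<in> gC n F0"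
    by (rule lie_algebra_Ad[OF alg h(1) degree_op_mem GC_inverse(1)[OF h(1)]])
  also have "h ** (g0.degree_op - half_weight) ** matrix_inv h = Y - half_weight"
    by (simp add: Y_def mat_mul_diff half_weight_def scaleC_mat_mul_left scaleC_mat_mul_right GC_inverse(1)[OF h(1)])
  finally have Y: "Y - half_weight \<in> gC n F0" .
  have "eF p ** Y ** eF p = of_int p *\<^sub>C eF p" for p
  proof (rule mat_eqI)
    fix v
    have "eF p *v v \<in> F p" by (simp add: F_iff gF.e_e_vec)
    then obtain u where u: "u \<in> F0 p" "eF p *v v = h *v u" by (auto simp: h(2) act_def)
    have "e0 r *v (g0.degree_op *v u - of_int p *\<^sub>C u) = (of_int r - of_int p) *\<^sub>C (e0 r *v u)" for r
      by (simp add: mat_vec_diff mat_vec_scaleC matrix_vector_mul_assoc g0.degree_op_e scaleC_mat_vec cvs.scale_left_diff_distrib)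
    moreover have "e0 r *v u = 0" if "r < p" for r using u(1) that by (simp add: F0_iff)
    ultimately have "e0 r *v (g0.degree_op *v u - of_int p *\<^sub>C u) = 0" if "r < p + 1" for r
      using that by (cases "r = p") auto
    then have "g0.degree_op *v u - of_int p *\<^sub>C u \<in> F0 (p + 1)" by (simp add: F0_iff)
    then have "h *v (g0.degree_op *v u - of_int p *\<^sub>C u) \<in> F (p + 1)" by (simp add: h(2) act_def)
    then have "eF p *v (h *v (g0.degree_op *v u - of_int p *\<^sub>C u)) = 0" by (simp add: F_iff)
    moreover have "Y *v (h *v u) = h *v (g0.degree_op *v u)"
    proof -
      have "Y ** h = h ** g0.degree_op ** (matrix_inv h ** h)" by (simp only: Y_def matrix_mul_assoc)
      then have "Y ** h = h ** g0.degree_op" by (simp add: GC_inverse(2)[OF h(1)])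
      then show ?thesis by (simp add: matrix_vector_mul_assoc)
    qed
    ultimately have "eF p *v (Y *v (eF p *v v)) = of_int p *\<^sub>C (eF p *v (eF p *v v))"
      by (simp add: u(2) mat_vec_diff mat_vec_scaleC)
    then show "(eF p ** Y ** eF p) *v v = (of_int p *\<^sub>C eF p) *v v"
      by (simp add: gF.e_e_vec scaleC_mat_vec flip: matrix_vector_mul_assoc)
  qed
  then have "component n eF 0 Y = gF.degree_op" by (simp add: component_def gF.degree_op_def)
  moreover have "component n eF 0 half_weight = half_weight"
    by (rule gF.component_eq_of_commute) (simp add: half_weight_commute)
  ultimately have "component n eF 0 (Y - half_weight) = gF.degree_op - half_weight" by (simp add: gF.component_diff)
  then show ?thesis using component_eF_mem[OF Y, of 0] by simp
qed

text \<open>The degree operator of \<open>eS\<close> is the part of \<open>eF\<close>-degree \<open>0\<close> of the conjugate of the degree operator of \<open>eF\<close>.\<close>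

lemma gS_degree_mem: "gS.degree_op - half_weight \<in> gC n F0"
proof -
  have "vconj gF.degree_op = gB.degree_op"
    by (simp add: gF.degree_op_def gB.degree_op_def vconj_sum vconj_scaleC eB_def)
  moreover have "vconj half_weight = half_weight" by (simp add: half_weight_def vconj_scaleC vconj_mat_1)
  ultimately have B: "gB.degree_op - half_weight \<in> gC n F0"
    using gC_vconj[OF gF_degree_mem] by (simp add: vconj_diff)
  have "component n eF 0 (\<Sum>q\<in>K. f q) = (\<Sum>q\<in>K. component n eF 0 (f q))" for K and f :: "int \<Rightarrow> complex^'n^'n"
    unfolding component_def mat_mul_sum_left mat_mul_sum_right by (rule sum.swap)
  then have "component n eF 0 gB.degree_op = gS.degree_op"
    by (simp add: gB.degree_op_def gS.degree_op_def gF.component_scale eS_def)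
  moreover have "component n eF 0 half_weight = half_weight"
    by (rule gF.component_eq_of_commute) (simp add: half_weight_commute)
  ultimately have "component n eF 0 (gB.degree_op - half_weight) = gS.degree_op - half_weight" by (simp add: gF.component_diff)
  then show ?thesis using component_eF_mem[OF B, of 0] by simp
qed

lemma component_eS_mem: "X \<in> gC n F0 \<Longrightarrow> component n eS a X \<in> gC n F0"
  by (rule gS.component_mem_of_ad_stable[OF gC_csubspace ad_shift_mem[OF gS_degree_mem]])

text \<open>Multiplication by \<open>p - q\<close> on \<open>J p q\<close>, the obstruction to being Hodge--Tate.\<close>

definition Z :: "complex^'n^'n" where "Z = gF.degree_op - gS.degree_op"

lemma Z_mem: "Z \<in> gC n F0"
  using cvs.subspace_diff[OF gC_csubspace gF_degree_mem gS_degree_mem] by (simp add: Z_def)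

lemma component_eS_commute:
  assumes "component n eF a X = X"
  shows "component n eF a (component n eS b X) = component n eS b X"
proof (rule gF.component_eq_of_commute)
  fix p
  have X: "X ** eF p = eF (p + a) ** X" by (rule gF.degree_component_commute[OF assms])
  have "eS (q + b) ** X ** eS q ** eF p = eF (p + a) ** (eS (q + b) ** X ** eS q)" for q
  proof -
    have "eS (q + b) ** X ** eS q ** eF p = eS (q + b) ** (X ** eF p) ** eS q"
      by (simp add: comm[symmetric] flip: matrix_mul_assoc)
    also have "\<dots> = (eS (q + b) ** eF (p + a)) ** X ** eS q" by (simp only: X matrix_mul_assoc)
    also have "\<dots> = eF (p + a) ** (eS (q + b) ** X ** eS q)" by (simp only: comm[symmetric] matrix_mul_assoc)
    finally show ?thesis .
  qed
  then show "component n eS b X ** eF p = eF (p + a) ** component n eS b X"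
    by (simp add: component_def mat_mul_sum_left mat_mul_sum_right)
qed

lemma component_eF_commute:
  assumes "component n eS b X = X"
  shows "component n eS b (component n eF a X) = component n eF a X"
proof (rule gS.component_eq_of_commute)
  fix p
  have X: "X ** eS p = eS (p + b) ** X" by (rule gS.degree_component_commute[OF assms])
  have "eF (q + a) ** X ** eF q ** eS p = eS (p + b) ** (eF (q + a) ** X ** eF q)" for q
  proof -
    have "eF (q + a) ** X ** eF q ** eS p = eF (q + a) ** (X ** eS p) ** eF q"
      by (simp add: comm flip: matrix_mul_assoc)
    also have "\<dots> = (eF (q + a) ** eS (p + b)) ** X ** eF q" by (simp only: X matrix_mul_assoc)
    also have "\<dots> = eS (p + b) ** (eF (q + a) ** X ** eF q)" by (simp only: comm matrix_mul_assoc)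
    finally show ?thesis .
  qed
  then show "component n eF a X ** eS p = eS (p + b) ** component n eF a X"
    by (simp add: component_def mat_mul_sum_left mat_mul_sum_right)
qed

lemma bidegree_iff: "bidegree a b X \<longleftrightarrow> component n eF a X = X \<and> component n eS b X = X"
  unfolding bidegree_def
  using gF.degree_component_commute[of a X] gS.degree_component_commute[of b X]
    gF.component_eq_of_commute[of X a] gS.component_eq_of_commute[of X b] by blast

lemma bracket_Z_bidegree: "bidegree a b X \<Longrightarrow> lie_bracket Z X = of_int (a - b) *\<^sub>C X"
  using gF.degree_op_component[of a X] gS.degree_op_component[of b X]
  by (simp add: bidegree_iff lie_bracket_def Z_def mat_mul_diff cvs.scale_left_diff_distrib algebra_simps)

lemma N_bidegree: "bidegree (- 1) (- 1) N"
  unfolding bidegree_def using N_eF N_eS by simp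

lemma Z_N: "Z ** N = N ** Z"
  using bracket_Z_bidegree[OF N_bidegree] by (simp add: lie_bracket_def)

lemma bracket_Z_funpow:
  assumes "lie_bracket Z X = 0" shows "lie_bracket Z ((lie_bracket N ^^ k) X) = 0"
proof (induction k)
  case (Suc k)
  let ?Y = "(lie_bracket N ^^ k) X"
  have Y: "Z ** ?Y = ?Y ** Z" using Suc unfolding lie_bracket_def[of Z] by simp
  have "Z ** (N ** ?Y) = (N ** ?Y) ** Z" 
    by (metis Y Z_N matrix_mul_assoc)
  moreover have "Z ** (?Y ** N) = (?Y ** N) ** Z"
    by (metis Y Z_N matrix_mul_assoc)
  ultimately have "lie_bracket Z (lie_bracket N ?Y) = 0"
    unfolding lie_bracket_def[of N ?Y] lie_bracket_def[of Z] by (simp add: mat_mul_diff)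
  then show ?case by simp
qed (simp add: assms)

lemma bracket_N_mem: "X \<in> gC n F0 \<Longrightarrow> (lie_bracket N ^^ k) X \<in> gC n F0"
  by (induction k) (auto intro: gC_bracket N_gC)

end

text \<open>Peeling off one degree: in this way the dimensions of the steps of a filtration determine those of the graded pieces.\<close>

lemma (in grading) dim_component_split:
  assumes U: "cvs.subspace U" and c: "\<And>X. X \<in> U \<Longrightarrow> component n e a X \<in> U" and D: "a \<notin> D"
  shows "dim {X \<in> U. \<forall>p q. q - p \<in> D \<longrightarrow> e q ** X ** e p = 0}
    = dim {X \<in> U. component n e a X = X} + dim {X \<in> U. \<forall>p q. q - p \<in> insert a D \<longrightarrow> e q ** X ** e p = 0}"
    (is "dim ?G = dim ?A + dim ?H")
proof -
  have A: "cvs.subspace ?A" and H: "cvs.subspace ?H"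
    using U by (auto simp: cvs.subspace_def component_add component_scale matrix_add_ldistrib matrix_add_rdistrib
        scaleC_mat_mul_left scaleC_mat_mul_right component_eq_0I)
  have "?G = {x + y | x y. x \<in> ?A \<and> y \<in> ?H}"
  proof (intro set_eqI iffI)
    fix X assume X: "X \<in> ?G"
    have "component n e a X \<in> ?A" using X c by (auto simp: component_component)
    moreover have "X - component n e a X \<in> ?H"
      using X c U by (auto simp: mat_mul_diff component_block intro: cvs.subspace_diff)
    moreover have "X = component n e a X + (X - component n e a X)" by simp
    ultimately show "X \<in> {x + y | x y. x \<in> ?A \<and> y \<in> ?H}" by blast
  next
    fix X assume "X \<in> {x + y | x y. x \<in> ?A \<and> y \<in> ?H}"
    then obtain x y where xy: "X = x + y" "x \<in> U" "component n e a x = x" "y \<in> ?H" by blast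
    have "e q ** x ** e p = 0" if "q - p \<in> D" for p q
    proof -
      have "q \<noteq> p + a" using that D by auto
      then show ?thesis using component_block[of q a x p] xy(3) by simp
    qed
    then show "X \<in> ?G"
      using xy U by (auto simp: matrix_add_ldistrib matrix_add_rdistrib intro: cvs.subspace_add)
  qed
  moreover have "?A \<inter> ?H \<subseteq> {0}"
  proof
    fix X assume X: "X \<in> ?A \<inter> ?H"
    then have "component n e a X = 0" by (intro component_eq_0I) auto
    then show "X \<in> {0}" using X by simp
  qed
  then have "dim (?A \<inter> ?H) = 0" by (simp only: dim_eq_0)
  ultimately show ?thesis
    using dim_sums_Int[OF subspace_of_csubspace[OF A] subspace_of_csubspace[OF H]] by (simp del: dim_eq_0)
qed

lemma (in grading) csubspace_homogeneous:
  "cvs.subspace U \<Longrightarrow> cvs.subspace {X \<in> U. component n e a X = X}"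
  by (auto simp: cvs.subspace_def component_add component_scale component_eq_0I)

lemma lie_bracket_add: "lie_bracket X (Y + Y') = lie_bracket X Y + lie_bracket X Y'"
  by (simp add: lie_bracket_def matrix_add_ldistrib matrix_add_rdistrib)

lemma lie_bracket_scaleC: "lie_bracket X (c *\<^sub>C Y) = c *\<^sub>C lie_bracket X Y"
  by (simp add: lie_bracket_def scaleC_mat_mul_left scaleC_mat_mul_right cvs.scale_right_diff_distrib)

lemma lie_bracket_sum: "lie_bracket X (sum f K) = (\<Sum>i\<in>K. lie_bracket X (f i))"
  by (simp add: lie_bracket_def mat_mul_sum_left mat_mul_sum_right sum_subtractf)

lemma linear_lie_bracket_funpow: "linear (lie_bracket X ^^ k)"
proof (induction k)
  case (Suc k)
  have "linear (lie_bracket X)"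
    by (rule linearI) (auto simp: lie_bracket_add lie_bracket_scaleC scaleR_eq_scaleC)
  from linear_compose[OF Suc this] show ?case by (simp only: funpow.simps(2))
qed (simp add: linear_ident)

section \<open>Totally real closed orbits force the diagonal bigrading\<close>

locale real_isotropy_limit = period_limit n F0 F Wc N Finf
  for n and F0 F Wc :: "int \<Rightarrow> (complex^'n) set" and N Finf +
  assumes isotropy_real: "X \<in> isotropy n F0 Finf \<Longrightarrow> vconj X \<in> isotropy n F0 Finf"
begin

text \<open>The elements of \<open>\<gg>\<close> of nonpositive \<open>eS\<close>-degrees form the isotropy algebra of \<open>Finf\<close>, those of nonpositive \<open>eF\<close>-degrees its
  conjugate.\<close>

lemma nonpositive_degrees_eq:
  assumes X: "X \<in> gC n F0" "bidegree a b X" "X \<noteq> 0"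
  shows "a \<le> 0 \<longleftrightarrow> b \<le> 0"
proof -
  have cX: "component n eF a X = X" "component n eS b X = X" using X(2) by (simp_all add: bidegree_iff)
  have iso: "Y \<in> isotropy n F0 Finf \<longleftrightarrow> Y \<in> gC n F0 \<and> (\<forall>p q. q > p \<longrightarrow> eS q ** Y ** eS p = 0)" for Y
    using adjoint_F_Finf_iff[of Y 0] by (simp add: isotropy_eq_adjoint_F)
  have isoc: "vconj Y \<in> isotropy n F0 Finf \<longleftrightarrow> Y \<in> gC n F0 \<and> (\<forall>p q. q > p \<longrightarrow> eF q ** Y ** eF p = 0)" for Y
    using vconj_adjoint_F_Finf_iff[of Y 0] by (simp add: isotropy_eq_adjoint_F)
  show ?thesis
  proof
    assume a: "a \<le> 0"
    have "eF q ** X ** eF p = 0" if "q > p" for p q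
      using gF.component_block[of q a X p] cX(1) a that by simp
    then have "vconj X \<in> isotropy n F0 Finf" using isoc X(1) by blast
    then have "vconj (vconj X) \<in> isotropy n F0 Finf" by (rule isotropy_real)
    then have "X \<in> isotropy n F0 Finf" by (simp add: vconj_vconj)
    then have z: "eS q ** X ** eS p = 0" if "q > p" for p q using iso that by blast
    show "b \<le> 0"
    proof (rule ccontr)
      assume "\<not> b \<le> 0"
      then have "component n eS b X = 0" using z by (intro gS.component_eq_0I) simp
      then show False using cX(2) X(3) by simp
    qed
  next
    assume b: "b \<le> 0"
    have "eS q ** X ** eS p = 0" if "q > p" for p q
      using gS.component_block[of q b X p] cX(2) b that by simp
    then have "X \<in> isotropy n F0 Finf" using iso X(1) by blast
    then have "vconj X \<in> isotropy n F0 Finf" by (rule isotropy_real)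
    then have z: "eF q ** X ** eF p = 0" if "q > p" for p q using isoc that by blast
    show "a \<le> 0"
    proof (rule ccontr)
      assume "\<not> a \<le> 0"
      then have "component n eF a X = 0" using z by (intro gF.component_eq_0I) simp
      then show False using cX(1) X(3) by simp
    qed
  qed
qed

text \<open>The bracket with \<open>N\<close> lowers both degrees by one.  Either one of them reaches zero before the other, which
  \<open>nonpositive_degrees_eq\<close> excludes unless the bracket is zero, or the bracket vanishes by induction.  In both cases \<open>bracket_N_power_inj\<close> applies.\<close>

lemma off_diagonal_positive_eq_0:
  assumes "X \<in> gC n F0" "bidegree a b X" "a > 0" "b > 0" "a \<noteq> b"
  shows "X = 0"
  using assms
proof (induction "nat a" arbitrary: a b X rule: less_induct)
  case less
  let ?Y = "lie_bracket N X"
  have Y: "?Y \<in> gC n F0" "bidegree (a - 1) (b - 1) ?Y"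
    using less.prems by (auto intro: gC_bracket N_gC bidegree_bracket_N)
  have "?Y = 0"
  proof (rule ccontr)
    assume nz: "?Y \<noteq> 0"
    have iff: "a - 1 \<le> 0 \<longleftrightarrow> b - 1 \<le> 0" by (rule nonpositive_degrees_eq[OF Y nz])
    show False
    proof (cases "a = 1")
      case True
      then show ?thesis using iff less.prems by auto
    next
      case False
      then have "a - 1 > 0" "b - 1 > 0" using iff less.prems by auto
      then have "?Y = 0" using less.hyps[OF _ Y] less.prems by simp
      then show ?thesis using nz by simp
    qed
  qed
  moreover have "(lie_bracket N ^^ k) 0 = 0" for k
    by (induction k) (auto simp: lie_bracket_def)
  moreover obtain k where "nat (a + b) = Suc k" using less.prems by (cases "nat (a + b)") auto
  ultimately have "(lie_bracket N ^^ nat (a + b)) X = 0" by (simp add: funpow_swap1)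
  then show ?case using less.prems by (intro bracket_N_power_inj[OF dims_opposite less.prems(2)]) auto
qed

lemma bidegree_of_eF_positive:
  assumes X: "X \<in> gC n F0" "component n eF a X = X" "a > 0"
  shows "bidegree a a X"
proof -
  let ?K = "{- int n..int n}"
  have z: "component n eS b X = 0" if "b \<noteq> a" for b
  proof (rule ccontr)
    assume nz: "component n eS b X \<noteq> 0"
    have m: "component n eS b X \<in> gC n F0" "bidegree a b (component n eS b X)"
      using X component_eS_mem by (auto simp: bidegree_iff component_eS_commute gS.component_component)
    have "a \<le> 0 \<longleftrightarrow> b \<le> 0" by (rule nonpositive_degrees_eq[OF m nz])
    then show False using off_diagonal_positive_eq_0[OF m] nz that X(3) by auto
  qed
  have "X = (\<Sum>b\<in>?K. component n eS b X)" by (rule gS.component_sum[symmetric])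
  also have "\<dots> = (\<Sum>b\<in>?K. if b = a then component n eS a X else 0)"
    using z by (intro sum.cong) auto
  also have "\<dots> = component n eS a X"
    using gS.component_out_of_range[of a X] by (auto simp: sum.delta)
  finally show ?thesis using X(2) by (simp add: bidegree_iff)
qed

lemma bidegree_of_eS_positive:
  assumes X: "X \<in> gC n F0" "component n eS b X = X" "b > 0"
  shows "bidegree b b X"
proof -
  let ?K = "{- int n..int n}"
  have z: "component n eF a X = 0" if "a \<noteq> b" for a
  proof (rule ccontr)
    assume nz: "component n eF a X \<noteq> 0"
    have m: "component n eF a X \<in> gC n F0" "bidegree a b (component n eF a X)"
      using X component_eF_mem by (auto simp: bidegree_iff component_eF_commute gF.component_component)
    have "a \<le> 0 \<longleftrightarrow> b \<le> 0" by (rule nonpositive_degrees_eq[OF m nz])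
    then show False using off_diagonal_positive_eq_0[OF m] nz that X(3) by auto
  qed
  have "X = (\<Sum>a\<in>?K. component n eF a X)" by (rule gF.component_sum[symmetric])
  also have "\<dots> = (\<Sum>a\<in>?K. if a = b then component n eF b X else 0)"
    using z by (intro sum.cong) auto
  also have "\<dots> = component n eF b X"
    using gF.component_out_of_range[of b X] by (auto simp: sum.delta)
  finally show ?thesis using X(2) by (simp add: bidegree_iff)
qed

text \<open>The dimensions of the graded pieces are those of the Hodge structure of \<open>F0\<close> on \<open>\<gg>\<close>, where they are symmetric by
  \<open>dim_adjoint_F0\<close>.\<close>

lemma dim_eF_homogeneous_sym:
  "dim {X \<in> gC n F0. component n eF a X = X} = dim {X \<in> gC n F0. component n eF (- a) X = X}"
proof -
  define d where "d = (\<lambda>a. dim (adjoint_F n F0 F0 a))"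
  have G: "dim {X \<in> gC n F0. \<forall>p q. q < p + a \<longrightarrow> eF q ** X ** eF p = 0} = d a" for a
  proof -
    have "adjoint_F n F0 F a = {X \<in> gC n F0. \<forall>p q. q < p + a \<longrightarrow> eF q ** X ** eF p = 0}"
      by (rule set_eqI) (simp only: adjoint_F_F_iff mem_Collect_eq)
    then show ?thesis using dim_adjoint_F[OF F_dual, of a] by (simp add: d_def)
  qed
  have s: "d a = dim {X \<in> gC n F0. component n eF a X = X} + d (a + 1)" for a
  proof -
    have "q < p + a \<longleftrightarrow> q - p \<in> {..<a}" "q < p + (a + 1) \<longleftrightarrow> q - p \<in> insert a {..<a}" for p q by auto
    then show ?thesis
      using gF.dim_component_split[OF gC_csubspace component_eF_mem, of a "{..<a}"]
      by (simp only: flip: G) simp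
  qed
  have "d (a + 1) + d (- a) = dim (gC n F0)" "d (a - 1 + 1) + d (- (a - 1)) = dim (gC n F0)"
    unfolding d_def by (rule dim_adjoint_F0)+
  then show ?thesis using s[of a] s[of "- a"] by (simp add: algebra_simps)
qed

lemma dim_eS_homogeneous_sym:
  "dim {X \<in> gC n F0. component n eS a X = X} = dim {X \<in> gC n F0. component n eS (- a) X = X}"
proof -
  define d where "d = (\<lambda>a. dim (adjoint_F n F0 F0 a))"
  have G: "dim {X \<in> gC n F0. \<forall>p q. q > p + a \<longrightarrow> eS q ** X ** eS p = 0} = d (- a)" for a
  proof -
    have "adjoint_F n F0 Finf (- a) = {X \<in> gC n F0. \<forall>p q. q > p + a \<longrightarrow> eS q ** X ** eS p = 0}"
      by (rule set_eqI) (simp only: adjoint_F_Finf_iff mem_Collect_eq)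
    then show ?thesis using dim_adjoint_F[OF Finf_dual, of "- a"] by (simp add: d_def)
  qed
  have s: "d (- a) = dim {X \<in> gC n F0. component n eS a X = X} + d (- (a - 1))" for a
  proof -
    have "q > p + a \<longleftrightarrow> q - p \<in> {a<..}" "q > p + (a - 1) \<longleftrightarrow> q - p \<in> insert a {a<..}" for p q by auto
    then show ?thesis
      using gS.dim_component_split[OF gC_csubspace component_eS_mem, of a "{a<..}"]
      by (simp only: flip: G) simp
  qed
  have "d (a + 1) + d (- a) = dim (gC n F0)" "d (a - 1 + 1) + d (- (a - 1)) = dim (gC n F0)"
    unfolding d_def by (rule dim_adjoint_F0)+
  then show ?thesis using s[of a] s[of "- a"] by (simp add: algebra_simps)
qed

text \<open>The power \<open>ad(N)\<^bsup>2a\<^esup>\<close> maps \<open>S\<close> injectively, hence for reasons of dimension onto \<open>S'\<close>, and commutes with \<open>ad Z\<close>,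
  which annihilates \<open>S\<close>.\<close>

lemma bracket_Z_negative:
  assumes S: "subspace S" "S \<subseteq> gC n F0" and S': "subspace S'" and d: "dim S = dim S'" and a: "a > 0"
    and bi: "\<And>X. X \<in> S \<Longrightarrow> bidegree a a X"
    and S'I: "\<And>X. X \<in> gC n F0 \<Longrightarrow> bidegree (- a) (- a) X \<Longrightarrow> X \<in> S'"
    and Y: "Y \<in> S'"
  shows "lie_bracket Z Y = 0"
proof -
  let ?T = "lie_bracket N ^^ nat (2 * a)"
  have lin: "linear ?T" by (rule linear_lie_bracket_funpow)
  have z: "X = 0" if "X \<in> S" "?T X = 0" for X
  proof (rule bracket_N_power_inj[OF dims_opposite bi[OF that(1)]])
    show "a + a > 0" using a by simp
    show "(lie_bracket N ^^ nat (a + a)) X = 0" using that(2) by (simp only: mult_2)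
  qed
  have "inj_on ?T (span S)"
  proof (rule inj_onI)
    fix X X' assume X: "X \<in> span S" "X' \<in> span S" "?T X = ?T X'"
    then have "X - X' \<in> S" using S(1) by (metis span_eq_iff subspace_diff)
    moreover have "?T (X - X') = 0" using X(3) linear_diff[OF lin] by simp
    ultimately show "X = X'" using z by fastforce
  qed
  then have "dim (?T ` S) = dim S" by (rule dim_image_eq[OF lin])
  moreover have "?T ` S \<subseteq> S'"
  proof clarify
    fix X assume X: "X \<in> S"
    have "bidegree (a - int (nat (2 * a))) (a - int (nat (2 * a))) (?T X)"
      by (rule bidegree_bracket_N_funpow[OF bi[OF X]])
    moreover have "a - int (nat (2 * a)) = - a" using a by simp
    ultimately show "?T X \<in> S'" using X S(2) by (intro S'I bracket_N_mem) auto
  qed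
  ultimately have "?T ` S = S'"
    using d by (intro subspace_dim_equal linear_subspace_image[OF lin S(1)] S') simp_all
  then obtain X where X: "X \<in> S" "Y = ?T X" using Y by blast
  have "lie_bracket Z X = 0" using bracket_Z_bidegree[OF bi[OF X(1)]] by simp
  then show ?thesis unfolding X(2) by (rule bracket_Z_funpow)
qed

text \<open>In positive degrees, of either grading, \<open>\<gg>\<close> is concentrated on the diagonal, where \<open>Z\<close> acts by zero; negative degrees are
  covered by \<open>bracket_Z_negative\<close>; and bidegree \<open>(0, 0)\<close> is itself on the diagonal.\<close>

lemma Z_central:
  assumes X: "X \<in> gC n F0" shows "lie_bracket Z X = 0"
proof -
  have eF_part: "lie_bracket Z Y = 0" if Y: "Y \<in> gC n F0" "component n eF a Y = Y" "a \<noteq> 0" for a Y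
  proof (cases "a > 0")
    case True
    then show ?thesis using bracket_Z_bidegree[OF bidegree_of_eF_positive[OF Y(1,2)]] by simp
  next
    case False
    then have a: "- a > 0" using Y(3) by simp
    show ?thesis
    proof (rule bracket_Z_negative[OF _ _ _ _ a])
      show "subspace {X \<in> gC n F0. component n eF (- a) X = X}" "subspace {X \<in> gC n F0. component n eF a X = X}"
        by (rule subspace_of_csubspace[OF gF.csubspace_homogeneous[OF gC_csubspace]])+
      show "dim {X \<in> gC n F0. component n eF (- a) X = X} = dim {X \<in> gC n F0. component n eF a X = X}"
        by (rule dim_eF_homogeneous_sym[symmetric])
    qed (use bidegree_of_eF_positive a Y in \<open>auto simp: bidegree_iff\<close>)
  qed
  have eS_part: "lie_bracket Z Y = 0" if Y: "Y \<in> gC n F0" "component n eS a Y = Y" "a \<noteq> 0" for a Y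
  proof (cases "a > 0")
    case True
    then show ?thesis using bracket_Z_bidegree[OF bidegree_of_eS_positive[OF Y(1,2)]] by simp
  next
    case False
    then have a: "- a > 0" using Y(3) by simp
    show ?thesis
    proof (rule bracket_Z_negative[OF _ _ _ _ a])
      show "subspace {X \<in> gC n F0. component n eS (- a) X = X}" "subspace {X \<in> gC n F0. component n eS a X = X}"
        by (rule subspace_of_csubspace[OF gS.csubspace_homogeneous[OF gC_csubspace]])+
      show "dim {X \<in> gC n F0. component n eS (- a) X = X} = dim {X \<in> gC n F0. component n eS a X = X}"
        by (rule dim_eS_homogeneous_sym[symmetric])
    qed (use bidegree_of_eS_positive a Y in \<open>auto simp: bidegree_iff\<close>)
  qed
  let ?K = "{- int n..int n}"
  have part: "lie_bracket Z (component n eS b (component n eF a X)) = 0" for a b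
  proof -
    let ?Y = "component n eS b (component n eF a X)"
    have Y: "?Y \<in> gC n F0" using X by (intro component_eS_mem component_eF_mem)
    have c: "component n eF a ?Y = ?Y" "component n eS b ?Y = ?Y"
      by (simp_all add: component_eS_commute gF.component_component gS.component_component)
    show ?thesis
    proof (cases "a = 0 \<and> b = 0")
      case True
      then have "bidegree 0 0 ?Y" using c by (simp add: bidegree_iff)
      from bracket_Z_bidegree[OF this] show ?thesis by simp
    qed (use eF_part[OF Y c(1)] eS_part[OF Y c(2)] in blast)
  qed
  have "X = (\<Sum>a\<in>?K. \<Sum>b\<in>?K. component n eS b (component n eF a X))"
    by (simp add: gS.component_sum gF.component_sum)
  then have "lie_bracket Z X = lie_bracket Z (\<Sum>a\<in>?K. \<Sum>b\<in>?K. component n eS b (component n eF a X))" by simp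
  then show ?thesis by (simp add: lie_bracket_sum part)
qed

text \<open>A central element spans an abelian ideal.\<close>

lemma Z_eq_0:
  assumes ss: "semisimple_lie (gC n F0)"
  shows "Z = 0"
proof -
  let ?I = "cvs.span {Z}"
  have I: "\<exists>c. Y = c *\<^sub>C Z" if "Y \<in> ?I" for Y using that by (auto simp: cvs.span_singleton)
  have "?I \<subseteq> gC n F0" by (rule cvs.span_minimal[OF _ gC_csubspace]) (use Z_mem in simp)
  moreover have "lie_bracket X Y \<in> ?I" if XY: "X \<in> gC n F0" "Y \<in> ?I" for X Y
  proof -
    obtain c where "Y = c *\<^sub>C Z" using I XY(2) by blast
    moreover have "lie_bracket X Z = - lie_bracket Z X" by (simp add: lie_bracket_def)
    ultimately have "lie_bracket X Y = 0" using Z_central[OF XY(1)] by (simp add: lie_bracket_scaleC)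
    then show ?thesis by (simp add: cvs.span_zero)
  qed
  ultimately have ideal: "lie_ideal ?I (gC n F0)" unfolding lie_ideal_def by (simp add: cvs.subspace_span)
  have "lie_bracket X Y = 0" if XY: "X \<in> ?I" "Y \<in> ?I" for X Y
  proof -
    obtain c d where "X = c *\<^sub>C Z" "Y = d *\<^sub>C Z" using I XY by blast
    then show ?thesis by (simp add: lie_bracket_def scaleC_mat_mul_left scaleC_mat_mul_right scaleC_scaleC mult.commute)
  qed
  then have "{lie_bracket X Y | X Y. X \<in> ?I \<and> Y \<in> ?I} = {0}"
    using cvs.span_zero by (auto intro!: exI[of _ 0])
  then have "derived_algebra ?I = {0}" unfolding derived_algebra_def by simp
  then have "(derived_algebra ^^ 1) ?I = {0}" by simp
  then have "?I = {0}" using ss ideal unfolding semisimple_lie_def by blast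
  then show ?thesis using cvs.span_base[of Z "{Z}"] by simp
qed

lemma eF_eq_eS:
  assumes ss: "semisimple_lie (gC n F0)"
  shows "eF p = eS p"
proof -
  have d: "gF.degree_op = gS.degree_op" using Z_eq_0[OF ss] by (simp add: Z_def)
  have z: "eF p ** eS q = 0" if "p \<noteq> q" for p q
  proof -
    have "eF p ** gF.degree_op ** eS q = eF p ** (gS.degree_op ** eS q)" by (simp add: d matrix_mul_assoc)
    then have "of_int p *\<^sub>C (eF p ** eS q) = of_int q *\<^sub>C (eF p ** eS q)"
      by (simp add: gF.degree_op_e gS.degree_op_e scaleC_mat_mul_left scaleC_mat_mul_right)
    then have "(of_int p - of_int q) *\<^sub>C (eF p ** eS q) = 0" by (simp add: cvs.scale_left_diff_distrib)
    then show ?thesis using that by simp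
  qed
  show ?thesis
  proof (cases "p \<in> {0..int n}")
    case True
    have "eF p = (\<Sum>q = 0..int n. eF p ** eS q)" by (simp add: gS.total flip: mat_mul_sum_right)
    also have "\<dots> = (\<Sum>q = 0..int n. if q = p then eF p ** eS p else 0)" using z by (intro sum.cong) auto
    also have "\<dots> = eF p ** eS p" using True by (simp add: sum.delta)
    finally have 1: "eF p = eF p ** eS p" .
    have "eS p = (\<Sum>q = 0..int n. eF q ** eS p)" by (simp add: gF.total flip: mat_mul_sum_left)
    also have "\<dots> = (\<Sum>q = 0..int n. if q = p then eF p ** eS p else 0)" using z by (intro sum.cong) auto
    also have "\<dots> = eF p ** eS p" using True by (simp add: sum.delta)
    finally show ?thesis using 1 by simp
  next
    case False
    then have "p < 0 \<or> p > int n" by auto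
    then show ?thesis using gF.support gS.support by simp
  qed
qed

lemma Finf_real:
  assumes ss: "semisimple_lie (gC n F0)"
  shows "vconj ` Finf p = Finf p"
proof -
  have "Phi q = Psi q" for q
    by (rule set_eqI) (simp add: Phi_eq Psi_iff down_def eF_eq_eS[OF ss])
  then have "vconj ` Psi (int n - p) = Psi (int n - p)" by (simp flip: Phi_def)
  moreover have "Finf p = Psi (int n - p)" using Phi_eq_Finf[of "int n - p"] \<open>\<And>q. Phi q = Psi q\<close> by simp
  ultimately show ?thesis by simp
qed

end

section \<open>Hodge--Tate structures\<close>

text \<open>Suppose that one grading with components \<open>c k\<close> splits \<open>F\<close> by \<open>k\<close> and \<open>W\<close> by \<open>2k\<close>.  Then the pieces \<open>I\<^bsup>k,k\<^esup>\<close> of this grading form the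
  Deligne splitting.  The congruence for the conjugate of \<open>I\<^bsup>p,p\<^esup>\<close> holds because \<open>I\<^bsup>p,p\<^esup> + W\<^bsub>2p-2\<^esub> = W\<^bsub>2p\<^esub>\<close>
  and the complexified weight filtration is conjugation stable.\<close>

lemma hodge_tate_of_grading:
  fixes c :: "int \<Rightarrow> 'a \<Rightarrow> 'a::conj_space"
  assumes U: "cvs.subspace U" and K: "finite K"
    and mem: "\<And>k x. x \<in> U \<Longrightarrow> c k x \<in> U" and add: "\<And>k x y. c k (x + y) = c k x + c k y"
    and scale: "\<And>k r x. c k (r *\<^sub>C x) = r *\<^sub>C c k x"
    and cc: "\<And>j k x. c j (c k x) = (if j = k then c k x else 0)"
    and tot: "\<And>x. (\<Sum>k\<in>K. c k x) = x" and out: "\<And>k x. k \<notin> K \<Longrightarrow> c k x = 0"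
    and F: "\<And>p x. x \<in> F p \<longleftrightarrow> x \<in> U \<and> (\<forall>k<p. c k x = 0)"
    and W: "\<And>l x. x \<in> complexify (W l) \<longleftrightarrow> x \<in> U \<and> (\<forall>k. 2 * k > l \<longrightarrow> c k x = 0)"
    and W_conj: "\<And>l x. x \<in> complexify (W l) \<Longrightarrow> vconj x \<in> complexify (W l)"
  shows "hodge_tate U W F"
proof -
  \<comment> \<open>The Deligne splitting, concentrated on the diagonal.\<close>
  define I where "I = (\<lambda>p q. if p = q then {x \<in> U. c p x = x} else {0})"
  have c0: "c k 0 = 0" for k using scale[of k 0 0] by simp
  have cdiff: "c k (x - y) = c k x - c k y" for k x y
    using add[of k "x - y" y] by simp
  have csum: "c k (sum f A) = (\<Sum>z\<in>A. c k (f z))" for k A and f :: "int \<times> int \<Rightarrow> 'a"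
    by (induction A rule: infinite_finite_induct) (auto simp: c0 add)
  have U0: "0 \<in> U" by (rule cvs.subspace_0[OF U])
  have I0: "0 \<in> I p q" for p q by (simp add: I_def U0 c0)
  have Isub: "cvs.subspace (I p q)" for p q
    using U by (auto simp: I_def cvs.subspace_def c0 add scale)
  have IU: "I p q \<subseteq> U" for p q using U0 by (auto simp: I_def)
  have supp: "bigraded_support I \<subseteq> (\<lambda>k. (k, k)) ` K"
  proof
    fix z assume "z \<in> bigraded_support I"
    then obtain p q where z: "z = (p, q)" "I p q \<noteq> {0}" by (auto simp: bigraded_support_def)
    then obtain x where x: "x \<in> I p q" "x \<noteq> 0" using I0[of p q] by blast
    then have "p = q" "c p x = x" by (auto simp: I_def split: if_splits)
    then have "p \<in> K" using out[of p x] x(2) by auto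
    then show "z \<in> (\<lambda>k. (k, k)) ` K" using z \<open>p = q\<close> by auto
  qed
  have fin: "finite (bigraded_support I)" using supp K by (auto intro: finite_subset)
  have cf: "c k (f z) = (if z = (k, k) then f z else 0)" if f: "\<forall>p q. f (p, q) \<in> I p q" and z: "z \<in> bigraded_support I" for f z k
  proof -
    obtain j where j: "z = (j, j)" using supp z by auto
    then have fj: "c j (f z) = f z" using f[rule_format, of j j] by (simp add: I_def)
    have "c k (f z) = c k (c j (f z))" by (simp add: fj)
    also have "\<dots> = (if k = j then c j (f z) else 0)" by (simp only: cc)
    finally show ?thesis using fj j by auto
  qed
  have bsum: "bigraded_sum I S = {x \<in> U. \<forall>k. (k, k) \<notin> S \<longrightarrow> c k x = 0}" for S
  proof (intro set_eqI iffI)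
    fix x assume "x \<in> bigraded_sum I S"
    then obtain f where f: "x = (\<Sum>z\<in>S \<inter> bigraded_support I. f z)" "\<forall>p q. f (p, q) \<in> I p q"
      by (auto simp: bigraded_sum_def)
    have "f z \<in> U" for z
      using f(2)[rule_format, of "fst z" "snd z"] IU[of "fst z" "snd z"] by auto
    then have "x \<in> U" unfolding f(1) by (intro cvs.subspace_sum[OF U])
    moreover have "c k x = 0" if "(k, k) \<notin> S" for k
      unfolding f(1) csum using that cf[OF f(2)] by (intro sum.neutral) auto
    ultimately show "x \<in> {x \<in> U. \<forall>k. (k, k) \<notin> S \<longrightarrow> c k x = 0}" by blast
  next
    fix x assume x: "x \<in> {x \<in> U. \<forall>k. (k, k) \<notin> S \<longrightarrow> c k x = 0}"
    define f where "f = (\<lambda>(p, q). if p = q then c p x else 0 :: 'a)"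
    have f: "f (p, q) \<in> I p q" for p q using x mem by (auto simp: f_def I_def cc)
    have "x = (\<Sum>k\<in>K. f (k, k))" by (simp add: f_def tot)
    also have "\<dots> = (\<Sum>z\<in>(\<lambda>k. (k, k)) ` K. f z)"
      by (subst sum.reindex) (auto simp: inj_on_def)
    also have "\<dots> = (\<Sum>z\<in>S \<inter> bigraded_support I. f z)"
    proof (rule sum.mono_neutral_right)
      show "\<forall>z\<in>(\<lambda>k. (k, k)) ` K - S \<inter> bigraded_support I. f z = 0"
      proof
        fix z assume z: "z \<in> (\<lambda>k. (k, k)) ` K - S \<inter> bigraded_support I"
        then obtain k where k: "z = (k, k)" by auto
        show "f z = 0"
        proof (cases "(k, k) \<in> S")
          case True
          then have "I k k = {0}" using z k by (auto simp: bigraded_support_def)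
          then show ?thesis using f[of k k] k by simp
        next
          case False
          then show ?thesis using x k by (simp add: f_def)
        qed
      qed
    qed (use K supp in auto)
    finally show "x \<in> bigraded_sum I S" unfolding bigraded_sum_def using f by blast
  qed
  have big: "is_bigrading U I"
    unfolding is_bigrading_def
  proof (intro conjI allI impI)
    show "bigraded_sum I UNIV = U" by (simp add: bsum)
    fix f p q assume f: "(\<forall>p q. f (p, q) \<in> I p q) \<and> (\<Sum>z\<in>bigraded_support I. f z) = 0"
    show "f (p, q) = 0"
    proof (cases "(p, q) \<in> bigraded_support I")
      case True
      then have pq: "p = q" using supp by auto
      have "0 = c p (\<Sum>z\<in>bigraded_support I. f z)" using f c0 by simp
      also have "\<dots> = (\<Sum>z\<in>bigraded_support I. if z = (p, p) then f z else 0)"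
        unfolding csum using cf[of f] f by (intro sum.cong) auto
      also have "\<dots> = f (p, p)" using fin True pq by (simp add: sum.delta)
      finally show ?thesis using pq by simp
    next
      case False
      then have "I p q = {0}" by (simp add: bigraded_support_def)
      then show ?thesis using f by blast
    qed
  qed (use Isub fin in auto)
  have conj: "vconj ` I p q + bigraded_sum I {(r, s). r < q \<and> s < p} = I q p + bigraded_sum I {(r, s). r < q \<and> s < p}" for p q
  proof (cases "p = q")
    case False
    then show ?thesis by (simp add: I_def)
  next
    case True
    let ?L = "bigraded_sum I {(r, s). r < p \<and> s < p}"
    have "2 * k > 2 * p - 2 \<longleftrightarrow> \<not> k < p" for k by auto
    then have L: "?L = complexify (W (2 * p - 2))" by (intro set_eqI) (simp only: W bsum, auto)
    have M: "I p p + ?L = complexify (W (2 * p))"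
    proof (intro set_eqI iffI)
      fix x assume "x \<in> I p p + ?L"
      then obtain y z where yz: "x = y + z" "y \<in> U" "c p y = y" "z \<in> ?L"
        by (auto simp: set_plus_def I_def)
      have "c k y = 0" if "2 * k > 2 * p" for k
      proof -
        have "c k y = c k (c p y)" by (simp add: yz(3))
        also have "\<dots> = 0" using that by (simp add: cc)
        finally show ?thesis .
      qed
      then show "x \<in> complexify (W (2 * p))"
        using yz by (auto simp: W bsum add intro: cvs.subspace_add[OF U])
    next
      fix x assume x: "x \<in> complexify (W (2 * p))"
      have "c p x \<in> I p p" using x mem by (simp add: I_def W cc)
      moreover have "x - c p x \<in> ?L"
        unfolding bsum using x mem by (auto simp: W cdiff cc intro: cvs.subspace_diff[OF U])
      moreover have "x = c p x + (x - c p x)" by simp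
      ultimately show "x \<in> I p p + ?L" by (metis set_plus_intro)
    qed
    have "vconj ` I p p + ?L = I p p + ?L"
    proof (intro set_eqI iffI)
      fix x assume "x \<in> vconj ` I p p + ?L"
      then obtain y z where yz: "x = vconj y + z" "y \<in> I p p" "z \<in> ?L" by (auto simp: set_plus_def)
      have "vconj z \<in> ?L" using yz(3) W_conj unfolding L by blast
      then have "y + vconj z \<in> complexify (W (2 * p))" unfolding M[symmetric] using yz(2) by (rule set_plus_intro[rotated])
      then have "vconj (y + vconj z) \<in> complexify (W (2 * p))" by (rule W_conj)
      then show "x \<in> I p p + ?L" unfolding M by (simp add: yz(1) vconj_add vconj_vconj)
    next
      fix x assume "x \<in> I p p + ?L"
      then have "vconj x \<in> I p p + ?L" unfolding M by (rule W_conj)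
      then obtain y z where yz: "vconj x = y + z" "y \<in> I p p" "z \<in> ?L" by (auto simp: set_plus_def)
      have "vconj z \<in> ?L" using yz(3) W_conj unfolding L by blast
      moreover have "x = vconj y + vconj z" using arg_cong[OF yz(1), of vconj] by (simp add: vconj_vconj vconj_add)
      ultimately show "x \<in> vconj ` I p p + ?L" using yz(2) by (metis imageI set_plus_intro)
    qed
    then show ?thesis using True by simp
  qed
  have "deligne_splitting U W F I"
    unfolding deligne_splitting_def Let_def
  proof (intro conjI allI)
    show "is_bigrading U I" by (rule big)
    show "complexify (W k) = bigraded_sum I {(p, q). p + q \<le> k}" for k
      by (rule set_eqI) (simp add: W bsum not_le flip: mult_2)
    show "F p = bigraded_sum I {(r, s). p \<le> r}" for p
      by (rule set_eqI) (auto simp: F bsum not_le)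
    show "vconj ` I p q + bigraded_sum I {(r, s). r < q \<and> s < p}
        = I q p + bigraded_sum I {(r, s). r < q \<and> s < p}" for p q
      by (rule conj)
  qed
  moreover have "\<forall>p q. p \<noteq> q \<longrightarrow> I p q = {0}" by (simp add: I_def)
  ultimately show ?thesis unfolding hodge_tate_def by blast
qed

lemma vconj_complexify:
  assumes "subspace A" "A \<subseteq> real_points U" "x \<in> complexify A" shows "vconj x \<in> complexify A"
proof -
  obtain u v where *: "x = u + \<i> *\<^sub>C v" "u \<in> A" "v \<in> A" using assms(3) by (auto simp: complexify_def)
  then have "vconj u = u" "vconj v = v" using assms(2) by (auto simp: real_points_def)
  then have "vconj x = u + \<i> *\<^sub>C (- v)" by (simp add: *(1) vconj_add vconj_scaleC)
  then show ?thesis using * subspace_neg[OF assms(1)] unfolding complexify_def by blast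
qed

lemma real_mem_complexify:
  assumes "A \<subseteq> real_points U" and "a + \<i> *\<^sub>C b \<in> complexify A" "vconj a = a" "vconj b = b"
  shows "a \<in> A" "b \<in> A"
proof -
  obtain u v where *: "a + \<i> *\<^sub>C b = u + \<i> *\<^sub>C v" "u \<in> A" "v \<in> A" using assms(2) by (auto simp: complexify_def)
  then have r: "vconj u = u" "vconj v = v" using assms(1) by (auto simp: real_points_def)
  have "a - \<i> *\<^sub>C b = u - \<i> *\<^sub>C v"
    using arg_cong[OF *(1), of vconj] by (simp add: vconj_add vconj_scaleC assms r)
  then have "(a + \<i> *\<^sub>C b) + (a - \<i> *\<^sub>C b) = (u + \<i> *\<^sub>C v) + (u - \<i> *\<^sub>C v)" using *(1) by simp
  then have "2 *\<^sub>R a = 2 *\<^sub>R u" by (simp add: scaleR_2)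
  then have a: "a = u" by simp
  then have "\<i> *\<^sub>C b = \<i> *\<^sub>C v" using *(1) by simp
  then have "b = v" by simp
  then show "a \<in> A" "b \<in> A" using a * by auto
qed

lemma subset_complexify: "subspace A \<Longrightarrow> A \<subseteq> complexify A"
proof
  fix x assume "subspace A" "x \<in> A"
  moreover have "x = x + \<i> *\<^sub>C 0" by simp
  ultimately show "x \<in> complexify A" unfolding complexify_def using subspace_0 by blast
qed

context real_isotropy_limit
begin

lemma hodge_tate_standard:
  assumes ss: "semisimple_lie (gC n F0)" and W: "\<And>k. complexify (W k) = Wc k"
  shows "hodge_tate UNIV W F"
proof (rule hodge_tate_of_grading[where c="\<lambda>k v. eF k *v v" and K="{0..int n}"])
  show "x \<in> complexify (W l) \<longleftrightarrow> x \<in> UNIV \<and> (\<forall>k. l < 2 * k \<longrightarrow> eF k *v x = 0)" for l x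
  proof -
    have "(\<forall>p q. p + q > l \<longrightarrow> eF p *v (eS q *v x) = 0) \<longleftrightarrow> (\<forall>k. l < 2 * k \<longrightarrow> eF k *v x = 0)"
      by (auto simp: gF.e_e_vec simp flip: eF_eq_eS[OF ss])
    then show ?thesis by (simp add: W W_iff)
  qed
qed (auto simp: W W_vconj F_iff gF.e_e_vec gF.decomp gF.support matrix_vector_right_distrib mat_vec_scaleC)

lemma W_degree_iff:
  assumes ss: "semisimple_lie (gC n F0)"
  shows "(\<forall>m. \<forall>v\<in>Wc m. X *v v \<in> Wc (m + l)) \<longleftrightarrow> (\<forall>k. 2 * k > l \<longrightarrow> component n eF k X = 0)"
proof -
  have Wi: "v \<in> Wc m \<longleftrightarrow> (\<forall>k. 2 * k > m \<longrightarrow> eF k *v v = 0)" for v m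
    unfolding W_iff by (auto simp: gF.e_e_vec simp flip: eF_eq_eS[OF ss])
  show ?thesis
  proof (intro iffI allI impI ballI)
    fix k assume a: "\<forall>m. \<forall>v\<in>Wc m. X *v v \<in> Wc (m + l)" and k: "2 * k > l"
    show "component n eF k X = 0"
    proof (rule gF.component_eq_0I)
      fix p
      show "eF (p + k) ** X ** eF p = 0"
      proof (rule mat_eqI)
        fix v
        have "eF p *v v \<in> Wc (2 * p)" by (simp add: Wi gF.e_e_vec)
        then have "X *v (eF p *v v) \<in> Wc (2 * p + l)" using a by blast
        then have "eF (p + k) *v (X *v (eF p *v v)) = 0" using k by (simp add: Wi)
        then show "(eF (p + k) ** X ** eF p) *v v = 0 *v v" by (simp flip: matrix_vector_mul_assoc)
      qed
    qed
  next
    fix m v assume a: "\<forall>k. 2 * k > l \<longrightarrow> component n eF k X = 0" and v: "v \<in> Wc m"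
    have "eF q *v (X *v v) = 0" if q: "2 * q > m + l" for q
    proof -
      have "(eF q ** X ** eF p) *v v = 0" for p
      proof (cases "2 * p > m")
        case True
        then have "eF p *v v = 0" using v by (simp add: Wi)
        then show ?thesis by (simp flip: matrix_vector_mul_assoc)
      next
        case False
        then have "component n eF (q - p) X = 0" using a q by simp
        then have "eF q ** X ** eF p = 0" using gF.component_block[of q "q - p" X p] by simp
        then show ?thesis by simp
      qed
      then show ?thesis by (simp add: gF.apply_block_sum)
    qed
    then show "X *v v \<in> Wc (m + l)" by (simp add: Wi)
  qed
qed

text \<open>The grading \<open>eF\<close> induces a grading of \<open>\<gg>\<close> which splits the adjoint Hodge filtration; it also splits the adjoint weight
  filtration because \<open>W\<close> is given by twice the \<open>eF\<close>-degree.\<close>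

lemma hodge_tate_adjoint:
  assumes ss: "semisimple_lie (gC n F0)" and W: "\<And>k. complexify (W k) = Wc k"
    and Ws: "\<And>k. subspace (W k)" and Wr: "\<And>k. W k \<subseteq> real_points UNIV"
  shows "hodge_tate (gC n F0) (adjoint_W n F0 W) (adjoint_F n F0 F)"
proof -
  define M where "M = (\<lambda>l. {X \<in> gC n F0. \<forall>m. \<forall>v\<in>Wc m. X *v v \<in> Wc (m + l)})"
  have Mc: "vconj X \<in> M l" if X: "X \<in> M l" for X l
  proof -
    have "vconj X *v v \<in> Wc (m + l)" if v: "v \<in> Wc m" for m v
    proof -
      have "X *v vconj v \<in> Wc (m + l)" using X W_vconj[OF v] by (simp add: M_def)
      then have "vconj (X *v vconj v) \<in> Wc (m + l)" by (rule W_vconj)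
      then show ?thesis by (simp add: vconj_mat_vec vconj_vconj)
    qed
    then show ?thesis using X gC_vconj by (simp add: M_def)
  qed
  have Ms: "cvs.subspace (M l)" for l
    using gC_csubspace W_csubspace
    by (auto simp: M_def cvs.subspace_def matrix_vector_mult_add_rdistrib scaleC_mat_vec)
  have "adjoint_W n F0 W l = real_points (M l)" for l
  proof (intro set_eqI iffI)
    fix X assume X: "X \<in> adjoint_W n F0 W l"
    then have g: "X \<in> gC n F0" "vconj X = X" by (auto simp: adjoint_W_def gR_iff)
    have "X *v v \<in> Wc (m + l)" if v: "v \<in> Wc m" for m v
    proof -
      obtain a b where ab: "v = a + \<i> *\<^sub>C b" "a \<in> W m" "b \<in> W m" 
        using v unfolding W[symmetric] complexify_def by blast
      have "X *v a \<in> W (m + l)" "X *v b \<in> W (m + l)" using X ab by (auto simp: adjoint_W_def)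
      then have "X *v a + \<i> *\<^sub>C (X *v b) \<in> Wc (m + l)" unfolding W[symmetric] complexify_def by blast
      then show ?thesis by (simp add: ab(1) matrix_vector_right_distrib mat_vec_scaleC)
    qed
    then show "X \<in> real_points (M l)" using g by (simp add: real_points_def M_def)
  next
    fix X assume X: "X \<in> real_points (M l)"
    then have g: "X \<in> gC n F0" "vconj X = X" by (auto simp: real_points_def M_def)
    have "X *v a \<in> W (m + l)" if a: "a \<in> W m" for a m
    proof (rule real_mem_complexify(1)[OF Wr, of _ 0])
      have "a \<in> Wc m" using a subset_complexify[OF Ws] unfolding W[symmetric] by blast
      then show "X *v a + \<i> *\<^sub>C 0 \<in> complexify (W (m + l))" using X by (simp add: real_points_def M_def W)
      have "vconj a = a" using a Wr by (auto simp: real_points_def)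
      then show "vconj (X *v a) = X *v a" by (simp add: vconj_mat_vec g)
    qed simp
    then show "X \<in> adjoint_W n F0 W l" using g by (auto simp: adjoint_W_def gR_iff)
  qed
  then have cM: "complexify (adjoint_W n F0 W l) = M l" for l
    using conj_stable_eq_complexify[OF Ms Mc] by simp
  show ?thesis
  proof (rule hodge_tate_of_grading[where c="component n eF" and K="{- int n..int n}"])
    show "X \<in> complexify (adjoint_W n F0 W l) \<longleftrightarrow> X \<in> gC n F0 \<and> (\<forall>k. l < 2 * k \<longrightarrow> component n eF k X = 0)" for l X
      unfolding cM M_def mem_Collect_eq W_degree_iff[OF ss] ..
    show "X \<in> adjoint_F n F0 F p \<longleftrightarrow> X \<in> gC n F0 \<and> (\<forall>k<p. component n eF k X = 0)" for X p
    proof -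
      have "(\<forall>r q. q < r + p \<longrightarrow> eF q ** X ** eF r = 0) \<longleftrightarrow> (\<forall>k<p. component n eF k X = 0)"
      proof (intro iffI allI impI)
        fix k assume "\<forall>r q. q < r + p \<longrightarrow> eF q ** X ** eF r = 0" "k < p"
        then show "component n eF k X = 0" by (intro gF.component_eq_0I) simp
      next
        fix r q assume "\<forall>k<p. component n eF k X = 0" "q < r + p"
        then have "component n eF (q - r) X = 0" by simp
        then show "eF q ** X ** eF r = 0" using gF.component_block[of q "q - r" X r] by simp
      qed
      then show ?thesis by (simp add: adjoint_F_F_iff)
    qed
    show "vconj X \<in> complexify (adjoint_W n F0 W l)" if "X \<in> complexify (adjoint_W n F0 W l)" for X l
      using that Mc by (simp add: cM)
  qed (auto simp: gC_csubspace component_eF_mem gF.component_add gF.component_scale gF.component_component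
     gF.component_sum gF.component_out_of_range)
qed

end

section \<open>Fields of definition of stabilizers\<close>

lemma poly_funs_real_imaginary:
  assumes "f \<in> poly_funs UNIV"
  shows "\<exists>g\<in>poly_funs \<real>. \<exists>h\<in>poly_funs \<real>. \<forall>A::complex^'n^'n. f A = g A + \<i> * h A"
  using assms
proof (induction rule: poly_funs.induct)
  case (const c)
  have "(\<lambda>A::complex^'n^'n. complex_of_real (Re c)) \<in> poly_funs \<real>" "(\<lambda>A::complex^'n^'n. complex_of_real (Im c)) \<in> poly_funs \<real>"
    by (auto intro: poly_funs.const)
  moreover have "c = complex_of_real (Re c) + \<i> * complex_of_real (Im c)" by (simp add: complex_eq_iff)
  ultimately show ?case by fast
next
  case (entry i j)
  have "(\<lambda>A::complex^'n^'n. 0) \<in> poly_funs \<real>" by (auto intro: poly_funs.const)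
  moreover have "(\<lambda>A::complex^'n^'n. A $ i $ j) \<in> poly_funs \<real>" by (rule poly_funs.entry)
  moreover have "A $ i $ j = A $ i $ j + \<i> * 0" for A :: "complex^'n^'n" by simp
  ultimately show ?case
    by (rule_tac x="\<lambda>A. A $ i $ j" in bexI, rule_tac x="\<lambda>A. 0" in bexI) auto
next
  case (add f f')
  then obtain g h g' h' where *: "g \<in> poly_funs \<real>" "h \<in> poly_funs \<real>" "\<forall>A. f A = g A + \<i> * h A"
     "g' \<in> poly_funs \<real>" "h' \<in> poly_funs \<real>" "\<forall>A. f' A = g' A + \<i> * h' A" by blast
  have "(\<lambda>A. g A + g' A) \<in> poly_funs \<real>" "(\<lambda>A. h A + h' A) \<in> poly_funs \<real>" using * by (auto intro: poly_funs.add)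
  then show ?case
    by (rule_tac x="\<lambda>A. g A + g' A" in bexI, rule_tac x="\<lambda>A. h A + h' A" in bexI)
       (simp_all add: *(3,6) algebra_simps)
next
  case (mult f f')
  then obtain g h g' h' where *: "g \<in> poly_funs \<real>" "h \<in> poly_funs \<real>" "\<forall>A. f A = g A + \<i> * h A"
     "g' \<in> poly_funs \<real>" "h' \<in> poly_funs \<real>" "\<forall>A. f' A = g' A + \<i> * h' A" by blast
  have m: "(\<lambda>A. -1 :: complex) \<in> poly_funs \<real>" by (auto intro: poly_funs.const)
  have "(\<lambda>A. g A * g' A + (-1) * (h A * h' A)) \<in> poly_funs \<real>" "(\<lambda>A. g A * h' A + h A * g' A) \<in> poly_funs \<real>"
    by (intro poly_funs.add poly_funs.mult m *)+
  moreover have "(g A + \<i> * h A) * (g' A + \<i> * h' A)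
      = (g A * g' A + (-1) * (h A * h' A)) + \<i> * (g A * h' A + h A * g' A)" for A
    by (simp add: algebra_simps)
  ultimately show ?case
    by (rule_tac x="\<lambda>A. g A * g' A + (-1) * (h A * h' A)" in bexI,
        rule_tac x="\<lambda>A. g A * h' A + h A * g' A" in bexI) (simp_all only: *(3,6) simp_thms)
qed

text \<open>Write the equations as \<open>f = g + \<i> h\<close> with real \<open>g\<close> and \<open>h\<close>.  At a point \<open>A\<close> whose conjugate also satisfies \<open>f\<close>, the numbers \<open>g A + \<i> h A\<close> and
  \<open>g A - \<i> h A\<close> both vanish.\<close>

lemma defined_over_real_of_conj_stable:
  assumes H: "defined_over UNIV H" and c: "\<And>A. A \<in> H \<Longrightarrow> vconj A \<in> H"
  shows "defined_over \<real> H"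
proof -
  obtain S where S: "S \<subseteq> poly_funs UNIV" "H = {A. invertible A \<and> (\<forall>f\<in>S. f A = 0)}"
    using H by (auto simp: defined_over_def)
  have "\<forall>f\<in>S. \<exists>gh. fst gh \<in> poly_funs \<real> \<and> snd gh \<in> poly_funs \<real> \<and> (\<forall>A. f A = fst gh A + \<i> * snd gh A)"
  proof
    fix f assume "f \<in> S"
    then obtain g h where "g \<in> poly_funs \<real>" "h \<in> poly_funs \<real>" "\<forall>A. f A = g A + \<i> * h A"
      using poly_funs_real_imaginary[of f] S(1) by blast
    then show "\<exists>gh. fst gh \<in> poly_funs \<real> \<and> snd gh \<in> poly_funs \<real> \<and> (\<forall>A. f A = fst gh A + \<i> * snd gh A)"
      by (intro exI[of _ "(g, h)"]) simp
  qed
  then obtain r where r: "\<forall>f\<in>S. fst (r f) \<in> poly_funs \<real> \<and> snd (r f) \<in> poly_funs \<real> \<and> (\<forall>A. f A = fst (r f) A + \<i> * snd (r f) A)"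
    by (rule bchoice[THEN exE])
  let ?S = "(\<lambda>f. fst (r f)) ` S \<union> (\<lambda>f. snd (r f)) ` S"
  have "H = {A. invertible A \<and> (\<forall>f\<in>?S. f A = 0)}"
  proof (intro set_eqI iffI)
    fix A assume A: "A \<in> H"
    have "fst (r f) A = 0 \<and> snd (r f) A = 0" if f: "f \<in> S" for f
    proof -
      have "f A = 0" "f (vconj A) = 0" using A c[OF A] f S(2) by auto
      moreover have "fst (r f) (vconj A) = cnj (fst (r f) A)" "snd (r f) (vconj A) = cnj (snd (r f) A)"
        using r f by (auto intro: poly_funs_vconj)
      ultimately have 1: "fst (r f) A + \<i> * snd (r f) A = 0" and 2: "cnj (fst (r f) A) + \<i> * cnj (snd (r f) A) = 0"
        using r f by auto
      have "fst (r f) A - \<i> * snd (r f) A = 0" using arg_cong[OF 2, of cnj] by simp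
      then show ?thesis using 1 by (simp add: eq_neg_iff_add_eq_0)
    qed
    then show "A \<in> {A. invertible A \<and> (\<forall>f\<in>?S. f A = 0)}" using A S(2) by auto
  next
    fix A assume "A \<in> {A. invertible A \<and> (\<forall>f\<in>?S. f A = 0)}"
    then have z: "fst (r f) A = 0" "snd (r f) A = 0" if "f \<in> S" for f
      using that by auto
    have "f A = fst (r f) A + \<i> * snd (r f) A" if "f \<in> S" for f using r that by blast
    then have "f A = 0" if "f \<in> S" for f by (simp add: z that)
    then show "A \<in> H" using \<open>A \<in> {A. invertible A \<and> (\<forall>f\<in>?S. f A = 0)}\<close> S(2) by blast
  qed
  moreover have "?S \<subseteq> poly_funs \<real>" using r by auto
  ultimately show ?thesis unfolding defined_over_def by blast
qed

context mt_group
begin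

text \<open>A group with real equations is conjugation stable, and so is its Lie algebra.\<close>

lemma isotropy_real_of_stabilizer_real:
  assumes x: "\<And>p. cvs.subspace (x p)" and P: "defined_over \<real> (stabC n F0 x)" and X: "X \<in> isotropy n F0 x"
  shows "vconj X \<in> isotropy n F0 x"
proof -
  obtain S where S: "S \<subseteq> poly_funs \<real>" "stabC n F0 x = {A. invertible A \<and> (\<forall>f\<in>S. f A = 0)}"
    using P by (auto simp: defined_over_def)
  have c: "vconj A \<in> stabC n F0 x" if A: "A \<in> stabC n F0 x" for A
  proof -
    have "vconj A \<in> GC n F0" using A by (intro algebraic_subgroup_vconj[OF alg]) (simp add: stabC_def)
    then have "invertible (vconj A)" using algebraic_subgroup_iff_vanishing[OF alg] by blast
    moreover have "f (vconj A) = 0" if "f \<in> S" for f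
    proof -
      have "f A = 0" using A that S(2) by blast
      moreover have "f (vconj A) = cnj (f A)" using S(1) that by (intro poly_funs_vconj) blast
      ultimately show ?thesis by simp
    qed
    ultimately show ?thesis using S(2) by blast
  qed
  have "mexp (t *\<^sub>R vconj X) \<in> stabC n F0 x" for t
  proof -
    have "mexp (t *\<^sub>R X) \<in> stabC n F0 x"
      using X unfolding lie_stabC[of x, OF x, symmetric] by (simp add: lie_algebra_def)
    then have "vconj (mexp (t *\<^sub>R X)) \<in> stabC n F0 x" by (rule c)
    then show ?thesis by (simp add: vconj_scaleR flip: mexp_vconj)
  qed
  then show ?thesis unfolding lie_stabC[of x, OF x, symmetric] by (simp add: lie_algebra_def)
qed

lemma isotropy_real_act:
  assumes g: "g \<in> GR n F0" and r: "\<forall>X\<in>isotropy n F0 x. vconj X \<in> isotropy n F0 x"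
  shows "\<forall>X\<in>isotropy n F0 (act g x). vconj X \<in> isotropy n F0 (act g x)"
proof
  fix X assume "X \<in> isotropy n F0 (act g x)"
  then obtain Y where Y: "X = g ** Y ** matrix_inv g" "Y \<in> isotropy n F0 x"
    using isotropy_act[OF GR_GC[OF g]] by blast
  have "vconj X = g ** vconj Y ** matrix_inv g"
    by (simp add: Y(1) vconj_mat_mul GR_real[OF g] GR_real[OF GR_inv[OF g]])
  then show "vconj X \<in> isotropy n F0 (act g x)"
    using isotropy_act[OF GR_GC[OF g], of x] r Y(2) by blast
qed

lemma orbitR_eq:
  assumes "x \<in> orbitR n F0 y"
  shows "orbitR n F0 y = (\<lambda>g. act g x) ` GR n F0"
proof -
  obtain h where h: "h \<in> GR n F0" "x = act h y" using assms by (auto simp: orbitR_def)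
  have "act g y = act (g ** matrix_inv h) x" for g
  proof -
    have "g ** matrix_inv h ** h = g ** (matrix_inv h ** h)" by (simp only: matrix_mul_assoc)
    then show ?thesis by (simp add: h(2) act_act GC_inverse[OF GR_GC[OF h(1)]])
  qed
  then show ?thesis
    using h GR_mult GR_inv by (auto simp: orbitR_def act_act image_iff) blast
qed

lemma is_quotient_by_stabilizer:
  assumes "x \<in> orbitR n F0 y"
  shows "is_quotient_by n F0 x (stabC n F0 x \<inter> GR n F0) (orbitR n F0 y)"
  unfolding is_quotient_by_def
proof (intro conjI ballI)
  show "(\<lambda>g. act g x) ` GR n F0 = orbitR n F0 y" by (rule orbitR_eq[OF assms, symmetric])
  fix g h assume gh: "g \<in> GR n F0" "h \<in> GR n F0"
  note inv = GC_inverse[OF GR_GC[OF gh(1)]]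
  have m: "matrix_inv g ** h \<in> GR n F0" using gh GR_mult GR_inv by blast
  have "act g x = act h x \<longleftrightarrow> act (matrix_inv g ** h) x = x"
  proof
    assume e: "act g x = act h x"
    have "act (matrix_inv g ** h) x = act (matrix_inv g) (act g x)" by (simp add: e act_act)
    then show "act (matrix_inv g ** h) x = x" by (simp add: act_act inv)
  next
    assume e: "act (matrix_inv g ** h) x = x"
    have "act g x = act g (act (matrix_inv g ** h) x)" by (simp add: e)
    also have "\<dots> = act (g ** matrix_inv g ** h) x" by (simp add: act_act matrix_mul_assoc)
    finally show "act g x = act h x" by (simp add: inv)
  qed
  then show "act g x = act h x \<longleftrightarrow> matrix_inv g ** h \<in> stabC n F0 x \<inter> GR n F0"
    using m GR_GC[OF m] by (simp add: stabC_def)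
qed

end

context period_limit
begin

text \<open>As \<open>eS\<close> splits \<open>Finf\<close>, stabilizing \<open>Finf\<close> means being block triangular.\<close>

lemma stabC_iff: "A \<in> stabC n F0 Finf \<longleftrightarrow> A \<in> GC n F0 \<and> (\<forall>p q. q > p \<longrightarrow> eS q ** A ** eS p = 0)"
proof -
  have "act A Finf = Finf \<longleftrightarrow> (\<forall>p. \<forall>v\<in>Finf p. A *v v \<in> Finf (p - 0))" if A: "A \<in> GC n F0"
  proof
    assume "act A Finf = Finf"
    then have "act A Finf p = Finf p" for p by simp
    then show "\<forall>p. \<forall>v\<in>Finf p. A *v v \<in> Finf (p - 0)" by (auto simp: act_def)
  next
    assume a: "\<forall>p. \<forall>v\<in>Finf p. A *v v \<in> Finf (p - 0)"
    show "act A Finf = Finf"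
    proof
      fix p
      have "inj_on (\<lambda>v. A *v v) (span (Finf p))"
      proof (rule inj_on_inverseI[where g="\<lambda>v. matrix_inv A *v v"])
        show "matrix_inv A *v (A *v v) = v" for v by (simp add: matrix_vector_mul_assoc GC_inverse[OF A])
      qed
      then have "dim (act A Finf p) = dim (Finf p)" by (simp add: act_def dim_image_eq[OF linear_mat_vec])
      then show "act A Finf p = Finf p"
        using a csubspace_act[of Finf p A] Finf_csubspace
        by (intro subspace_dim_equal subspace_of_csubspace) (auto simp: act_def)
    qed
  qed
  moreover have "(\<forall>q. \<forall>v\<in>Phi q. A *v v \<in> Phi (q + 0)) \<longleftrightarrow> (\<forall>q. \<forall>v\<in>down eS q. A *v v \<in> down eS (q + 0))"
    unfolding Ball_def by (simp add: Phi_eq)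
  ultimately show ?thesis
    unfolding stabC_def mem_Collect_eq Finf_shift gS.raises_down_iff by auto
qed

lemma stabC_defined_over: "defined_over UNIV (stabC n F0 Finf)"
proof -
  let ?f = "\<lambda>q p i j A. (eS q ** A ** eS p) $ i $ j"
  define S where "S = vanishing (GC n F0) \<union> {?f q p i j | q p i j. q > p}"
  have "?f q p i j \<in> poly_funs UNIV" for q p i j
    unfolding matrix_matrix_mult_def by (auto intro!: poly_funs_sum poly_funs.intros)
  then have "S \<subseteq> poly_funs UNIV" by (auto simp: S_def vanishing_def)
  moreover have "stabC n F0 Finf = {A. invertible A \<and> (\<forall>f\<in>S. f A = 0)}"
  proof (rule set_eqI)
    fix A
    have "(\<forall>p q. q > p \<longrightarrow> eS q ** A ** eS p = 0) \<longleftrightarrow> (\<forall>f\<in>{?f q p i j | q p i j. q > p}. f A = 0)"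
      (is "?L \<longleftrightarrow> ?R")
    proof
      assume ?L
      then show ?R by auto
    next
      assume R: ?R
      have "(eS q ** A ** eS p) $ i $ j = 0" if "q > p" for p q i j
      proof -
        have "?f q p i j \<in> {?f q p i j | q p i j. q > p}" using that by blast
        with R have "?f q p i j A = 0" by (rule bspec)
        then show ?thesis .
      qed
      then show ?L by (simp add: vec_eq_iff)
    qed
    then show "A \<in> stabC n F0 Finf \<longleftrightarrow> A \<in> {A. invertible A \<and> (\<forall>f\<in>S. f A = 0)}"
      unfolding stabC_iff algebraic_subgroup_iff_vanishing[OF alg, of A] S_def
      by (simp only: ball_Un mem_Collect_eq conj_assoc)
  qed
  ultimately show ?thesis unfolding defined_over_def by blast
qed

lemma stabC_defined_over_real:
  assumes "\<And>p. vconj ` Finf p = Finf p"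
  shows "defined_over \<real> (stabC n F0 Finf)"
proof (rule defined_over_real_of_conj_stable[OF stabC_defined_over])
  fix A assume A: "A \<in> stabC n F0 Finf"
  then have "vconj A \<in> GC n F0" by (intro algebraic_subgroup_vconj[OF alg]) (simp add: stabC_def)
  moreover have "act (vconj A) Finf p = Finf p" for p
  proof -
    have "act (vconj A) Finf p = (\<lambda>v. vconj A *v v) ` vconj ` Finf p" by (simp add: act_def assms)
    also have "\<dots> = vconj ` act A Finf p" by (simp add: act_def image_image vconj_mat_vec)
    also have "\<dots> = Finf p" using A by (simp add: stabC_def assms)
    finally show ?thesis .
  qed
  ultimately show "vconj A \<in> stabC n F0 Finf" by (auto simp: stabC_def)
qed

end

section \<open>Limiting mixed Hodge structures\<close>

lemma mt_hodge_of_polarized: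
  assumes "polarized_hodge_structure n Q F0"
  shows "mt_hodge n F0"
proof
  note h = assms[unfolded polarized_hodge_structure_def]
  have opp: "F0 p + vconj ` F0 (int n - p + 1) = UNIV" "F0 p \<inter> vconj ` F0 (int n - p + 1) = {0}" for p
    using h by blast+
  show "\<exists>b. v - b \<in> F0 p \<and> vconj b \<in> F0 (int n - p + 1)" for v p
  proof -
    have "v \<in> F0 p + vconj ` F0 (int n - p + 1)" using opp(1) by simp
    then obtain a b where "v = a + vconj b" "a \<in> F0 p" "b \<in> F0 (int n - p + 1)"
      by (auto simp: set_plus_def)
    then show ?thesis by (intro exI[of _ "vconj b"]) (simp add: vconj_vconj)
  qed
  show "v = 0" if "v \<in> F0 p" "vconj v \<in> F0 (int n - p + 1)" for v p
  proof -
    have "v \<in> vconj ` F0 (int n - p + 1)" using that(2) by (intro image_eqI[of _ _ "vconj v"]) (simp_all add: vconj_vconj)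
    then show ?thesis using opp(2)[of p] that(1) by blast
  qed
qed (use assms in \<open>auto simp: polarized_hodge_structure_def\<close>)

context mt_hodge
begin

lemma compact_dual_filtration:
  assumes "x \<in> compact_dual n F0"
  shows "p \<le> q \<Longrightarrow> x q \<subseteq> x p" and "p \<le> 0 \<Longrightarrow> x p = UNIV" and "p > int n \<Longrightarrow> x p = {0}"
proof -
  obtain g where g: "g \<in> GC n F0" "x = act g F0" using assms by (auto simp: compact_dual_def)
  show "p \<le> q \<Longrightarrow> x q \<subseteq> x p" using F0_antimono[of p q] by (auto simp: g(2) act_def)
  show "p > int n \<Longrightarrow> x p = {0}" by (simp add: g(2) act_def F0_high)
  have "v = g *v (matrix_inv g *v v)" for v
    by (simp add: matrix_vector_mul_assoc GC_inverse[OF g(1)])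
  then show "p \<le> 0 \<Longrightarrow> x p = UNIV" by (auto simp: g(2) act_def F0_low)
qed

lemma compact_dual_orbit: "x \<in> compact_dual n F0 \<Longrightarrow> orbitR n F0 x \<subseteq> compact_dual n F0"
  using GR_GC GC_mult by (fastforce simp: compact_dual_def orbitR_def act_act)

text \<open>The conditions on the real filtration pass to its complexification by splitting vectors into real and imaginary parts.\<close>

lemma limit_mhs_data_of_limiting_mhs:
  assumes lm: "limiting_mhs n F0 W F N"
  shows "limit_mhs_data n F (\<lambda>k. complexify (W k)) N"
proof -
  have no: "nilpotent_orbit n F0 F N" and mw: "monodromy_weight_filtration N (int n) W"
    and mh: "mixed_hodge_structure UNIV W F" using lm by (simp_all add: limiting_mhs_def)
  have Fd: "F \<in> compact_dual n F0" and NR: "N \<in> gR n F0" and NF: "\<And>p. (\<lambda>v. N *v v) ` F p \<subseteq> F (p - 1)"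
    using no by (simp_all add: nilpotent_orbit_def)
  have Nr: "vconj N = N" using NR by (simp add: gR_iff)
  have Ws: "subspace (W k)" and Wr: "W k \<subseteq> real_points UNIV" and NW: "(\<lambda>v. N *v v) ` W k \<subseteq> W (k - 2)" for k
    using mw by (simp_all add: monodromy_weight_filtration_def)
  have Wm: "k \<le> l \<Longrightarrow> W k \<subseteq> W l" for k l using mw by (simp add: monodromy_weight_filtration_def)
  have lef: "(\<lambda>v. mpow N l *v v) ` W (int n + int l) + W (int n - int l - 1) = W (int n - int l)" for l
    using mw by (simp add: monodromy_weight_filtration_def)
  have gr: "(F p \<inter> complexify (W k) + complexify (W (k - 1))) + (vconj ` F (k - p + 1) \<inter> complexify (W k) + complexify (W (k - 1))) = complexify (W k)"
    "(F p \<inter> complexify (W k) + complexify (W (k - 1))) \<inter> (vconj ` F (k - p + 1) \<inter> complexify (W k) + complexify (W (k - 1))) = complexify (W (k - 1))" for p k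
    using mh by (simp_all add: mixed_hodge_structure_def Let_def)
  have cW: "cvs.subspace (complexify (W k))" for k by (rule csubspace_complexify[OF Ws])
  have split: "\<exists>a b. v = a + \<i> *\<^sub>C b \<and> a \<in> W k \<and> b \<in> W k \<and> vconj a = a \<and> vconj b = b" if "v \<in> complexify (W k)" for v k
    using that Wr[of k] unfolding complexify_def real_points_def by blast
  have mk: "a + \<i> *\<^sub>C b \<in> complexify (W k)" if "a \<in> W k" "b \<in> W k" for a b k
    using that unfolding complexify_def by blast
  have Nv: "A *v (a + \<i> *\<^sub>C b) = A *v a + \<i> *\<^sub>C (A *v b)" for A :: "complex^'n^'n" and a b
    by (simp add: matrix_vector_right_distrib mat_vec_scaleC)
  show ?thesis
  proof
    show "cvs.subspace (F p)" for p by (rule compact_dual_csubspace[OF Fd])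
    show "F q \<subseteq> F p" if "p \<le> q" for p q by (rule compact_dual_filtration(1)[OF Fd that])
    show "F p = UNIV" if "p \<le> 0" for p by (rule compact_dual_filtration(2)[OF Fd that])
    show "F p = {0}" if "p > int n" for p by (rule compact_dual_filtration(3)[OF Fd that])
    show "cvs.subspace (complexify (W k))" for k by (rule cW)
    show "complexify (W k) \<subseteq> complexify (W l)" if "k \<le> l" for k l
      using Wm[OF that] unfolding complexify_def by blast
    show "\<exists>k. complexify (W k) = {0}"
    proof -
      obtain k where "W k = {0}" using mw by (auto simp: monodromy_weight_filtration_def)
      then show ?thesis by (intro exI[of _ k]) (simp add: complexify_def)
    qed
    show "\<exists>k. complexify (W k) = UNIV"
    proof -
      obtain k where "W k = real_points UNIV" using mw by (auto simp: monodromy_weight_filtration_def)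
      then show ?thesis using conj_stable_eq_complexify[of UNIV] by (intro exI[of _ k]) simp
    qed
    show "vconj v \<in> complexify (W k)" if "v \<in> complexify (W k)" for v k
      by (rule vconj_complexify[OF Ws Wr that])
    show "\<exists>a\<in>F p \<inter> complexify (W k). \<exists>b\<in>complexify (W k). vconj b \<in> F (k - p + 1) \<and> w - a - b \<in> complexify (W (k - 1))"
      if w: "w \<in> complexify (W k)" for w k p
    proof -
      have "w \<in> (F p \<inter> complexify (W k) + complexify (W (k - 1))) + (vconj ` F (k - p + 1) \<inter> complexify (W k) + complexify (W (k - 1)))"
        using w by (simp only: gr(1))
      then obtain a x b y where *: "w = (a + x) + (b + y)" "a \<in> F p \<inter> complexify (W k)" "x \<in> complexify (W (k - 1))"
        "b \<in> vconj ` F (k - p + 1)" "b \<in> complexify (W k)" "y \<in> complexify (W (k - 1))"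
        unfolding set_plus_def by blast
      have "w - a - b = x + y" by (simp add: *(1))
      then have "w - a - b \<in> complexify (W (k - 1))" using * by (simp add: cvs.subspace_add[OF cW])
      moreover have "vconj b \<in> F (k - p + 1)" using *(4) by (auto simp: vconj_vconj)
      ultimately show ?thesis using * by blast
    qed
    show "a \<in> complexify (W (k - 1))"
      if *: "a \<in> F p" "a \<in> complexify (W k)" "b \<in> complexify (W k)" "vconj b \<in> F (k - p + 1)"
        "a - b \<in> complexify (W (k - 1))" for a b p k
    proof -
      have "a + 0 \<in> F p \<inter> complexify (W k) + complexify (W (k - 1))"
        using * cvs.subspace_0[OF cW] by (intro set_plus_intro) auto
      moreover have "b \<in> vconj ` F (k - p + 1)"
        using *(4) by (intro image_eqI[of _ _ "vconj b"]) (simp_all add: vconj_vconj)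
      then have "b + (a - b) \<in> vconj ` F (k - p + 1) \<inter> complexify (W k) + complexify (W (k - 1))"
        using * by (intro set_plus_intro) auto
      ultimately have "a \<in> (F p \<inter> complexify (W k) + complexify (W (k - 1))) \<inter>
          (vconj ` F (k - p + 1) \<inter> complexify (W k) + complexify (W (k - 1)))" by simp
      then show ?thesis by (simp only: gr(2))
    qed
    show "vconj N = N" by (rule Nr)
    show "N *v v \<in> F (p - 1)" if "v \<in> F p" for v p using NF[of p] that by blast
    show "N *v v \<in> complexify (W (k - 2))" if v: "v \<in> complexify (W k)" for v k
    proof -
      obtain a b where ab: "v = a + \<i> *\<^sub>C b" "a \<in> W k" "b \<in> W k" using split[OF v] by blast
      then have "N *v a \<in> W (k - 2)" "N *v b \<in> W (k - 2)" using NW[of k] by blast+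
      then show ?thesis unfolding ab(1) Nv by (rule mk)
    qed
    show "\<exists>v\<in>complexify (W (int n + int l)). u - mpow N l *v v \<in> complexify (W (int n - int l - 1))"
      if u: "u \<in> complexify (W (int n - int l))" for u l
    proof -
      have s: "\<exists>v w. a = mpow N l *v v + w \<and> v \<in> W (int n + int l) \<and> w \<in> W (int n - int l - 1)"
        if "a \<in> W (int n - int l)" for a
        using that unfolding lef[of l, symmetric] set_plus_def by blast
      obtain a b where ab: "u = a + \<i> *\<^sub>C b" "a \<in> W (int n - int l)" "b \<in> W (int n - int l)" using split[OF u] by blast
      obtain v w where v: "a = mpow N l *v v + w" "v \<in> W (int n + int l)" "w \<in> W (int n - int l - 1)"
        using s[OF ab(2)] by blast
      obtain v' w' where v': "b = mpow N l *v v' + w'" "v' \<in> W (int n + int l)" "w' \<in> W (int n - int l - 1)"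
        using s[OF ab(3)] by blast
      have "u - mpow N l *v (v + \<i> *\<^sub>C v') = w + \<i> *\<^sub>C w'"
        by (simp add: Nv ab(1) v(1) v'(1) scaleC_add_right)
      then show ?thesis using mk v v' by (intro bexI[of _ "v + \<i> *\<^sub>C v'"]) simp_all
    qed
  qed
qed

end

section \<open>Totally real closed orbits\<close>

theorem theorem1p10:
  fixes n :: nat
    and Q :: "complex^'n^'n"
    and F0 F Finf W :: "int \<Rightarrow> (complex^'n) set"
    and N :: "complex^'n^'n"
    and Ocl :: "(int \<Rightarrow> (complex^'n) set) set"
  assumes "mumford_tate_domain n Q F0"
    and "closed_orbit n F0 Ocl"
    and "polarizable_relative TYPE('m::finite) n F0 Ocl"
    and "limiting_mhs n F0 W F N"
    and "reduced_limit_period n F0 F N Finf"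
    and "Finf \<in> Ocl"
  shows
    "let P = stabC n F0 Finf;
         a = totally_real n F0 Ocl;
         b = (\<forall>x \<in> Ocl. real_orbit_dim n F0 x = compact_dual_dim n F0);
         c = (defined_over \<real> P \<and> is_quotient_by n F0 Finf (P \<inter> GR n F0) Ocl)
     in (a \<longleftrightarrow> b) \<and> (b \<longleftrightarrow> c) \<and>
        (a \<or> b \<or> c \<longrightarrow>
           hodge_tate UNIV W F \<and>
           hodge_tate (gC n F0) (adjoint_W n F0 W) (adjoint_F n F0 F))"
proof -
  have ss: "semisimple_lie (gC n F0)" and pol: "polarized_hodge_structure n Q F0"
    using assms(1) by (simp_all add: mumford_tate_domain_def)
  interpret mt_hodge n F0 by (rule mt_hodge_of_polarized[OF pol])
  interpret limit_mhs_data n F "\<lambda>k. complexify (W k)" N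
    by (rule limit_mhs_data_of_limiting_mhs[OF assms(4)])
  obtain x0 where x0: "x0 \<in> compact_dual n F0" "Ocl = orbitR n F0 x0"
    using assms(2) by (auto simp: closed_orbit_def)
  have dual: "x \<in> compact_dual n F0" if "x \<in> Ocl" for x
    using that compact_dual_orbit[OF x0(1)] x0(2) by blast
  interpret period_limit n F0 F "\<lambda>k. complexify (W k)" N Finf
    using assms(4,5) dual[OF assms(6)]
    by unfold_locales (simp_all add: limiting_mhs_def nilpotent_orbit_def gR_iff reduced_limit_period_def)
  \<comment> \<open>Each of the three conditions will be compared with the stability of the isotropy algebra at \<open>Finf\<close>.\<close>
  define R where "R = (\<lambda>x. \<forall>X\<in>isotropy n F0 x. vconj X \<in> isotropy n F0 x)"
  have Finf_orbit: "Finf \<in> orbitR n F0 x0" using assms(6) x0(2) by simp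
  \<comment> \<open>Stability does not depend on the point of the real orbit, since conjugation commutes with real group elements.\<close>
  have R: "(\<forall>x\<in>Ocl. R x) \<longleftrightarrow> R Finf"
    using isotropy_real_act assms(6) unfolding x0(2) orbitR_eq[OF Finf_orbit] by (auto simp: R_def)
  have a: "totally_real n F0 Ocl \<longleftrightarrow> R Finf"
    unfolding R[symmetric] unfolding totally_real_def R_def
    by (intro ball_cong refl cr_tangent_trivial_iff compact_dual_csubspace dual)
  have b: "(\<forall>x \<in> Ocl. real_orbit_dim n F0 x = compact_dual_dim n F0) \<longleftrightarrow> R Finf"
    unfolding R[symmetric] using orbit_dim_eq_iff[OF F0_csubspace dual] by (simp add: R_def)
  \<comment> \<open>The second half of (c) is the correspondence between orbits and cosets of the stabilizer.\<close>
  have quot: "is_quotient_by n F0 Finf (stabC n F0 Finf \<inter> GR n F0) Ocl"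
    unfolding x0(2) by (rule is_quotient_by_stabilizer[OF Finf_orbit])
  have real_case: "defined_over \<real> (stabC n F0 Finf) \<and> hodge_tate UNIV W F \<and>
      hodge_tate (gC n F0) (adjoint_W n F0 W) (adjoint_F n F0 F)" if "R Finf"
  proof -
    interpret real_isotropy_limit n F0 F "\<lambda>k. complexify (W k)" N Finf
      using that by unfold_locales (simp add: R_def)
    have W: "subspace (W k)" "W k \<subseteq> real_points UNIV" for k
      using assms(4) by (simp_all add: limiting_mhs_def monodromy_weight_filtration_def)
    show ?thesis
      using stabC_defined_over_real[OF Finf_real[OF ss]] hodge_tate_standard[OF ss, of W]
        hodge_tate_adjoint[OF ss, of W] W by blast
  qed
  have c: "defined_over \<real> (stabC n F0 Finf) \<longleftrightarrow> R Finf"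
    using real_case isotropy_real_of_stabilizer_real[of Finf, OF Finf_csubspace] unfolding R_def by blast
  show ?thesis
    unfolding Let_def a b c using quot real_case by blast
qed

end
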